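(* Let $F\in\mathcal V^\circ$. The morphism $$\kappa\colon W_F^\circ\times_{P^\circ}C^\circ\to D^\circ\times C^\circ,\qquad (w,x_1,y,t)\mapsto(u,v,y,t)=\Bigl(\frac{wy}{f_3(t)},\frac{x_1y^2}{f_3(t)},y,t\Bigr)$$ is an isomorphism. In particular it defines a birational map $W_F\times_PC\dashrightarrow D\times C$.
   Context: Work over $\mathbb C$. $\mathcal V^\circ$ is the set of sextics $F=X_0^3F_3(X_1,X_2)+F_6(X_1,X_2)$, $F_i$ homogeneous of degree $i$, such that $F_3F_6$ has no multiple roots; $f_i(t)=F_i(1,t)$. $W_F$ is the minimal resolution of $S_F=\{S^2=F\}\subset\mathbb P(3,1,1,1)$, with the fibration $\pi_F\colon W_F\to P=\mathbb P^1$ induced by $[X_0:X_1:X_2]\mapsto[X_1:X_2]$. Coordinates: $x_1=X_1/X_0$, $t=X_2/X_1$, $w=S/(X_0^2X_1)$. $P^\circ=P\setminus(\{[0:1],[1:0]\}\cup Z(F_3)\cup Z(F_6))$, with coordinate $t$. $W_F^\circ$ is the open subset of $W_F$ given by $\{(w,x_1,t): t\in P^\circ,\ w^2=x_1f_3(t)+x_1^4f_6(t)\}$. $C$ is the smooth projective model of $y^6=f_3(t)^2f_6(t)$, a 6-fold cover of $P$ via $t$, and $C^\circ=\{(y,t):t\in P^\circ,\ y^6=f_3(t)^2f_6(t)\}$ is the preimage of $P^\circ$. $D$ is the smooth projective model of $u^2=v(v^3+1)$ and $D^\circ=\{(u,v):u^2=v(v^3+1)\}\subset\mathbb A^2$.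 *)

theory Defs
  imports "HOL-Analysis.Analysis" "HOL-Library.Poly_Mapping"
begin

section \<open>Polynomials\<close>

text \<open>Complex polynomials in variables indexed by \<open>nat\<close>, and their values at a coordinate list.\<close>

type_synonym mpol = "(nat \<Rightarrow>\<^sub>0 nat) \<Rightarrow>\<^sub>0 complex"

definition Cst :: "complex \<Rightarrow> mpol" where
  "Cst c = Poly_Mapping.single 0 c"

definition Var :: "nat \<Rightarrow> mpol" where
  "Var i = Poly_Mapping.single (Poly_Mapping.single i 1) 1"

definition pvars :: "mpol \<Rightarrow> nat set" where
  "pvars p = (\<Union>m\<in>Poly_Mapping.keys p. Poly_Mapping.keys m)"

definition peval :: "mpol \<Rightarrow> complex list \<Rightarrow> complex" where
  "peval p xs = (\<Sum>m\<in>Poly_Mapping.keys p. Poly_Mapping.lookup p m *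
     (\<Prod>i\<in>Poly_Mapping.keys m. (xs ! i) ^ Poly_Mapping.lookup m i))"

text \<open>Weighted homogeneous of degree \<open>d\<close>, in the variables \<open>0, \<dots>, length a - 1\<close> of weights \<open>a\<close>.\<close>

definition whomog :: "nat list \<Rightarrow> nat \<Rightarrow> mpol \<Rightarrow> bool" where
  "whomog a d p \<longleftrightarrow> pvars p \<subseteq> {..<length a} \<and>
     (\<forall>m\<in>Poly_Mapping.keys p. (\<Sum>i\<in>Poly_Mapping.keys m. a ! i * Poly_Mapping.lookup m i) = d)"


section \<open>Spaces with functions\<close>

text \<open>
  A variety is given by its complex points, its Zariski topology and, for every open set, the
  regular functions on it; \<open>reg X U f\<close> says that \<open>U\<close> is open and that the restriction of \<open>f\<close> to
  \<open>U\<close> is regular (the values of \<open>f\<close> outside \<open>U\<close> are irrelevant).  Subvarieties carry the reduced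
  structure.
\<close>

record 'a fspace =
  zar :: "'a topology"
  reg :: "'a set \<Rightarrow> ('a \<Rightarrow> complex) \<Rightarrow> bool"

abbreviation pts :: "'a fspace \<Rightarrow> 'a set" where
  "pts X \<equiv> topspace (zar X)"

definition subspace_on :: "'a fspace \<Rightarrow> 'a set \<Rightarrow> 'a fspace" where
  "subspace_on X Y = \<lparr>
     zar = subtopology (zar X) Y,
     reg = (\<lambda>U f. openin (subtopology (zar X) Y) U \<and>
       (\<forall>x\<in>U. \<exists>V g. x \<in> V \<and> reg X V g \<and> (\<forall>y\<in>U \<inter> V. f y = g y)))\<rparr>"

definition morphism :: "'a fspace \<Rightarrow> 'b fspace \<Rightarrow> ('a \<Rightarrow> 'b) \<Rightarrow> bool" where
  "morphism X Y f \<longleftrightarrow> continuous_map (zar X) (zar Y) f \<and>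
     (\<forall>V g. reg Y V g \<longrightarrow> reg X {x \<in> pts X. f x \<in> V} (g \<circ> f))"

definition isomorphism :: "'a fspace \<Rightarrow> 'b fspace \<Rightarrow> ('a \<Rightarrow> 'b) \<Rightarrow> bool" where
  "isomorphism X Y f \<longleftrightarrow> bij_betw f (pts X) (pts Y) \<and> morphism X Y f \<and>
     morphism Y X (inv_into (pts X) f)"

text \<open>
  The product: both the topology and the regular functions come from the functions
  \<open>(x, y) \<mapsto> \<Sum>i<n. f i x * g i y\<close> on open rectangles, with \<open>f i\<close> and \<open>g i\<close> regular.  For affine
  factors this is the affine variety whose coordinate ring is the tensor product.
\<close>

definition tensor_fun ::
    "'a fspace \<Rightarrow> 'b fspace \<Rightarrow> 'a set \<Rightarrow> 'b set \<Rightarrow> ('a \<times> 'b \<Rightarrow> complex) \<Rightarrow> bool" where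
  "tensor_fun X Y U V h \<longleftrightarrow> (\<exists>(n::nat) f g. (\<forall>i<n. reg X U (f i) \<and> reg Y V (g i)) \<and>
     h = (\<lambda>(x, y). \<Sum>i<n. f i x * g i y))"

definition prod_zar :: "'a fspace \<Rightarrow> 'b fspace \<Rightarrow> ('a \<times> 'b) topology" where
  "prod_zar X Y = topology_generated_by
     {{z \<in> U \<times> V. h z \<noteq> 0} | U V h. openin (zar X) U \<and> openin (zar Y) V \<and> tensor_fun X Y U V h}"

definition fprod :: "'a fspace \<Rightarrow> 'b fspace \<Rightarrow> ('a \<times> 'b) fspace"  (infixr "\<times>\<^sub>v" 80) where
  "X \<times>\<^sub>v Y = \<lparr>
     zar = prod_zar X Y,
     reg = (\<lambda>W f. openin (prod_zar X Y) W \<and>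
       (\<forall>z\<in>W. \<exists>U V p q. openin (zar X) U \<and> openin (zar Y) V \<and> z \<in> U \<times> V \<and>
          tensor_fun X Y U V p \<and> tensor_fun X Y U V q \<and> q z \<noteq> 0 \<and>
          (\<forall>z'\<in>W \<inter> (U \<times> V). q z' \<noteq> 0 \<longrightarrow> f z' = p z' / q z')))\<rparr>"

definition fibre_product ::
    "'a fspace \<Rightarrow> ('a \<Rightarrow> 'c) \<Rightarrow> 'b fspace \<Rightarrow> ('b \<Rightarrow> 'c) \<Rightarrow> ('a \<times> 'b) fspace" where
  "fibre_product X f Y g = subspace_on (X \<times>\<^sub>v Y) {(x, y). f x = g y}"

definition irreducible_fs :: "'a fspace \<Rightarrow> bool" where
  "irreducible_fs X \<longleftrightarrow> pts X \<noteq> {} \<and>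
     (\<forall>U V. openin (zar X) U \<and> openin (zar X) V \<and> U \<noteq> {} \<and> V \<noteq> {} \<longrightarrow> U \<inter> V \<noteq> {})"

definition dense_open :: "'a fspace \<Rightarrow> 'a set \<Rightarrow> bool" where
  "dense_open X U \<longleftrightarrow> openin (zar X) U \<and> zar X closure_of U = pts X"

text \<open>\<open>f\<close> represents a birational map from \<open>X\<close> to \<open>Y\<close>, restricting to an isomorphism from \<open>U\<close>
  onto \<open>V\<close>; only the values of \<open>f\<close> on \<open>U\<close> matter.\<close>

definition birational_on ::
    "'a fspace \<Rightarrow> 'b fspace \<Rightarrow> ('a \<Rightarrow> 'b) \<Rightarrow> 'a set \<Rightarrow> 'b set \<Rightarrow> bool" where
  "birational_on X Y f U V \<longleftrightarrow> dense_open X U \<and> dense_open Y V \<and>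
     isomorphism (subspace_on X U) (subspace_on Y V) f"


section \<open>Affine and weighted projective spaces\<close>

definition affine_zar :: "nat \<Rightarrow> complex list topology" where
  "affine_zar n = topology_generated_by
     {{x. length x = n \<and> peval q x \<noteq> 0} | q. pvars q \<subseteq> {..<n}}"

definition affine_space :: "nat \<Rightarrow> complex list fspace" where
  "affine_space n = \<lparr>
     zar = affine_zar n,
     reg = (\<lambda>U f. openin (affine_zar n) U \<and>
       (\<forall>x\<in>U. \<exists>p q. pvars p \<subseteq> {..<n} \<and> pvars q \<subseteq> {..<n} \<and> peval q x \<noteq> 0 \<and>
          (\<forall>y\<in>U. peval q y \<noteq> 0 \<longrightarrow> f y = peval p y / peval q y)))\<rparr>"

text \<open>A point of weighted projective space is an orbit of nonzero vectors under
  \<open>l \<cdot> (v\<^sub>0, v\<^sub>1, \<dots>) = (l ^ a\<^sub>0 * v\<^sub>0, l ^ a\<^sub>1 * v\<^sub>1, \<dots>)\<close>, where \<open>l\<close> is a nonzero complex number.\<close>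

definition nonzero_vecs :: "nat \<Rightarrow> complex list set" where
  "nonzero_vecs n = {v. length v = n \<and> (\<exists>c\<in>set v. c \<noteq> 0)}"

definition orbit :: "nat list \<Rightarrow> complex list \<Rightarrow> complex list set" where
  "orbit a v = {map2 (\<lambda>k c. l ^ k * c) a v | l. l \<noteq> 0}"

definition wproj_zar :: "nat list \<Rightarrow> complex list set topology" where
  "wproj_zar a = topology_generated_by
     {{orbit a v | v. v \<in> nonzero_vecs (length a) \<and> peval q v \<noteq> 0} | q. \<exists>d. whomog a d q}"

definition wproj_space :: "nat list \<Rightarrow> complex list set fspace" where
  "wproj_space a = \<lparr>
     zar = wproj_zar a,
     reg = (\<lambda>U f. openin (wproj_zar a) U \<and>
       (\<forall>v\<in>nonzero_vecs (length a). orbit a v \<in> U \<longrightarrow>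
          (\<exists>d p q. whomog a d p \<and> whomog a d q \<and> peval q v \<noteq> 0 \<and>
             (\<forall>v'\<in>nonzero_vecs (length a). orbit a v' \<in> U \<and> peval q v' \<noteq> 0 \<longrightarrow>
                f (orbit a v') = peval p v' / peval q v'))))\<rparr>"

definition proj_space :: "nat \<Rightarrow> complex list set fspace" where
  "proj_space n = wproj_space (replicate (Suc n) 1)"

definition projective_variety :: "complex list set fspace \<Rightarrow> bool" where
  "projective_variety X \<longleftrightarrow> (\<exists>n Z. closedin (zar (proj_space n)) Z \<and>
     X = subspace_on (proj_space n) Z \<and> irreducible_fs X)"


section \<open>Smoothness, resolutions and smooth projective models\<close>

definition partial :: "nat \<Rightarrow> mpol \<Rightarrow> complex list \<Rightarrow> complex" where
  "partial j p z = deriv (\<lambda>s. peval p (z[j := s])) (z ! j)"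

text \<open>Smooth of pure dimension \<open>d\<close>: locally cut out in an open subset of affine \<open>n\<close>-space by
  \<open>n - d\<close> equations whose differentials are linearly independent at every point.\<close>

definition smooth_of_dim :: "nat \<Rightarrow> 'a fspace \<Rightarrow> bool" where
  "smooth_of_dim d X \<longleftrightarrow> (\<forall>x\<in>pts X. \<exists>U n ps V Z e.
     openin (zar X) U \<and> x \<in> U \<and>
     length ps + d = n \<and> (\<forall>p\<in>set ps. pvars p \<subseteq> {..<n}) \<and>
     openin (zar (affine_space n)) V \<and> Z = {z \<in> V. \<forall>p\<in>set ps. peval p z = 0} \<and>
     (\<forall>z\<in>Z. \<forall>c. (\<forall>j<n. (\<Sum>i<length ps. c i * partial j (ps ! i) z) = 0) \<longrightarrow>
        (\<forall>i<length ps. c i = 0)) \<and>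
     isomorphism (subspace_on X U) (subspace_on (affine_space n) Z) e)"

text \<open>Resolutions of a projective surface.  A smooth complete surface is projective, so
  allowing only embedded projective surfaces is no restriction up to isomorphism; properness of
  the morphism is then automatic.\<close>

definition surface_resolution ::
    "'a fspace \<Rightarrow> complex list set fspace \<Rightarrow> (complex list set \<Rightarrow> 'a) \<Rightarrow> bool" where
  "surface_resolution S W \<rho> \<longleftrightarrow> projective_variety W \<and> smooth_of_dim 2 W \<and> morphism W S \<rho> \<and>
     (\<exists>U V. birational_on W S \<rho> U V)"

definition minimal_resolution ::
    "'a fspace \<Rightarrow> complex list set fspace \<Rightarrow> (complex list set \<Rightarrow> 'a) \<Rightarrow> bool" where
  "minimal_resolution S W \<rho> \<longleftrightarrow> surface_resolution S W \<rho> \<and>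
     (\<forall>W' \<rho>'. surface_resolution S W' \<rho>' \<longrightarrow>
        (\<exists>g. morphism W' W g \<and> (\<forall>x\<in>pts W'. \<rho> (g x) = \<rho>' x)))"

text \<open>A smooth projective curve \<open>X\<close> with a birational map \<open>\<phi>\<close>, defined on \<open>U\<close>, to the curve \<open>E\<close>.\<close>

definition smooth_projective_model ::
    "'a fspace \<Rightarrow> complex list set fspace \<Rightarrow> (complex list set \<Rightarrow> 'a) \<Rightarrow> complex list set set \<Rightarrow> bool"
  where
  "smooth_projective_model E X \<phi> U \<longleftrightarrow> projective_variety X \<and> smooth_of_dim 1 X \<and>
     (\<exists>V. birational_on X E \<phi> U V)"


section \<open>The sextic, the double plane and the two curves\<close>

definition binary_form :: "nat \<Rightarrow> mpol \<Rightarrow> bool" where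
  "binary_form d G \<longleftrightarrow> pvars G \<subseteq> {1, 2} \<and>
     (\<forall>m\<in>Poly_Mapping.keys G. Poly_Mapping.lookup m 1 + Poly_Mapping.lookup m 2 = d)"

text \<open>The root \<open>[a:b]\<close> of a form in \<open>X\<^sub>1, X\<^sub>2\<close> corresponds to the factor \<open>b X\<^sub>1 - a X\<^sub>2\<close>.
  The zero form is excluded, as everything divides it.\<close>

definition no_multiple_roots :: "mpol \<Rightarrow> bool" where
  "no_multiple_roots G \<longleftrightarrow>
     (\<forall>a b. (a, b) \<noteq> (0, 0) \<longrightarrow> \<not> (Cst b * Var 1 - Cst a * Var 2) ^ 2 dvd G)"

definition V_circ :: "(mpol \<times> mpol) set" where
  "V_circ = {(F3, F6). binary_form 3 F3 \<and> binary_form 6 F6 \<and> no_multiple_roots (F3 * F6)}"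

definition sextic :: "mpol \<Rightarrow> mpol \<Rightarrow> mpol" where
  "sextic F3 F6 = Var 0 ^ 3 * F3 + F6"

text \<open>The value \<open>G(x\<^sub>1, x\<^sub>2)\<close> of a binary form and its dehomogenization \<open>G(1, t)\<close>; the variable
  \<open>X\<^sub>0\<close> does not occur in \<open>G\<close>.\<close>

definition bval :: "mpol \<Rightarrow> complex \<Rightarrow> complex \<Rightarrow> complex" where
  "bval G x1 x2 = peval G [0, x1, x2]"

definition dehom :: "mpol \<Rightarrow> complex \<Rightarrow> complex" where
  "dehom G t = bval G 1 t"

abbreviation P1 :: "complex list set fspace" where
  "P1 \<equiv> proj_space 1"

abbreviation pt2 :: "complex \<Rightarrow> complex \<Rightarrow> complex list set" where
  "pt2 x1 x2 \<equiv> orbit [1, 1] [x1, x2]"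

definition zeros_P1 :: "mpol \<Rightarrow> complex list set set" where
  "zeros_P1 G = {pt2 x1 x2 | x1 x2. (x1, x2) \<noteq> (0, 0) \<and> bval G x1 x2 = 0}"

definition P_circ :: "mpol \<Rightarrow> mpol \<Rightarrow> complex list set set" where
  "P_circ F3 F6 = pts P1 - ({pt2 0 1, pt2 1 0} \<union> zeros_P1 F3 \<union> zeros_P1 F6)"

abbreviation pt4 :: "complex \<Rightarrow> complex \<Rightarrow> complex \<Rightarrow> complex \<Rightarrow> complex list set" where
  "pt4 s x0 x1 x2 \<equiv> orbit [3, 1, 1, 1] [s, x0, x1, x2]"

definition S_surface :: "mpol \<Rightarrow> complex list set fspace" where
  "S_surface F = subspace_on (wproj_space [3, 1, 1, 1])
     {pt4 s x0 x1 x2 | s x0 x1 x2. (s, x0, x1, x2) \<noteq> (0, 0, 0, 0) \<and> s ^ 2 = peval F [x0, x1, x2]}"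

definition W_circ :: "mpol \<Rightarrow> mpol \<Rightarrow> complex list fspace" where
  "W_circ F3 F6 = subspace_on (affine_space 3)
     {[w, x1, t] | w x1 t. pt2 1 t \<in> P_circ F3 F6 \<and>
        w ^ 2 = x1 * dehom F3 t + x1 ^ 4 * dehom F6 t}"

definition C_plane :: "mpol \<Rightarrow> mpol \<Rightarrow> complex list fspace" where
  "C_plane F3 F6 = subspace_on (affine_space 2)
     {[y, t] | y t. y ^ 6 = dehom F3 t ^ 2 * dehom F6 t}"

definition C_circ :: "mpol \<Rightarrow> mpol \<Rightarrow> complex list fspace" where
  "C_circ F3 F6 = subspace_on (affine_space 2)
     {[y, t] | y t. pt2 1 t \<in> P_circ F3 F6 \<and> y ^ 6 = dehom F3 t ^ 2 * dehom F6 t}"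

definition D_circ :: "complex list fspace" where
  "D_circ = subspace_on (affine_space 2) {[u, v] | u v. u ^ 2 = v * (v ^ 3 + 1)}"

text \<open>The projections to the projective line: on both \<open>W_circ\<close> and \<open>C_circ\<close> the coordinate \<open>t\<close>
  comes last.\<close>

definition t_proj :: "complex list \<Rightarrow> complex list set" where
  "t_proj z = pt2 1 (last z)"

abbreviation WC_circ :: "mpol \<Rightarrow> mpol \<Rightarrow> (complex list \<times> complex list) fspace" where
  "WC_circ F3 F6 \<equiv> fibre_product (W_circ F3 F6) t_proj (C_circ F3 F6) t_proj"

text \<open>On the fibre product the two coordinates \<open>t\<close> and \<open>t'\<close> below agree.\<close>

definition kappa :: "mpol \<Rightarrow> complex list \<times> complex list \<Rightarrow> complex list \<times> complex list" where
  "kappa F3 = (\<lambda>(a, c). case (a, c) of ([w, x1, t], [y, t']) \<Rightarrow>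
     ([w * y / dehom F3 t, x1 * y ^ 2 / dehom F3 t], [y, t]))"

definition induced_fibration ::
    "complex list set fspace \<Rightarrow> (complex list set \<Rightarrow> complex list set) \<Rightarrow>
     (complex list set \<Rightarrow> complex list set) \<Rightarrow> bool" where
  "induced_fibration W \<rho> \<pi> \<longleftrightarrow> morphism W P1 \<pi> \<and>
     (\<forall>a\<in>pts W. \<forall>s x0 x1 x2. \<rho> a = pt4 s x0 x1 x2 \<and> (x1, x2) \<noteq> (0, 0) \<longrightarrow> \<pi> a = pt2 x1 x2)"

definition induced_cover ::
    "complex list set fspace \<Rightarrow> (complex list set \<Rightarrow> complex list) \<Rightarrow> complex list set set \<Rightarrow>
     (complex list set \<Rightarrow> complex list set) \<Rightarrow> bool" where
  "induced_cover C \<phi> U \<tau> \<longleftrightarrow> morphism C P1 \<tau> \<and> (\<forall>c\<in>U. \<tau> c = t_proj (\<phi> c))"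

text \<open>\<open>z = [w, x\<^sub>1, t]\<close> with \<open>w = S / (X\<^sub>0\<^sup>2 X\<^sub>1)\<close>, \<open>x\<^sub>1 = X\<^sub>1 / X\<^sub>0\<close> and \<open>t = X\<^sub>2 / X\<^sub>1\<close>, at points of the
  double plane where these quotients make sense.\<close>

definition double_plane_coords :: "complex list set \<Rightarrow> complex list \<Rightarrow> bool" where
  "double_plane_coords b z \<longleftrightarrow> (\<exists>s x0 x1 x2. b = pt4 s x0 x1 x2 \<and> x0 \<noteq> 0 \<and> x1 \<noteq> 0 \<and>
     z = [s / (x0 ^ 2 * x1), x1 / x0, x2 / x1])"

text \<open>The rational map from \<open>W \<times>\<^sub>P C\<close> to \<open>D \<times> C\<close> given in coordinates by \<open>kappa\<close> is birational.
  Here \<open>\<rho>\<close> maps \<open>W\<close> to the double plane and \<open>\<phi>\<close>, \<open>\<psi>\<close> are the plane coordinates on \<open>C\<close>, \<open>D\<close>.\<close>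

definition kappa_defines_birational_map ::
    "mpol \<Rightarrow> mpol \<Rightarrow> complex list set fspace \<Rightarrow> (complex list set \<Rightarrow> complex list set) \<Rightarrow>
     (complex list set \<Rightarrow> complex list set) \<Rightarrow>
     complex list set fspace \<Rightarrow> (complex list set \<Rightarrow> complex list) \<Rightarrow> complex list set set \<Rightarrow>
     (complex list set \<Rightarrow> complex list set) \<Rightarrow>
     complex list set fspace \<Rightarrow> (complex list set \<Rightarrow> complex list) \<Rightarrow> complex list set set \<Rightarrow> bool"
  where
  "kappa_defines_birational_map F3 F6 W \<rho> \<pi> C \<phi> UC \<tau> D \<psi> UD \<longleftrightarrow>
     (\<exists>K \<Omega> \<Omega>'. birational_on (fibre_product W \<pi> C \<tau>) (D \<times>\<^sub>v C) K \<Omega> \<Omega>' \<and>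
        (\<forall>(a, c)\<in>\<Omega>. \<exists>z d c'. double_plane_coords (\<rho> a) z \<and> c \<in> UC \<and>
           (z, \<phi> c) \<in> pts (WC_circ F3 F6) \<and>
           K (a, c) = (d, c') \<and> d \<in> UD \<and> c' \<in> UC \<and> (\<psi> d, \<phi> c') = kappa F3 (z, \<phi> c)))"

end

theory Submission
  imports Defs "HOL-Complex_Analysis.Complex_Analysis"
begin

text \<open>
  Over \<open>P\<^sup>\<circ>\<close> neither \<open>f\<^sub>3\<close> nor \<open>f\<^sub>6\<close> vanishes, so \<open>y\<close> vanishes nowhere on \<open>C\<^sup>\<circ>\<close> and the equations
  \<open>u = w y / f\<^sub>3\<close>, \<open>v = x\<^sub>1 y\<^sup>2 / f\<^sub>3\<close> can be solved for \<open>w\<close> and \<open>x\<^sub>1\<close>; the relation \<open>y\<^sup>6 = f\<^sub>3\<^sup>2 f\<^sub>6\<close>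
  turns the equation of \<open>W\<^sup>\<circ>\<close> into that of \<open>D\<^sup>\<circ>\<close> and back.  Morphisms into affine, weighted
  projective, product and fibre product spaces can be recognised on components
  (\<open>morphism_affineI\<close>, \<open>morphism_wprojI\<close>, \<open>morphism_pair\<close>, \<open>morphism_fibre_productI\<close>), so that both
  directions are morphisms (\<open>kappa_isomorphism\<close>).

  For the models, let \<open>\<Omega>1\<close> be the open set of those points of \<open>W \<times>\<^sub>P C\<close> at which the maps to the
  double plane and to the plane curve are invertible and the affine coordinates are defined.
  Through \<open>kappa\<close> it is isomorphic to an open subset of \<open>D\<^sup>\<circ> \<times> C\<close>, and composing with the inverse of
  \<open>D \<dashrightarrow> D\<^sup>\<circ>\<close> gives the rational map to \<open>D \<times> C\<close>.  On the side of the target, density is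
  automatic as \<open>D \<times> C\<close> is irreducible.  The point that needs an argument is that \<open>\<Omega>1\<close> is dense in
  the whole of \<open>W \<times>\<^sub>P C\<close>, including the points over exceptional curves and over the zeros of
  \<open>F\<^sub>3 F\<^sub>6\<close>.  Geometrically this is flatness: no component of \<open>W \<times>\<^sub>P C\<close> lies over a point of \<open>P\<close>.

  The proof of density uses holomorphic arcs instead of flatness.  Given \<open>(a, c)\<close> in \<open>W \<times>\<^sub>P C\<close>, choose an
  arc in \<open>W\<close> through \<open>a\<close> and an arc in \<open>C\<close> through \<open>c\<close> which, except at their centres, stay in the good
  open sets and off the fibres of \<open>a\<close> and \<open>c\<close> (\<open>smooth_arc\<close>).  Their images in \<open>P\<close> are nonconstant
  germs with the same centre; by the open mapping theorem each value of the first is a value of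
  the second, and the matching parameters give points of \<open>\<Omega>1\<close> arbitrarily close to \<open>(a, c)\<close>, in
  particular in any given Zariski neighbourhood (\<open>fibre_product_meets\<close>).

  Arcs through a smooth point come from an implicit function theorem, proved by Newton iteration
  (\<open>implicit_arc\<close>): the \<open>d\<close> free coordinates may be prescribed to run along any line.  It remains to
  choose the line so that a given regular function \<open>q\<close>, not zero on the irreducible variety, does
  not vanish identically on the arc.  Since the transcendence degree is at most \<open>d\<close>, the function
  \<open>q\<close> and the free coordinates satisfy an algebraic relation; after division by a power of \<open>q\<close> its
  constant term is a nonzero polynomial \<open>R\<close> in the free coordinates, and a line on which \<open>R\<close> is not
  identically zero works.  The bound on the transcendence degree is obtained by counting monomials on
  the affine models \<open>w\<^sup>2 = x\<^sub>1 f\<^sub>3 + x\<^sub>1\<^sup>4 f\<^sub>6\<close> and \<open>y\<^sup>6 = f\<^sub>3\<^sup>2 f\<^sub>6\<close> (\<open>alg_dim_le_model\<close>).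
\<close>

section \<open>Polynomials as functions\<close>

definition monev :: "(nat \<Rightarrow>\<^sub>0 nat) \<Rightarrow> complex list \<Rightarrow> complex" where
  "monev m xs = (\<Prod>i\<in>Poly_Mapping.keys m. (xs ! i) ^ Poly_Mapping.lookup m i)"

lemma monev_superset:
  assumes "finite A" "Poly_Mapping.keys m \<subseteq> A"
  shows "monev m xs = (\<Prod>i\<in>A. (xs ! i) ^ Poly_Mapping.lookup m i)"
  unfolding monev_def using assms
  by (intro prod.mono_neutral_left) (auto simp: in_keys_iff)

lemma monev_zero [simp]: "monev 0 xs = 1"
  by (simp add: monev_def)

lemma monev_add: "monev (m + m') xs = monev m xs * monev m' xs"
proof -
  let ?A = "Poly_Mapping.keys m \<union> Poly_Mapping.keys m'"
  have "monev (m + m') xs = (\<Prod>i\<in>?A. (xs ! i) ^ Poly_Mapping.lookup (m + m') i)"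
    by (rule monev_superset) (auto dest: subsetD[OF Poly_Mapping.keys_add])
  also have "\<dots> = (\<Prod>i\<in>?A. (xs ! i) ^ Poly_Mapping.lookup m i) * (\<Prod>i\<in>?A. (xs ! i) ^ Poly_Mapping.lookup m' i)"
    by (simp add: lookup_add power_add prod.distrib)
  also have "\<dots> = monev m xs * monev m' xs"
    by (simp add: monev_superset[of ?A])
  finally show ?thesis .
qed

lemma monev_single: "monev (Poly_Mapping.single i k) xs = xs ! i ^ k"
  by (cases "k = 0") (auto simp: monev_def)

lemma peval_superset:
  assumes "finite A" "Poly_Mapping.keys p \<subseteq> A"
  shows "peval p xs = (\<Sum>m\<in>A. Poly_Mapping.lookup p m * monev m xs)"
  unfolding peval_def monev_def[symmetric] using assms
  by (intro sum.mono_neutral_left) (auto simp: in_keys_iff)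

lemma peval_alt: "peval p xs = (\<Sum>m\<in>Poly_Mapping.keys p. Poly_Mapping.lookup p m * monev m xs)"
  by (simp add: peval_def monev_def)

lemma peval_zero [simp]: "peval 0 xs = 0"
  by (simp add: peval_def)

lemma peval_add: "peval (p + q) xs = peval p xs + peval q xs"
proof -
  let ?A = "Poly_Mapping.keys p \<union> Poly_Mapping.keys q"
  have "peval (p + q) xs = (\<Sum>m\<in>?A. Poly_Mapping.lookup (p + q) m * monev m xs)"
    by (rule peval_superset) (auto dest: subsetD[OF Poly_Mapping.keys_add])
  then show ?thesis
    by (simp add: peval_superset[of ?A] lookup_add distrib_right sum.distrib)
qed

lemma peval_single: "peval (Poly_Mapping.single m c) xs = c * monev m xs"
  by (cases "c = 0") (auto simp: peval_alt)

lemma mpol_eq_sum_single: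
  fixes p :: mpol
  shows "p = (\<Sum>m\<in>Poly_Mapping.keys p. Poly_Mapping.single m (Poly_Mapping.lookup p m))"
proof (rule poly_mapping_eqI)
  fix k
  show "Poly_Mapping.lookup p k
      = Poly_Mapping.lookup (\<Sum>m\<in>Poly_Mapping.keys p. Poly_Mapping.single m (Poly_Mapping.lookup p m)) k"
    by (auto simp: lookup_sum lookup_single when_def sum.delta in_keys_iff)
qed

lemma mpol_induct [case_names zero single add]:
  fixes p :: mpol
  assumes "P 0" "\<And>m c. P (Poly_Mapping.single m c)" "\<And>p q. P p \<Longrightarrow> P q \<Longrightarrow> P (p + q)"
  shows "P p"
proof -
  have "P (\<Sum>m\<in>A. Poly_Mapping.single m (Poly_Mapping.lookup p m))" if "finite A" for A
    using that by induction (auto intro: assms)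
  from this[of "Poly_Mapping.keys p"] show ?thesis
    using mpol_eq_sum_single[of p] by simp
qed

lemma peval_mult: "peval (p * q) xs = peval p xs * peval q xs"
proof (induction p rule: mpol_induct)
  case (single m c)
  show ?case
    by (induction q rule: mpol_induct)
      (auto simp: mult_single peval_single monev_add peval_add algebra_simps)
qed (auto simp: peval_add algebra_simps)

lemma peval_Cst [simp]: "peval (Cst c) xs = c"
  by (simp add: Cst_def peval_single)

lemma peval_Var [simp]: "peval (Var i) xs = xs ! i"
  by (simp add: Var_def peval_single monev_single)

lemma one_mpol: "(1 :: mpol) = Cst 1"
  by (simp add: Cst_def)

lemma peval_power: "peval (p ^ k) xs = peval p xs ^ k"
  by (induction k) (auto simp: one_mpol peval_mult)

lemma peval_cong:
  assumes "\<And>i. i \<in> pvars p \<Longrightarrow> xs ! i = ys ! i"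
  shows "peval p xs = peval p ys"
proof -
  have "xs ! i = ys ! i" if "m \<in> Poly_Mapping.keys p" "i \<in> Poly_Mapping.keys m" for m i
    using that by (intro assms) (auto simp: pvars_def)
  then show ?thesis
    unfolding peval_def by (intro sum.cong prod.cong refl arg_cong2[where f = "(*)"]) auto
qed

lemma pvars_add: "pvars (p + q) \<subseteq> pvars p \<union> pvars q"
  using Poly_Mapping.keys_add[of p q] by (auto simp: pvars_def)

lemma pvars_mult: "pvars (p * q) \<subseteq> pvars p \<union> pvars q"
proof
  fix i assume "i \<in> pvars (p * q)"
  then obtain m where "m \<in> Poly_Mapping.keys (p * q)" "i \<in> Poly_Mapping.keys m"
    by (auto simp: pvars_def)
  with Poly_Mapping.keys_mult[of p q] obtain a b where
    "a \<in> Poly_Mapping.keys p" "b \<in> Poly_Mapping.keys q" "i \<in> Poly_Mapping.keys (a + b)"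
    by blast
  then show "i \<in> pvars p \<union> pvars q"
    using Poly_Mapping.keys_add[of a b] by (auto simp: pvars_def)
qed

lemma pvars_Cst [simp]: "pvars (Cst c) = {}"
  by (auto simp: pvars_def Cst_def)

lemma pvars_Var [simp]: "pvars (Var i) = {i}"
  by (auto simp: pvars_def Var_def)

lemma pvars_zero [simp]: "pvars 0 = {}"
  by (auto simp: pvars_def)

lemma pvars_addI: "pvars p \<subseteq> A \<Longrightarrow> pvars q \<subseteq> A \<Longrightarrow> pvars (p + q) \<subseteq> A"
  using pvars_add[of p q] by blast

lemma pvars_multI: "pvars p \<subseteq> A \<Longrightarrow> pvars q \<subseteq> A \<Longrightarrow> pvars (p * q) \<subseteq> A"
  using pvars_mult[of p q] by blast

lemma pvars_powerI: "pvars p \<subseteq> A \<Longrightarrow> pvars (p ^ k) \<subseteq> A"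
proof (induction k)
  case (Suc k)
  then show ?case unfolding power_Suc by (intro pvars_multI)
qed (simp add: one_mpol)

definition mweight :: "nat list \<Rightarrow> (nat \<Rightarrow>\<^sub>0 nat) \<Rightarrow> nat" where
  "mweight a m = (\<Sum>i\<in>Poly_Mapping.keys m. a ! i * Poly_Mapping.lookup m i)"

lemma mweight_superset:
  assumes "finite A" "Poly_Mapping.keys m \<subseteq> A"
  shows "mweight a m = (\<Sum>i\<in>A. a ! i * Poly_Mapping.lookup m i)"
  unfolding mweight_def using assms
  by (intro sum.mono_neutral_left) (auto simp: in_keys_iff)

lemma mweight_add: "mweight a (m + m') = mweight a m + mweight a m'"
proof -
  let ?A = "Poly_Mapping.keys m \<union> Poly_Mapping.keys m'"
  have "mweight a (m + m') = (\<Sum>i\<in>?A. a ! i * Poly_Mapping.lookup (m + m') i)"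
    by (rule mweight_superset) (auto dest: subsetD[OF Poly_Mapping.keys_add])
  then show ?thesis
    by (simp add: mweight_superset[of ?A] lookup_add distrib_left sum.distrib)
qed

lemma whomog_alt:
  "whomog a d p \<longleftrightarrow> pvars p \<subseteq> {..<length a} \<and> (\<forall>m\<in>Poly_Mapping.keys p. mweight a m = d)"
  by (simp add: whomog_def mweight_def)

lemma whomog_add: "whomog a d p \<Longrightarrow> whomog a d q \<Longrightarrow> whomog a d (p + q)"
  unfolding whomog_alt using pvars_addI Poly_Mapping.keys_add[of p q] by blast

lemma whomog_mult: "whomog a d p \<Longrightarrow> whomog a e q \<Longrightarrow> whomog a (d + e) (p * q)"
  unfolding whomog_alt
proof (intro conjI ballI)
  assume *: "pvars p \<subseteq> {..<length a} \<and> (\<forall>m\<in>Poly_Mapping.keys p. mweight a m = d)"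
    "pvars q \<subseteq> {..<length a} \<and> (\<forall>m\<in>Poly_Mapping.keys q. mweight a m = e)"
  then show "pvars (p * q) \<subseteq> {..<length a}" by (simp add: pvars_multI)
  fix m assume "m \<in> Poly_Mapping.keys (p * q)"
  with Poly_Mapping.keys_mult[of p q] obtain b c where
    "b \<in> Poly_Mapping.keys p" "c \<in> Poly_Mapping.keys q" "m = b + c"
    by blast
  with * show "mweight a m = d + e" by (simp add: mweight_add)
qed

lemma whomog_Cst [simp]: "whomog a 0 (Cst c)"
  by (auto simp: whomog_alt Cst_def mweight_def pvars_def)

lemma whomog_Var: "i < length a \<Longrightarrow> d = a ! i \<Longrightarrow> whomog a d (Var i)"
  by (auto simp: whomog_alt Var_def mweight_def pvars_def)

text \<open>Every monomial of \<open>p\<close> is multiplied by the same factor \<open>l ^ d\<close>.\<close>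

lemma peval_scale:
  assumes "whomog a d p" "length v = length a"
  shows "peval p (map2 (\<lambda>k c. l ^ k * c) a v) = l ^ d * peval p v"
proof -
  have "monev m (map2 (\<lambda>k c. l ^ k * c) a v) = l ^ d * monev m v" if "m \<in> Poly_Mapping.keys p" for m
  proof -
    have i: "i < length a" if "i \<in> Poly_Mapping.keys m" for i
      using that \<open>m \<in> Poly_Mapping.keys p\<close> assms by (auto simp: whomog_def pvars_def)
    have "monev m (map2 (\<lambda>k c. l ^ k * c) a v)
        = (\<Prod>i\<in>Poly_Mapping.keys m. l ^ (a ! i * Poly_Mapping.lookup m i) * (v ! i) ^ Poly_Mapping.lookup m i)"
      unfolding monev_def using i assms(2)
      by (intro prod.cong) (auto simp: power_mult_distrib power_mult)
    also have "\<dots> = l ^ mweight a m * monev m v"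
      by (simp add: prod.distrib mweight_def monev_def power_sum)
    finally show ?thesis using assms(1) that by (simp add: whomog_alt)
  qed
  then show ?thesis
    by (simp add: peval_alt sum_distrib_left mult_ac cong: sum.cong)
qed

section \<open>Spaces with a sheaf of rings of functions\<close>

text \<open>A family closed under intersection of two members is a basis, not merely a subbasis.\<close>

lemma openin_generated_by_basis:
  assumes "\<And>A B. A \<in> S \<Longrightarrow> B \<in> S \<Longrightarrow> A \<inter> B \<in> S"
  shows "openin (topology_generated_by S) U \<longleftrightarrow> (\<forall>x\<in>U. \<exists>Q\<in>S. x \<in> Q \<and> Q \<subseteq> U)"
proof
  assume "openin (topology_generated_by S) U"
  then have "generate_topology_on S U" by (rule openin_topology_generated_by)
  then show "\<forall>x\<in>U. \<exists>Q\<in>S. x \<in> Q \<and> Q \<subseteq> U"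
  proof induction
    case Empty
    show ?case by simp
  next
    case (UN K)
    then show ?case by (meson Union_iff Union_upper order_trans)
  next
    case (Basis s)
    then show ?case by blast
  next
    case (Int a b)
    show ?case
    proof
      fix x assume "x \<in> a \<inter> b"
      with Int.IH obtain Q R where "Q \<in> S" "x \<in> Q" "Q \<subseteq> a" "R \<in> S" "x \<in> R" "R \<subseteq> b" by blast
      with assms[of Q R] show "\<exists>Q\<in>S. x \<in> Q \<and> Q \<subseteq> a \<inter> b" by blast
    qed
  qed
next
  assume *: "\<forall>x\<in>U. \<exists>Q\<in>S. x \<in> Q \<and> Q \<subseteq> U"
  then have "U = \<Union>{Q \<in> S. Q \<subseteq> U}" by blast
  also have "openin (topology_generated_by S) \<dots>"
    by (intro openin_Union) (auto intro: topology_generated_by_Basis)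
  finally show "openin (topology_generated_by S) U" .
qed

text \<open>The part of the theory of ringed spaces that carries the proofs: regularity is a local
  condition, and the regular functions on an open set form a ring containing the constants in which
  a function becomes invertible where it does not vanish.  By the first and the last clause the set
  of these points is open.\<close>

definition ringed :: "'a fspace \<Rightarrow> bool" where
  "ringed X \<longleftrightarrow>
     (\<forall>U f. reg X U f \<longrightarrow> openin (zar X) U) \<and>
     (\<forall>U f. openin (zar X) U \<and>
        (\<forall>x\<in>U. \<exists>V g. x \<in> V \<and> reg X V g \<and> (\<forall>y\<in>U \<inter> V. f y = g y)) \<longrightarrow> reg X U f) \<and>
     (\<forall>c. reg X (pts X) (\<lambda>_. c)) \<and>
     (\<forall>U f g. reg X U f \<and> reg X U g \<longrightarrow> reg X U (\<lambda>x. f x + g x) \<and> reg X U (\<lambda>x. f x * g x)) \<and>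
     (\<forall>U f. reg X U f \<longrightarrow> reg X {x \<in> U. f x \<noteq> 0} (\<lambda>x. 1 / f x))"

lemma ringed_openin: "ringed X \<Longrightarrow> reg X U f \<Longrightarrow> openin (zar X) U"
  unfolding ringed_def by (elim conjE) (drule spec, drule spec, drule mp)

lemma ringed_local:
  assumes "ringed X" "openin (zar X) U"
    "\<And>x. x \<in> U \<Longrightarrow> \<exists>V g. x \<in> V \<and> reg X V g \<and> (\<forall>y\<in>U \<inter> V. f y = g y)"
  shows "reg X U f"
proof -
  have "\<forall>U f. openin (zar X) U \<and>
        (\<forall>x\<in>U. \<exists>V g. x \<in> V \<and> reg X V g \<and> (\<forall>y\<in>U \<inter> V. f y = g y)) \<longrightarrow> reg X U f"
    using assms(1) unfolding ringed_def by (elim conjE)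
  from this[rule_format, of U f] show ?thesis using assms(2,3) by blast
qed

lemma ringed_restrict:
  assumes "ringed X" "reg X U f" "openin (zar X) V" "V \<subseteq> U"
  shows "reg X V f"
  by (rule ringed_local[OF assms(1,3)]) (rule exI[of _ U], rule exI[of _ f], use assms in auto)

lemma ringed_cong:
  assumes "ringed X" "reg X U f" "\<And>x. x \<in> U \<Longrightarrow> f x = g x"
  shows "reg X U g"
  by (rule ringed_local[OF assms(1) ringed_openin[OF assms(1,2)]])
    (rule exI[of _ U], rule exI[of _ f], use assms in auto)

lemma ringed_const_pts: "ringed X \<Longrightarrow> reg X (pts X) (\<lambda>_. c)"
  unfolding ringed_def by (elim conjE) (drule spec, assumption)

lemma ringed_const: "ringed X \<Longrightarrow> openin (zar X) U \<Longrightarrow> reg X U (\<lambda>_. c)"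
  by (rule ringed_restrict[of X "pts X"]) (auto intro: ringed_const_pts dest: openin_subset)

lemma ringed_add: "ringed X \<Longrightarrow> reg X U f \<Longrightarrow> reg X U g \<Longrightarrow> reg X U (\<lambda>x. f x + g x)"
  unfolding ringed_def by (elim conjE) (drule spec, drule spec, drule spec, drule mp, erule (1) conjI, erule conjunct1)

lemma ringed_mult: "ringed X \<Longrightarrow> reg X U f \<Longrightarrow> reg X U g \<Longrightarrow> reg X U (\<lambda>x. f x * g x)"
  unfolding ringed_def by (elim conjE) (drule spec, drule spec, drule spec, drule mp, erule (1) conjI, erule conjunct2)

lemma ringed_inverse: "ringed X \<Longrightarrow> reg X U f \<Longrightarrow> reg X {x \<in> U. f x \<noteq> 0} (\<lambda>x. 1 / f x)"
  unfolding ringed_def by (elim conjE) (drule spec, drule spec, drule mp, assumption)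

lemma ringed_nonzero: "ringed X \<Longrightarrow> reg X U f \<Longrightarrow> openin (zar X) {x \<in> U. f x \<noteq> 0}"
  by (rule ringed_openin[OF _ ringed_inverse])

lemma ringed_power: "ringed X \<Longrightarrow> reg X U f \<Longrightarrow> reg X U (\<lambda>x. f x ^ k)"
  by (induction k) (auto intro: ringed_mult ringed_const ringed_openin)

lemma ringed_divide:
  assumes "ringed X" "reg X U f" "reg X U g" "\<And>x. x \<in> U \<Longrightarrow> g x \<noteq> 0"
  shows "reg X U (\<lambda>x. f x / g x)"
proof -
  have "{x \<in> U. g x \<noteq> 0} = U" using assms(4) by auto
  with ringed_inverse[OF assms(1,3)] have "reg X U (\<lambda>x. 1 / g x)" by simp
  from ringed_mult[OF assms(1,2) this] show ?thesis by simp
qed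

lemma ringed_sum:
  assumes "ringed X" "openin (zar X) U" "\<And>i. i \<in> I \<Longrightarrow> reg X U (f i)"
  shows "reg X U (\<lambda>x. \<Sum>i\<in>I. f i x)"
  using assms(3)
  by (induction I rule: infinite_finite_induct) (auto intro: assms ringed_const ringed_add)

lemma ringed_prod:
  assumes "ringed X" "openin (zar X) U" "\<And>i. i \<in> I \<Longrightarrow> reg X U (f i)"
  shows "reg X U (\<lambda>x. \<Prod>i\<in>I. f i x)"
  using assms(3)
  by (induction I rule: infinite_finite_induct) (auto intro: assms ringed_const ringed_mult)

lemma ringed_peval:
  assumes "ringed X" "openin (zar X) U" "\<And>i. i \<in> pvars p \<Longrightarrow> reg X U (\<lambda>x. g x ! i)"
  shows "reg X U (\<lambda>x. peval p (g x))"
  unfolding peval_def using assms(3)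
  by (intro ringed_sum ringed_mult ringed_prod ringed_power ringed_const assms(1,2))
     (auto simp: pvars_def)

text \<open>Affine, weighted projective and product spaces are all defined in the same way: there is a set
  \<open>B\<close> of fractions with their domains, the domains generate the topology, and a function is
  regular if it locally agrees with fractions in \<open>B\<close>.  It is enough that \<open>B\<close> is stable under the
  ring operations and under inversion.\<close>

lemma ringed_from_basis:
  fixes X :: "'a fspace" and B :: "('a set \<times> ('a \<Rightarrow> complex)) set"
  assumes zar: "zar X = topology_generated_by (fst ` B)"
    and reg: "\<And>U f. reg X U f \<longleftrightarrow> openin (zar X) U \<and>
        (\<forall>x\<in>U. \<exists>Q g. (Q, g) \<in> B \<and> x \<in> Q \<and> (\<forall>y\<in>U \<inter> Q. f y = g y))"
    and const: "\<And>Q g c. (Q, g) \<in> B \<Longrightarrow> \<exists>k. (Q, k) \<in> B \<and> (\<forall>y\<in>Q. k y = c)"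
    and add: "\<And>Q g R h. (Q, g) \<in> B \<Longrightarrow> (R, h) \<in> B \<Longrightarrow>
        \<exists>k. (Q \<inter> R, k) \<in> B \<and> (\<forall>y\<in>Q \<inter> R. k y = g y + h y)"
    and mult: "\<And>Q g R h. (Q, g) \<in> B \<Longrightarrow> (R, h) \<in> B \<Longrightarrow>
        \<exists>k. (Q \<inter> R, k) \<in> B \<and> (\<forall>y\<in>Q \<inter> R. k y = g y * h y)"
    and inv: "\<And>Q g. (Q, g) \<in> B \<Longrightarrow>
        \<exists>k. ({y \<in> Q. g y \<noteq> 0}, k) \<in> B \<and> (\<forall>y\<in>{y \<in> Q. g y \<noteq> 0}. k y = 1 / g y)"
  shows "ringed X" "\<And>U. openin (zar X) U \<longleftrightarrow> (\<forall>x\<in>U. \<exists>Q\<in>fst ` B. x \<in> Q \<and> Q \<subseteq> U)"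
proof -
  have int: "A \<inter> C \<in> fst ` B" if AC: "A \<in> fst ` B" "C \<in> fst ` B" for A C
  proof -
    obtain g h where "(A, g) \<in> B" "(C, h) \<in> B" using AC by auto
    from add[OF this] obtain k where "(A \<inter> C, k) \<in> B" by blast
    then show ?thesis by (metis fst_conv image_eqI)
  qed
  show op: "\<And>U. openin (zar X) U \<longleftrightarrow> (\<forall>x\<in>U. \<exists>Q\<in>fst ` B. x \<in> Q \<and> Q \<subseteq> U)"
    unfolding zar by (rule openin_generated_by_basis) (rule int)
  have opB: "openin (zar X) Q" if "(Q, g) \<in> B" for Q g
    unfolding zar using that by (intro topology_generated_by_Basis) force
  have comb: "reg X U (\<lambda>x. w (f x) (g x))"
    if f: "reg X U f" and g: "reg X U g" and w: "\<And>Q g R h. (Q, g) \<in> B \<Longrightarrow> (R, h) \<in> B \<Longrightarrow>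
        \<exists>k. (Q \<inter> R, k) \<in> B \<and> (\<forall>y\<in>Q \<inter> R. k y = w (g y) (h y))" for U f g w
    unfolding reg
  proof (intro conjI ballI)
    show "openin (zar X) U" using f reg by blast
    fix x assume x: "x \<in> U"
    with f reg obtain Q u where Q: "(Q, u) \<in> B" "x \<in> Q" "\<forall>y\<in>U \<inter> Q. f y = u y" by meson
    from x g reg obtain R v where R: "(R, v) \<in> B" "x \<in> R" "\<forall>y\<in>U \<inter> R. g y = v y" by meson
    from w[OF Q(1) R(1)] obtain k where "(Q \<inter> R, k) \<in> B" "\<forall>y\<in>Q \<inter> R. k y = w (u y) (v y)" by blast
    with Q R show "\<exists>Q k. (Q, k) \<in> B \<and> x \<in> Q \<and> (\<forall>y\<in>U \<inter> Q. w (f y) (g y) = k y)"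
      by (intro exI[of _ "Q \<inter> R"] exI[of _ k]) auto
  qed
  show "ringed X"
    unfolding ringed_def
  proof (intro conjI allI impI)
    show "openin (zar X) U" if "reg X U f" for U f using that reg by blast
    show "reg X U f" if "openin (zar X) U \<and>
        (\<forall>x\<in>U. \<exists>V g. x \<in> V \<and> reg X V g \<and> (\<forall>y\<in>U \<inter> V. f y = g y))" for U f
      unfolding reg
    proof (intro conjI ballI)
      show "openin (zar X) U" using that by blast
      fix x assume x: "x \<in> U"
      with that obtain V g where V: "x \<in> V" "reg X V g" "\<forall>y\<in>U \<inter> V. f y = g y" by blast
      from V(1,2) reg obtain Q h where Q: "(Q, h) \<in> B" "x \<in> Q" "\<forall>y\<in>V \<inter> Q. g y = h y" by meson
      have "openin (zar X) V" using V reg by blast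
      with V(1) op obtain R where R: "R \<in> fst ` B" "x \<in> R" "R \<subseteq> V" by meson
      then obtain r where r: "(R, r) \<in> B" by auto
      from const[OF r, of 0] obtain k where k: "(R, k) \<in> B" "\<forall>y\<in>R. k y = 0" by blast
      from add[OF Q(1) k(1)] obtain s where "(Q \<inter> R, s) \<in> B" "\<forall>y\<in>Q \<inter> R. s y = h y + k y" by blast
      with Q R V k show "\<exists>Q g. (Q, g) \<in> B \<and> x \<in> Q \<and> (\<forall>y\<in>U \<inter> Q. f y = g y)"
        by (intro exI[of _ "Q \<inter> R"] exI[of _ s]) (auto simp: subset_iff)
    qed
    show "reg X (pts X) (\<lambda>_. c)" for c
      unfolding reg
    proof (intro conjI ballI)
      fix x assume "x \<in> pts X"
      then obtain Q g where "(Q, g) \<in> B" "x \<in> Q" by (auto simp: zar)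
      with const[of Q g c] show "\<exists>Q g. (Q, g) \<in> B \<and> x \<in> Q \<and> (\<forall>y\<in>pts X \<inter> Q. c = g y)" by fastforce
    qed auto
    show "reg X U (\<lambda>x. f x + g x)" if "reg X U f \<and> reg X U g" for U f g
      by (rule comb[of U f g "(+)"]) (use that in blast, use that in blast, rule add)
    show "reg X U (\<lambda>x. f x * g x)" if "reg X U f \<and> reg X U g" for U f g
      by (rule comb[of U f g "(*)"]) (use that in blast, use that in blast, rule mult)
    fix U f assume f: "reg X U f"
    have loc: "\<exists>Q k. (Q, k) \<in> B \<and> x \<in> Q \<and> Q \<subseteq> {x \<in> U. f x \<noteq> 0} \<and> (\<forall>y\<in>Q. 1 / f y = k y)"
      if x: "x \<in> {x \<in> U. f x \<noteq> 0}" for x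
    proof -
      from x f reg obtain Q g where Q: "(Q, g) \<in> B" "x \<in> Q" "\<forall>y\<in>U \<inter> Q. f y = g y"
        by (metis (no_types, lifting) mem_Collect_eq)
      have "openin (zar X) U" using f reg by blast
      with x op obtain R where R: "R \<in> fst ` B" "x \<in> R" "R \<subseteq> U" by (metis (no_types, lifting) mem_Collect_eq)
      then obtain r where r: "(R, r) \<in> B" by auto
      from const[OF r, of 1] obtain k where k: "(R, k) \<in> B" "\<forall>y\<in>R. k y = 1" by blast
      from mult[OF Q(1) k(1)] obtain s where s: "(Q \<inter> R, s) \<in> B" "\<forall>y\<in>Q \<inter> R. s y = g y * k y" by blast
      from inv[OF s(1)] obtain h where "({y \<in> Q \<inter> R. s y \<noteq> 0}, h) \<in> B"
        "\<forall>y\<in>{y \<in> Q \<inter> R. s y \<noteq> 0}. h y = 1 / s y" by blast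
      with Q R k s x show ?thesis
        by (intro exI[of _ "{y \<in> Q \<inter> R. s y \<noteq> 0}"] exI[of _ h]) (auto simp: subset_iff)
    qed
    show "reg X {x \<in> U. f x \<noteq> 0} (\<lambda>x. 1 / f x)"
      unfolding reg op
    proof (intro conjI ballI)
      fix x assume x: "x \<in> {x \<in> U. f x \<noteq> 0}"
      from loc[OF this] obtain Q k where Q: "(Q, k) \<in> B" "x \<in> Q" "Q \<subseteq> {x \<in> U. f x \<noteq> 0}" "\<forall>y\<in>Q. 1 / f y = k y"
        by blast
      then show "\<exists>Q\<in>fst ` B. x \<in> Q \<and> Q \<subseteq> {x \<in> U. f x \<noteq> 0}"
        by (intro bexI[of _ Q]) (auto intro: rev_image_eqI)
      from Q show "\<exists>Q g. (Q, g) \<in> B \<and> x \<in> Q \<and> (\<forall>y\<in>{x \<in> U. f x \<noteq> 0} \<inter> Q. 1 / f y = g y)" by blast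
    qed
  qed
qed

section \<open>Affine space\<close>

lemma pts_affine [simp]: "pts (affine_space n) = {x. length x = n}"
proof -
  have "x \<in> pts (affine_space n)" if "length x = n" for x
  proof -
    have "pvars (Cst 1) \<subseteq> {..<n}" by simp
    then have "{x. length x = n \<and> peval (Cst 1) x \<noteq> 0}
        \<in> {{x. length x = n \<and> peval q x \<noteq> 0} | q. pvars q \<subseteq> {..<n}}" by blast
    then show ?thesis
      unfolding affine_space_def affine_zar_def fspace.simps topology_generated_by_topspace
      by (rule UnionI) (simp add: that)
  qed
  then show ?thesis by (auto simp: affine_space_def affine_zar_def)
qed

lemma zar_affine [simp]: "zar (affine_space n) = affine_zar n"
  by (simp add: affine_space_def)

lemma topspace_affine_zar [simp]: "topspace (affine_zar n) = {x. length x = n}"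
  using pts_affine[of n] by simp

definition affine_basis :: "nat \<Rightarrow> (complex list set \<times> (complex list \<Rightarrow> complex)) set" where
  "affine_basis n = {({x. length x = n \<and> peval q x \<noteq> 0}, \<lambda>x. peval p x / peval q x) | p q.
     pvars p \<subseteq> {..<n} \<and> pvars q \<subseteq> {..<n}}"

lemma affine_basisI:
  "pvars p \<subseteq> {..<n} \<Longrightarrow> pvars q \<subseteq> {..<n} \<Longrightarrow> Q = {x. length x = n \<and> peval q x \<noteq> 0} \<Longrightarrow>
   (\<And>x. g x = peval p x / peval q x) \<Longrightarrow> (Q, g) \<in> affine_basis n"
  unfolding affine_basis_def mem_Collect_eq by (rule exI[of _ p], rule exI[of _ q]) auto

lemma fst_affine_basis:
  "fst ` affine_basis n = {{x. length x = n \<and> peval q x \<noteq> 0} | q. pvars q \<subseteq> {..<n}}"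
  by (force simp: affine_basis_def image_def)

lemma affine_basis_laws:
  "(Q, g) \<in> affine_basis n \<Longrightarrow> \<exists>k. (Q, k) \<in> affine_basis n \<and> (\<forall>y\<in>Q. k y = c)"
  "(Q, g) \<in> affine_basis n \<Longrightarrow> (R, h) \<in> affine_basis n \<Longrightarrow>
     \<exists>k. (Q \<inter> R, k) \<in> affine_basis n \<and> (\<forall>y\<in>Q \<inter> R. k y = g y + h y)"
  "(Q, g) \<in> affine_basis n \<Longrightarrow> (R, h) \<in> affine_basis n \<Longrightarrow>
     \<exists>k. (Q \<inter> R, k) \<in> affine_basis n \<and> (\<forall>y\<in>Q \<inter> R. k y = g y * h y)"
  "(Q, g) \<in> affine_basis n \<Longrightarrow>
     \<exists>k. ({y \<in> Q. g y \<noteq> 0}, k) \<in> affine_basis n \<and> (\<forall>y\<in>{y \<in> Q. g y \<noteq> 0}. k y = 1 / g y)"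
proof -
  assume "(Q, g) \<in> affine_basis n"
  then obtain p q where pq: "pvars p \<subseteq> {..<n}" "pvars q \<subseteq> {..<n}"
    "Q = {x. length x = n \<and> peval q x \<noteq> 0}" "g = (\<lambda>x. peval p x / peval q x)"
    by (auto simp: affine_basis_def)
  have "(Q, \<lambda>x. peval (Cst c * q) x / peval q x) \<in> affine_basis n"
    by (rule affine_basisI[of "Cst c * q" n q]) (simp_all add: pvars_multI pq)
  then show "\<exists>k. (Q, k) \<in> affine_basis n \<and> (\<forall>y\<in>Q. k y = c)"
    by - (rule exI, rule conjI, assumption, simp add: pq(3) peval_mult)
  have "({y \<in> Q. g y \<noteq> 0}, \<lambda>x. peval (q * q) x / peval (p * q) x) \<in> affine_basis n"
    by (rule affine_basisI[of "q * q" n "p * q"])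
      (simp_all add: pvars_multI pq(1,2), auto simp: pq(3,4) peval_mult)
  then show "\<exists>k. ({y \<in> Q. g y \<noteq> 0}, k) \<in> affine_basis n \<and> (\<forall>y\<in>{y \<in> Q. g y \<noteq> 0}. k y = 1 / g y)"
    by - (rule exI, rule conjI, assumption, simp add: pq(3,4) peval_mult)
  {
    assume "(R, h) \<in> affine_basis n"
    then obtain p' q' where pq': "pvars p' \<subseteq> {..<n}" "pvars q' \<subseteq> {..<n}"
      "R = {x. length x = n \<and> peval q' x \<noteq> 0}" "h = (\<lambda>x. peval p' x / peval q' x)"
      by (auto simp: affine_basis_def)
    have "(Q \<inter> R, \<lambda>x. peval (p * q' + p' * q) x / peval (q * q') x) \<in> affine_basis n"
      by (rule affine_basisI[of "p * q' + p' * q" n "q * q'"])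
        (simp_all add: pvars_multI pvars_addI pq(1,2) pq'(1,2), auto simp: pq(3) pq'(3) peval_mult)
    then show "\<exists>k. (Q \<inter> R, k) \<in> affine_basis n \<and> (\<forall>y\<in>Q \<inter> R. k y = g y + h y)"
      by - (rule exI, rule conjI, assumption, simp add: pq(3,4) pq'(3,4) peval_mult peval_add field_simps)
    have "(Q \<inter> R, \<lambda>x. peval (p * p') x / peval (q * q') x) \<in> affine_basis n"
      by (rule affine_basisI[of "p * p'" n "q * q'"])
        (simp_all add: pvars_multI pvars_addI pq(1,2) pq'(1,2), auto simp: pq(3) pq'(3) peval_mult)
    then show "\<exists>k. (Q \<inter> R, k) \<in> affine_basis n \<and> (\<forall>y\<in>Q \<inter> R. k y = g y * h y)"
      by - (rule exI, rule conjI, assumption, simp add: pq(3,4) pq'(3,4) peval_mult)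
  }
qed

lemma reg_affine:
  "reg (affine_space n) U f \<longleftrightarrow> openin (zar (affine_space n)) U \<and>
     (\<forall>x\<in>U. \<exists>Q g. (Q, g) \<in> affine_basis n \<and> x \<in> Q \<and> (\<forall>y\<in>U \<inter> Q. f y = g y))"
proof -
  have "(\<exists>p q. pvars p \<subseteq> {..<n} \<and> pvars q \<subseteq> {..<n} \<and> peval q x \<noteq> 0 \<and>
          (\<forall>y\<in>U. peval q y \<noteq> 0 \<longrightarrow> f y = peval p y / peval q y)) \<longleftrightarrow>
        (\<exists>Q g. (Q, g) \<in> affine_basis n \<and> x \<in> Q \<and> (\<forall>y\<in>U \<inter> Q. f y = g y))" (is "?L \<longleftrightarrow> ?R")
    if U: "openin (affine_zar n) U" and x: "x \<in> U" for x
  proof -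
    have len: "length y = n" if "y \<in> U" for y
      using openin_subset[OF U] that pts_affine[of n] by auto
    show ?thesis
    proof
      assume ?L
      then obtain p q where *: "pvars p \<subseteq> {..<n}" "pvars q \<subseteq> {..<n}" "peval q x \<noteq> 0"
          "\<forall>y\<in>U. peval q y \<noteq> 0 \<longrightarrow> f y = peval p y / peval q y" by blast
      show ?R
        by (rule exI[of _ "{x. length x = n \<and> peval q x \<noteq> 0}"],
            rule exI[of _ "\<lambda>x. peval p x / peval q x"])
          (use * len x in \<open>auto intro!: affine_basisI[of p n q]\<close>)
    next
      assume ?R
      then show ?L using len x unfolding affine_basis_def by auto
    qed
  qed
  then show ?thesis by (auto simp: affine_space_def)
qed

lemma ringed_affine [simp]: "ringed (affine_space n)"
  and openin_affine_basis:
    "openin (zar (affine_space n)) U \<longleftrightarrow> (\<forall>x\<in>U. \<exists>Q\<in>fst ` affine_basis n. x \<in> Q \<and> Q \<subseteq> U)"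
proof -
  have z: "zar (affine_space n) = topology_generated_by (fst ` affine_basis n)"
    unfolding fst_affine_basis by (simp add: affine_space_def affine_zar_def)
  note r = ringed_from_basis[OF z reg_affine affine_basis_laws]
  show "ringed (affine_space n)" by (rule r(1))
  show "openin (zar (affine_space n)) U \<longleftrightarrow> (\<forall>x\<in>U. \<exists>Q\<in>fst ` affine_basis n. x \<in> Q \<and> Q \<subseteq> U)"
    by (rule r(2))
qed

lemma bex_Collect_image: "(\<exists>Q\<in>{f q | q. P q}. R Q) \<longleftrightarrow> (\<exists>q. P q \<and> R (f q))"
  by blast

lemma openin_affine:
  "openin (affine_zar n) U \<longleftrightarrow> (\<forall>x\<in>U. \<exists>q. pvars q \<subseteq> {..<n} \<and> length x = n \<and> peval q x \<noteq> 0 \<and>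
     {y. length y = n \<and> peval q y \<noteq> 0} \<subseteq> U)"
  unfolding openin_affine_basis[of n U, unfolded fst_affine_basis zar_affine bex_Collect_image]
  by (simp only: mem_Collect_eq conj_assoc)

lemma reg_affineE:
  assumes "reg (affine_space n) U f" "x \<in> U"
  obtains p q where "pvars p \<subseteq> {..<n}" "pvars q \<subseteq> {..<n}" "peval q x \<noteq> 0"
    "\<And>y. y \<in> U \<Longrightarrow> peval q y \<noteq> 0 \<Longrightarrow> f y = peval p y / peval q y"
  using assms by (auto simp: affine_space_def)

lemma reg_affine_coord:
  assumes "i < n"
  shows "reg (affine_space n) (pts (affine_space n)) (\<lambda>x. x ! i)"
proof -
  have "openin (affine_zar n) {x. length x = n}"
    by (metis openin_topspace pts_affine zar_affine)
  moreover have "\<exists>p q. pvars p \<subseteq> {..<n} \<and> pvars q \<subseteq> {..<n} \<and> peval q x \<noteq> 0 \<and>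
          (\<forall>y\<in>{x. length x = n}. peval q y \<noteq> 0 \<longrightarrow> y ! i = peval p y / peval q y)" for x
    by (rule exI[of _ "Var i"], rule exI[of _ "Cst 1"]) (use assms in auto)
  ultimately show ?thesis unfolding pts_affine by (simp add: affine_space_def)
qed

section \<open>Weighted projective space\<close>

lemma orbit_self: "length v = length a \<Longrightarrow> v \<in> orbit a v"
  unfolding orbit_def by (auto intro!: exI[of _ 1] nth_equalityI)

lemma orbit_eqD:
  assumes "orbit a v = orbit a v'" "length v = length a"
  obtains l where "l \<noteq> 0" "v = map2 (\<lambda>k c. l ^ k * c) a v'"
  using orbit_self[OF assms(2)] assms(1) by (auto simp: orbit_def)

lemma orbit_eqI:
  assumes "l \<noteq> 0" "v = map2 (\<lambda>k c. l ^ k * c) a v'" "length v' = length a"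
  shows "orbit a v = orbit a v'"
proof
  show "orbit a v \<subseteq> orbit a v'"
  proof
    fix u assume "u \<in> orbit a v"
    then obtain m where "m \<noteq> 0" "u = map2 (\<lambda>k c. m ^ k * c) a v" by (auto simp: orbit_def)
    then show "u \<in> orbit a v'" unfolding orbit_def using assms
      by (auto intro!: exI[of _ "m * l"] nth_equalityI simp: power_mult_distrib)
  qed
  show "orbit a v' \<subseteq> orbit a v"
  proof
    fix u assume "u \<in> orbit a v'"
    then obtain m where "m \<noteq> 0" "u = map2 (\<lambda>k c. m ^ k * c) a v'" by (auto simp: orbit_def)
    then show "u \<in> orbit a v" unfolding orbit_def using assms
      by (auto intro!: exI[of _ "m / l"] nth_equalityI simp: power_divide)
  qed
qed

lemma whomog_nonzero_orbit:
  assumes "whomog a d q" "orbit a v = orbit a v'" "length v = length a" "length v' = length a"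
  shows "peval q v \<noteq> 0 \<longleftrightarrow> peval q v' \<noteq> 0"
  using orbit_eqD[OF assms(2,3)] peval_scale[OF assms(1,4)] by (metis mult_eq_0_iff power_not_zero)

lemma whomog_ratio_orbit:
  assumes "whomog a d p" "whomog a d q" "orbit a v = orbit a v'" "length v = length a" "length v' = length a"
  shows "peval p v / peval q v = peval p v' / peval q v'"
proof -
  obtain l where "l \<noteq> 0" "v = map2 (\<lambda>k c. l ^ k * c) a v'" using orbit_eqD[OF assms(3,4)] .
  then show ?thesis using peval_scale[OF assms(1,5)] peval_scale[OF assms(2,5)] by simp
qed

text \<open>A function on weighted projective space is written as a quotient of two forms of equal degree
  at an arbitrary representing vector; the quotient does not depend on the choice.\<close>

definition orep :: "nat list \<Rightarrow> complex list set \<Rightarrow> complex list" where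
  "orep a b = (SOME v. v \<in> nonzero_vecs (length a) \<and> orbit a v = b)"

lemma orep:
  assumes "v \<in> nonzero_vecs (length a)"
  shows "orep a (orbit a v) \<in> nonzero_vecs (length a)" "orbit a (orep a (orbit a v)) = orbit a v"
  using someI[of "\<lambda>u. u \<in> nonzero_vecs (length a) \<and> orbit a u = orbit a v" v] assms
  by (auto simp: orep_def)

lemma nonzero_vecs_length: "v \<in> nonzero_vecs n \<Longrightarrow> length v = n"
  by (simp add: nonzero_vecs_def)

lemma orep_ratio:
  assumes "whomog a d p" "whomog a d q" "v \<in> nonzero_vecs (length a)"
  shows "peval p (orep a (orbit a v)) / peval q (orep a (orbit a v)) = peval p v / peval q v"
  by (rule whomog_ratio_orbit[OF assms(1,2)]) (use orep[OF assms(3)] assms(3) nonzero_vecs_length in auto)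

definition wopen :: "nat list \<Rightarrow> mpol \<Rightarrow> complex list set set" where
  "wopen a q = {orbit a v | v. v \<in> nonzero_vecs (length a) \<and> peval q v \<noteq> 0}"

lemma orbit_in_wopen:
  assumes "whomog a d q" "v \<in> nonzero_vecs (length a)"
  shows "orbit a v \<in> wopen a q \<longleftrightarrow> peval q v \<noteq> 0"
proof
  assume "orbit a v \<in> wopen a q"
  then obtain u where u: "u \<in> nonzero_vecs (length a)" "peval q u \<noteq> 0" "orbit a v = orbit a u"
    by (auto simp: wopen_def)
  then show "peval q v \<noteq> 0"
    using whomog_nonzero_orbit[OF assms(1) u(3)] assms(2) nonzero_vecs_length by blast
next
  assume "peval q v \<noteq> 0"
  then show "orbit a v \<in> wopen a q" using assms(2) unfolding wopen_def by blast
qed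

definition wproj_basis :: "nat list \<Rightarrow> (complex list set set \<times> (complex list set \<Rightarrow> complex)) set" where
  "wproj_basis a = {(wopen a q, \<lambda>b. peval p (orep a b) / peval q (orep a b)) | p q.
     \<exists>d. whomog a d p \<and> whomog a d q}"

lemma wproj_basisI:
  "whomog a d p \<Longrightarrow> whomog a d q \<Longrightarrow> Q = wopen a q \<Longrightarrow>
   (\<And>b. g b = peval p (orep a b) / peval q (orep a b)) \<Longrightarrow> (Q, g) \<in> wproj_basis a"
  unfolding wproj_basis_def by auto

lemma fst_wproj_basis: "fst ` wproj_basis a = {wopen a q | q. \<exists>d. whomog a d q}"
  by (force simp: wproj_basis_def image_def)

lemma wopen_orep:
  assumes "b \<in> wopen a q" "whomog a d q"
  shows "peval q (orep a b) \<noteq> 0"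
proof -
  obtain v where v: "v \<in> nonzero_vecs (length a)" "peval q v \<noteq> 0" "b = orbit a v"
    using assms(1) by (auto simp: wopen_def)
  then show ?thesis
    using whomog_nonzero_orbit[OF assms(2) orep(2)[OF v(1)]] orep(1)[OF v(1)] nonzero_vecs_length by blast
qed

lemma wopen_iff:
  assumes "whomog a d q"
  shows "b \<in> wopen a q \<longleftrightarrow> b \<in> wopen a (Cst 1) \<and> peval q (orep a b) \<noteq> 0"
proof
  assume b: "b \<in> wopen a (Cst 1) \<and> peval q (orep a b) \<noteq> 0"
  then obtain v where v: "v \<in> nonzero_vecs (length a)" "b = orbit a v"
    by (auto simp: wopen_def)
  with b whomog_nonzero_orbit[OF assms orep(2)[OF v(1)]] orep(1)[OF v(1)] nonzero_vecs_length
  have "peval q v \<noteq> 0" by blast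
  with v show "b \<in> wopen a q" by (auto simp: wopen_def)
next
  assume b: "b \<in> wopen a q"
  then show "b \<in> wopen a (Cst 1) \<and> peval q (orep a b) \<noteq> 0"
    using wopen_orep[OF b assms] by (auto simp: wopen_def)
qed

lemma wproj_basis_laws:
  "(Q, g) \<in> wproj_basis n \<Longrightarrow> \<exists>k. (Q, k) \<in> wproj_basis n \<and> (\<forall>y\<in>Q. k y = c)"
  "(Q, g) \<in> wproj_basis n \<Longrightarrow> (R, h) \<in> wproj_basis n \<Longrightarrow>
     \<exists>k. (Q \<inter> R, k) \<in> wproj_basis n \<and> (\<forall>y\<in>Q \<inter> R. k y = g y + h y)"
  "(Q, g) \<in> wproj_basis n \<Longrightarrow> (R, h) \<in> wproj_basis n \<Longrightarrow>
     \<exists>k. (Q \<inter> R, k) \<in> wproj_basis n \<and> (\<forall>y\<in>Q \<inter> R. k y = g y * h y)"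
  "(Q, g) \<in> wproj_basis n \<Longrightarrow>
     \<exists>k. ({y \<in> Q. g y \<noteq> 0}, k) \<in> wproj_basis n \<and> (\<forall>y\<in>{y \<in> Q. g y \<noteq> 0}. k y = 1 / g y)"
proof -
  assume "(Q, g) \<in> wproj_basis n"
  then obtain d p q where pq: "whomog n d p" "whomog n d q"
    "Q = wopen n q" "g = (\<lambda>x. peval p (orep n x) / peval q (orep n x))"
    by (auto simp: wproj_basis_def)
  note mult = whomog_mult[OF _ pq(2)] whomog_mult[OF pq(1)] whomog_mult[OF pq(2)]
  note Q = wopen_iff[OF pq(2)]
  have "(Q, \<lambda>x. peval (Cst c * q) (orep n x) / peval q (orep n x)) \<in> wproj_basis n"
    by (rule wproj_basisI[of n d "Cst c * q" q]) (use mult(1)[of 0 "Cst c"] pq in simp_all)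
  then show "\<exists>k. (Q, k) \<in> wproj_basis n \<and> (\<forall>y\<in>Q. k y = c)"
    by - (rule exI, rule conjI, assumption, simp add: pq(3) Q peval_mult)
  have "({y \<in> Q. g y \<noteq> 0}, \<lambda>x. peval (q * q) (orep n x) / peval (p * q) (orep n x)) \<in> wproj_basis n"
    by (rule wproj_basisI[of n "d + d" "q * q" "p * q"])
      (use mult pq(1,2) in \<open>simp_all, auto simp: pq(3,4) peval_mult Q wopen_iff[of n "d + d" "p * q"]\<close>)
  then show "\<exists>k. ({y \<in> Q. g y \<noteq> 0}, k) \<in> wproj_basis n \<and> (\<forall>y\<in>{y \<in> Q. g y \<noteq> 0}. k y = 1 / g y)"
    by - (rule exI, rule conjI, assumption, simp add: pq(3,4) peval_mult)
  {
    assume "(R, h) \<in> wproj_basis n"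
    then obtain e p' q' where pq': "whomog n e p'" "whomog n e q'"
      "R = wopen n q'" "h = (\<lambda>x. peval p' (orep n x) / peval q' (orep n x))"
      by (auto simp: wproj_basis_def)
    note Q' = Q wopen_iff[OF pq'(2)] wopen_iff[OF whomog_mult[OF pq(2) pq'(2)]]
    have "whomog n (d + e) (p' * q)" using whomog_mult[OF pq'(1) pq(2)] by (simp add: add.commute)
    then have "(Q \<inter> R, \<lambda>x. peval (p * q' + p' * q) (orep n x) / peval (q * q') (orep n x)) \<in> wproj_basis n"
      by (intro wproj_basisI[of n "d + e" "p * q' + p' * q" "q * q'"])
        (simp_all add: whomog_mult whomog_add pq(1,2) pq'(1,2), auto simp: pq(3) pq'(3) peval_mult Q')
    then show "\<exists>k. (Q \<inter> R, k) \<in> wproj_basis n \<and> (\<forall>y\<in>Q \<inter> R. k y = g y + h y)"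
      by - (rule exI, rule conjI, assumption, simp add: pq(3,4) pq'(3,4) peval_mult peval_add field_simps Q')
    have "(Q \<inter> R, \<lambda>x. peval (p * p') (orep n x) / peval (q * q') (orep n x)) \<in> wproj_basis n"
      by (rule wproj_basisI[of n "d + e" "p * p'" "q * q'"])
        (simp_all add: whomog_mult pq(1,2) pq'(1,2), auto simp: pq(3) pq'(3) peval_mult Q')
    then show "\<exists>k. (Q \<inter> R, k) \<in> wproj_basis n \<and> (\<forall>y\<in>Q \<inter> R. k y = g y * h y)"
      by - (rule exI, rule conjI, assumption, simp add: pq(3,4) pq'(3,4) peval_mult)
  }
qed

lemma pts_wproj: "pts (wproj_space a) = orbit a ` nonzero_vecs (length a)"
proof -
  have "orbit a v \<in> pts (wproj_space a)" if "v \<in> nonzero_vecs (length a)" for v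
  proof -
    have "whomog a 0 (Cst 1)" by simp
    then have "{orbit a v | v. v \<in> nonzero_vecs (length a) \<and> peval (Cst 1) v \<noteq> 0}
        \<in> {{orbit a v | v. v \<in> nonzero_vecs (length a) \<and> peval q v \<noteq> 0} | q. \<exists>d. whomog a d q}" by blast
    then show ?thesis
      unfolding wproj_space_def wproj_zar_def fspace.simps topology_generated_by_topspace
      by (rule UnionI) (use that in auto)
  qed
  then show ?thesis by (auto simp: wproj_space_def wproj_zar_def)
qed

lemma zar_wproj [simp]: "zar (wproj_space n) = wproj_zar n"
  by (simp add: wproj_space_def)

lemma reg_wproj:
  "reg (wproj_space a) U f \<longleftrightarrow> openin (zar (wproj_space a)) U \<and>
     (\<forall>x\<in>U. \<exists>Q g. (Q, g) \<in> wproj_basis a \<and> x \<in> Q \<and> (\<forall>y\<in>U \<inter> Q. f y = g y))"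
proof -
  have "(\<forall>v\<in>nonzero_vecs (length a). orbit a v \<in> U \<longrightarrow>
          (\<exists>d p q. whomog a d p \<and> whomog a d q \<and> peval q v \<noteq> 0 \<and>
             (\<forall>v'\<in>nonzero_vecs (length a). orbit a v' \<in> U \<and> peval q v' \<noteq> 0 \<longrightarrow>
                f (orbit a v') = peval p v' / peval q v'))) \<longleftrightarrow>
      (\<forall>x\<in>U. \<exists>Q g. (Q, g) \<in> wproj_basis a \<and> x \<in> Q \<and> (\<forall>y\<in>U \<inter> Q. f y = g y))" (is "?L \<longleftrightarrow> ?R")
    if U: "openin (wproj_zar a) U"
  proof -
    have U': "\<exists>v\<in>nonzero_vecs (length a). x = orbit a v" if "x \<in> U" for x
      using openin_subset[OF U] that pts_wproj[of a] by auto
    show ?thesis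
    proof (intro iffI ballI impI)
      fix x assume L: ?L and x: "x \<in> U"
      from U'[OF x] obtain v where v: "v \<in> nonzero_vecs (length a)" "x = orbit a v" by blast
      with L x obtain d p q where *: "whomog a d p" "whomog a d q" "peval q v \<noteq> 0"
        "\<forall>v'\<in>nonzero_vecs (length a). orbit a v' \<in> U \<and> peval q v' \<noteq> 0 \<longrightarrow>
                f (orbit a v') = peval p v' / peval q v'" by meson
      have "(wopen a q, \<lambda>b. peval p (orep a b) / peval q (orep a b)) \<in> wproj_basis a"
        by (rule wproj_basisI[OF *(1,2)]) auto
      moreover have "x \<in> wopen a q" using v * by (simp add: orbit_in_wopen)
      moreover have "f y = peval p (orep a y) / peval q (orep a y)" if "y \<in> U \<inter> wopen a q" for y
      proof -
        obtain u where u: "u \<in> nonzero_vecs (length a)" "y = orbit a u" "peval q u \<noteq> 0"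
          using \<open>y \<in> U \<inter> wopen a q\<close> by (auto simp: wopen_def)
        then show ?thesis using * that by (simp add: orep_ratio[OF *(1,2)])
      qed
      ultimately show "\<exists>Q g. (Q, g) \<in> wproj_basis a \<and> x \<in> Q \<and> (\<forall>y\<in>U \<inter> Q. f y = g y)" by blast
    next
      fix v assume R: ?R and v: "v \<in> nonzero_vecs (length a)" "orbit a v \<in> U"
      then obtain Q g where Q: "(Q, g) \<in> wproj_basis a" "orbit a v \<in> Q" "\<forall>y\<in>U \<inter> Q. f y = g y" by blast
      then obtain d p q where pq: "whomog a d p" "whomog a d q"
        "Q = wopen a q" "g = (\<lambda>x. peval p (orep a x) / peval q (orep a x))"
        by (auto simp: wproj_basis_def)
      show "\<exists>d p q. whomog a d p \<and> whomog a d q \<and> peval q v \<noteq> 0 \<and>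
             (\<forall>v'\<in>nonzero_vecs (length a). orbit a v' \<in> U \<and> peval q v' \<noteq> 0 \<longrightarrow>
                f (orbit a v') = peval p v' / peval q v')"
        by (rule exI[of _ d], rule exI[of _ p], rule exI[of _ q])
          (use Q v pq in \<open>auto simp: orbit_in_wopen orep_ratio\<close>)
    qed
  qed
  then show ?thesis by (auto simp: wproj_space_def)
qed

lemma ringed_wproj [simp]: "ringed (wproj_space a)"
  and openin_wproj_basis:
    "openin (zar (wproj_space a)) U \<longleftrightarrow> (\<forall>x\<in>U. \<exists>Q\<in>fst ` wproj_basis a. x \<in> Q \<and> Q \<subseteq> U)"
proof -
  have z: "zar (wproj_space a) = topology_generated_by (fst ` wproj_basis a)"
    unfolding fst_wproj_basis wopen_def by (simp add: wproj_space_def wproj_zar_def)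
  note r = ringed_from_basis[OF z reg_wproj wproj_basis_laws]
  show "ringed (wproj_space a)" by (rule r(1))
  show "openin (zar (wproj_space a)) U \<longleftrightarrow> (\<forall>x\<in>U. \<exists>Q\<in>fst ` wproj_basis a. x \<in> Q \<and> Q \<subseteq> U)"
    by (rule r(2))
qed

section \<open>Subspaces\<close>

lemma zar_subspace [simp]: "zar (subspace_on X A) = subtopology (zar X) A"
  by (simp add: subspace_on_def)

lemma reg_subspace:
  "reg (subspace_on X A) U f \<longleftrightarrow> openin (subtopology (zar X) A) U \<and>
       (\<forall>x\<in>U. \<exists>V g. x \<in> V \<and> reg X V g \<and> (\<forall>y\<in>U \<inter> V. f y = g y))"
  by (simp add: subspace_on_def)

lemma reg_subspaceI:
  assumes "ringed X" "reg X V f" 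
  shows "reg (subspace_on X A) (V \<inter> A) f"
  unfolding reg_subspace
  using ringed_openin[OF assms] by (auto simp: openin_subtopology intro!: exI[of _ V] exI[of _ f] assms)

lemma ringed_subspace [simp]:
  assumes "ringed X"
  shows "ringed (subspace_on X A)"
  unfolding ringed_def
proof (intro conjI allI impI)
  let ?Y = "subspace_on X A"
  have comb: "reg ?Y U (\<lambda>x. w (f x) (g x))"
    if f: "reg ?Y U f" and g: "reg ?Y U g" and w: "\<And>U f g. reg X U f \<Longrightarrow> reg X U g \<Longrightarrow>
        reg X U (\<lambda>x. w (f x) (g x))" for U f g w
    unfolding reg_subspace
  proof (intro conjI ballI)
    show "openin (subtopology (zar X) A) U" using f reg_subspace by blast
    fix x assume x: "x \<in> U"
    with f obtain V u where V: "reg X V u" "x \<in> V" "\<forall>y\<in>U \<inter> V. f y = u y" unfolding reg_subspace by meson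
    from x g obtain W v where W: "reg X W v" "x \<in> W" "\<forall>y\<in>U \<inter> W. g y = v y" unfolding reg_subspace by meson
    have o: "openin (zar X) (V \<inter> W)" using V W assms ringed_openin by blast
    have "reg X (V \<inter> W) (\<lambda>x. w (u x) (v x))"
      by (rule w) (rule ringed_restrict[OF assms V(1) o], simp, rule ringed_restrict[OF assms W(1) o], simp)
    then show "\<exists>V k. x \<in> V \<and> reg X V k \<and> (\<forall>y\<in>U \<inter> V. w (f y) (g y) = k y)"
      by (intro exI[of _ "V \<inter> W"] exI) (use V W in auto)
  qed
  show o: "openin (zar ?Y) U" if "reg ?Y U f" for U f using that by (simp add: reg_subspace)
  show "reg ?Y U f" if "openin (zar ?Y) U \<and>
        (\<forall>x\<in>U. \<exists>V g. x \<in> V \<and> reg ?Y V g \<and> (\<forall>y\<in>U \<inter> V. f y = g y))" for U f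
    unfolding reg_subspace
  proof (intro conjI ballI)
    show "openin (subtopology (zar X) A) U" using that by simp
    fix x assume x: "x \<in> U"
    with that obtain V g where V: "x \<in> V" "reg ?Y V g" "\<forall>y\<in>U \<inter> V. f y = g y" by blast
    from V(1,2) obtain W h where W: "x \<in> W" "reg X W h" "\<forall>y\<in>V \<inter> W. g y = h y"
      unfolding reg_subspace by blast
    from V(2) obtain T where T: "openin (zar X) T" "V = T \<inter> A"
      unfolding reg_subspace openin_subtopology by blast
    have U: "U \<subseteq> A" using that by (auto simp: openin_subtopology)
    have o: "openin (zar X) (T \<inter> W)" using T ringed_openin[OF assms W(2)] by blast
    have "reg X (T \<inter> W) h" by (rule ringed_restrict[OF assms W(2) o]) simp
    then show "\<exists>V g. x \<in> V \<and> reg X V g \<and> (\<forall>y\<in>U \<inter> V. f y = g y)"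
      by (intro exI[of _ "T \<inter> W"] exI[of _ h]) (use V W T U in auto)
  qed
  show "reg ?Y (pts ?Y) (\<lambda>_. c)" for c
    using reg_subspaceI[OF assms ringed_const_pts[OF assms]] by simp
  show "reg ?Y U (\<lambda>x. f x + g x)" if "reg ?Y U f \<and> reg ?Y U g" for U f g
    by (rule comb[of U f g "(+)"]) (use that in blast, use that in blast, rule ringed_add[OF assms])
  show "reg ?Y U (\<lambda>x. f x * g x)" if "reg ?Y U f \<and> reg ?Y U g" for U f g
    by (rule comb[of U f g "(*)"]) (use that in blast, use that in blast, rule ringed_mult[OF assms])
  fix U f assume f: "reg ?Y U f"
  have loc: "\<exists>V k. x \<in> V \<and> reg X V k \<and> (\<forall>y\<in>V. k y \<noteq> 0) \<and> (\<forall>y\<in>U \<inter> V. f y = k y)"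
    if "x \<in> {x \<in> U. f x \<noteq> 0}" for x
  proof -
    from f that obtain V g where V: "x \<in> V" "reg X V g" "\<forall>y\<in>U \<inter> V. f y = g y"
      unfolding reg_subspace by blast
    have "reg X {y \<in> V. g y \<noteq> 0} g"
      by (rule ringed_restrict[OF assms V(2) ringed_nonzero[OF assms V(2)]]) auto
    then show ?thesis by (intro exI[of _ "{y \<in> V. g y \<noteq> 0}"] exI[of _ g]) (use V that in auto)
  qed
  have U: "openin (zar ?Y) U" using f by (simp add: reg_subspace)
  show "reg ?Y {x \<in> U. f x \<noteq> 0} (\<lambda>x. 1 / f x)"
    unfolding reg_subspace
  proof (intro conjI ballI)
    let ?S = "{x \<in> U. f x \<noteq> 0}"
    have "\<exists>T. openin (subtopology (zar X) A) T \<and> x \<in> T \<and> T \<subseteq> ?S" if "x \<in> ?S" for x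
    proof -
      from loc[OF that] obtain V k where V: "x \<in> V" "reg X V k" "\<forall>y\<in>V. k y \<noteq> 0" "\<forall>y\<in>U \<inter> V. f y = k y" by blast
      have "openin (subtopology (zar X) A) (V \<inter> U)"
        using ringed_openin[OF assms V(2)] U by (auto simp: openin_subtopology)
      then show ?thesis by (intro exI[of _ "V \<inter> U"]) (use V that in auto)
    qed
    then show "openin (subtopology (zar X) A) ?S" by (subst openin_subopen) blast
    fix x assume "x \<in> ?S"
    from loc[OF this] obtain V k where V: "x \<in> V" "reg X V k" "\<forall>y\<in>V. k y \<noteq> 0" "\<forall>y\<in>U \<inter> V. f y = k y" by blast
    have "reg X V (\<lambda>x. 1 / k x)"
      by (rule ringed_divide[OF assms ringed_const[OF assms ringed_openin[OF assms V(2)]] V(2)]) (use V in auto)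
    then show "\<exists>V g. x \<in> V \<and> reg X V g \<and> (\<forall>y\<in>?S \<inter> V. 1 / f y = g y)"
      by (intro exI[of _ V] exI[of _ "\<lambda>x. 1 / k x"]) (use V in auto)
  qed
qed

section \<open>Products\<close>

text \<open>Allowing any finite index set, sums and products of tensors can be indexed by disjoint
  unions and by products of index sets.\<close>

lemma tensor_funI:
  assumes "finite I" "\<And>i. i \<in> I \<Longrightarrow> reg X U (f i)" "\<And>i. i \<in> I \<Longrightarrow> reg Y V (g i)"
    "\<And>x y. h (x, y) = (\<Sum>i\<in>I. f i x * g i y)"
  shows "tensor_fun X Y U V h"
proof -
  obtain e where e: "bij_betw e {0..<card I} I" using ex_bij_betw_nat_finite[OF assms(1)] by blast
  have "(\<Sum>i\<in>I. f i x * g i y) = (\<Sum>i<card I. f (e i) x * g (e i) y)" for x y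
    using sum.reindex_bij_betw[OF e, of "\<lambda>i. f i x * g i y"] by (simp add: lessThan_atLeast0)
  moreover have "e i \<in> I" if "i < card I" for i using bij_betwE[OF e] that by simp
  ultimately show ?thesis
    unfolding tensor_fun_def
    by (intro exI[of _ "card I"] exI[of _ "\<lambda>i. f (e i)"] exI[of _ "\<lambda>i. g (e i)"])
      (simp add: assms(2,3,4) fun_eq_iff)
qed

lemma tensor_funE:
  assumes "tensor_fun X Y U V h"
  obtains n :: nat and f g where "\<And>i. i < n \<Longrightarrow> reg X U (f i)" "\<And>i. i < n \<Longrightarrow> reg Y V (g i)"
    "\<And>x y. h (x, y) = (\<Sum>i<n. f i x * g i y)"
proof -
  from assms obtain n :: nat and f g where *: "\<forall>i<n. reg X U (f i) \<and> reg Y V (g i)"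
    "h = (\<lambda>(x, y). \<Sum>i<n. f i x * g i y)" unfolding tensor_fun_def by blast
  show thesis by (rule that[of n f g]) (simp_all add: *)
qed

context
  fixes X :: "'a fspace" and Y :: "'b fspace"
  assumes X: "ringed X" and Y: "ringed Y"
begin

lemma tensor_add:
  assumes "tensor_fun X Y U V h" "tensor_fun X Y U V k"
  shows "tensor_fun X Y U V (\<lambda>z. h z + k z)"
proof -
  from assms(1) obtain n :: nat and f g where f: "\<And>i. i < n \<Longrightarrow> reg X U (f i)" "\<And>i. i < n \<Longrightarrow> reg Y V (g i)"
    "\<And>x y. h (x, y) = (\<Sum>i<n. f i x * g i y)" by (rule tensor_funE) blast
  from assms(2) obtain m :: nat and f' g' where f': "\<And>i. i < m \<Longrightarrow> reg X U (f' i)" "\<And>i. i < m \<Longrightarrow> reg Y V (g' i)"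
    "\<And>x y. k (x, y) = (\<Sum>i<m. f' i x * g' i y)" by (rule tensor_funE) blast
  show ?thesis
    by (rule tensor_funI[of "{..<n} <+> {..<m}" X U "case_sum f f'" Y V "case_sum g g'"])
      (auto simp: f f' sum.Plus)
qed

lemma tensor_mult:
  assumes "tensor_fun X Y U V h" "tensor_fun X Y U V k"
  shows "tensor_fun X Y U V (\<lambda>z. h z * k z)"
proof -
  from assms(1) obtain n :: nat and f g where f: "\<And>i. i < n \<Longrightarrow> reg X U (f i)" "\<And>i. i < n \<Longrightarrow> reg Y V (g i)"
    "\<And>x y. h (x, y) = (\<Sum>i<n. f i x * g i y)" by (rule tensor_funE) blast
  from assms(2) obtain m :: nat and f' g' where f': "\<And>i. i < m \<Longrightarrow> reg X U (f' i)" "\<And>i. i < m \<Longrightarrow> reg Y V (g' i)"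
    "\<And>x y. k (x, y) = (\<Sum>i<m. f' i x * g' i y)" by (rule tensor_funE) blast
  show ?thesis
  proof (rule tensor_funI[of "{..<n} \<times> {..<m}" X U "\<lambda>(i, j) x. f i x * f' j x" Y V "\<lambda>(i, j) y. g i y * g' j y"])
    show "reg X U ((\<lambda>(i, j) x. f i x * f' j x) i)" if "i \<in> {..<n} \<times> {..<m}" for i
      using that f(1) f'(1) by (auto intro!: ringed_mult[OF X])
    show "reg Y V ((\<lambda>(i, j) y. g i y * g' j y) i)" if "i \<in> {..<n} \<times> {..<m}" for i
      using that f(2) f'(2) by (auto intro!: ringed_mult[OF Y])
    show "h (x, y) * k (x, y) = (\<Sum>i\<in>{..<n} \<times> {..<m}. (case i of (i, j) \<Rightarrow> \<lambda>x. f i x * f' j x) x *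
        (case i of (i, j) \<Rightarrow> \<lambda>y. g i y * g' j y) y)" for x y
      unfolding f(3) f'(3) sum_product sum.cartesian_product
      by (rule sum.cong) auto
  qed auto
qed

lemma tensor_single:
  assumes "reg X U f" "reg Y V g"
  shows "tensor_fun X Y U V (\<lambda>(x, y). f x * g y)"
  by (rule tensor_funI[of "{0::nat}" X U "\<lambda>_. f" Y V "\<lambda>_. g"]) (auto simp: assms)

lemma tensor_const:
  assumes "openin (zar X) U" "openin (zar Y) V"
  shows "tensor_fun X Y U V (\<lambda>z. c)"
  using tensor_single[OF ringed_const[OF X assms(1), of c] ringed_const[OF Y assms(2), of 1]]
  by (simp add: case_prod_unfold)

lemma tensor_restrict:
  assumes "tensor_fun X Y U V h" "openin (zar X) U'" "U' \<subseteq> U" "openin (zar Y) V'" "V' \<subseteq> V"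
  shows "tensor_fun X Y U' V' h"
proof -
  from assms(1) obtain n :: nat and f g where f: "\<And>i. i < n \<Longrightarrow> reg X U (f i)" "\<And>i. i < n \<Longrightarrow> reg Y V (g i)"
    "\<And>x y. h (x, y) = (\<Sum>i<n. f i x * g i y)" by (rule tensor_funE) blast
  show ?thesis
  proof (rule tensor_funI[of "{..<n}" X U' f Y V' g])
    show "reg X U' (f i)" if "i \<in> {..<n}" for i
      by (rule ringed_restrict[OF X f(1) assms(2,3)]) (use that in simp)
    show "reg Y V' (g i)" if "i \<in> {..<n}" for i
      by (rule ringed_restrict[OF Y f(2) assms(4,5)]) (use that in simp)
  qed (auto simp: f)
qed

definition prod_basis :: "(('a \<times> 'b) set \<times> ('a \<times> 'b \<Rightarrow> complex)) set" where
  "prod_basis = {({z \<in> U \<times> V. q z \<noteq> 0}, \<lambda>z. p z / q z) | U V p q.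
     openin (zar X) U \<and> openin (zar Y) V \<and> tensor_fun X Y U V p \<and> tensor_fun X Y U V q}"

lemma prod_basisI:
  "openin (zar X) U \<Longrightarrow> openin (zar Y) V \<Longrightarrow> tensor_fun X Y U V p \<Longrightarrow> tensor_fun X Y U V q \<Longrightarrow>
   Q = {z \<in> U \<times> V. q z \<noteq> 0} \<Longrightarrow> (\<And>z. g z = p z / q z) \<Longrightarrow> (Q, g) \<in> prod_basis"
  unfolding prod_basis_def mem_Collect_eq
  by (rule exI[of _ U], rule exI[of _ V], rule exI[of _ p], rule exI[of _ q]) auto

lemma prod_basisE:
  assumes "(Q, g) \<in> prod_basis"
  obtains U V p q where "openin (zar X) U" "openin (zar Y) V" "tensor_fun X Y U V p" "tensor_fun X Y U V q"
   "Q = {z \<in> U \<times> V. q z \<noteq> 0}" "g = (\<lambda>z. p z / q z)"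
  using assms unfolding prod_basis_def mem_Collect_eq prod.inject by blast

lemma fst_prod_basis: "fst ` prod_basis =
     {{z \<in> U \<times> V. h z \<noteq> 0} | U V h. openin (zar X) U \<and> openin (zar Y) V \<and> tensor_fun X Y U V h}"
  (is "?L = ?R")
proof
  show "?L \<subseteq> ?R"
  proof
    fix Q assume "Q \<in> ?L"
    then obtain g where "(Q, g) \<in> prod_basis" by auto
    then show "Q \<in> ?R" by (rule prod_basisE) blast
  qed
  show "?R \<subseteq> ?L"
  proof
    fix Q assume "Q \<in> ?R"
    then obtain U V h where "Q = {z \<in> U \<times> V. h z \<noteq> 0}" "openin (zar X) U" "openin (zar Y) V" "tensor_fun X Y U V h"
      by blast
    then have "(Q, \<lambda>z. h z / h z) \<in> prod_basis" by (intro prod_basisI) auto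
    then show "Q \<in> ?L" by (rule rev_image_eqI) simp
  qed
qed

lemma prod_basis_laws:
  "(Q, g) \<in> prod_basis \<Longrightarrow> \<exists>k. (Q, k) \<in> prod_basis \<and> (\<forall>y\<in>Q. k y = c)"
  "(Q, g) \<in> prod_basis \<Longrightarrow> (R, h) \<in> prod_basis \<Longrightarrow>
     \<exists>k. (Q \<inter> R, k) \<in> prod_basis \<and> (\<forall>y\<in>Q \<inter> R. k y = g y + h y)"
  "(Q, g) \<in> prod_basis \<Longrightarrow> (R, h) \<in> prod_basis \<Longrightarrow>
     \<exists>k. (Q \<inter> R, k) \<in> prod_basis \<and> (\<forall>y\<in>Q \<inter> R. k y = g y * h y)"
  "(Q, g) \<in> prod_basis \<Longrightarrow>
     \<exists>k. ({y \<in> Q. g y \<noteq> 0}, k) \<in> prod_basis \<and> (\<forall>y\<in>{y \<in> Q. g y \<noteq> 0}. k y = 1 / g y)"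
proof -
  assume "(Q, g) \<in> prod_basis"
  then obtain U V p q where pq: "openin (zar X) U" "openin (zar Y) V" "tensor_fun X Y U V p" "tensor_fun X Y U V q"
    "Q = {z \<in> U \<times> V. q z \<noteq> 0}" "g = (\<lambda>z. p z / q z)"
    by (rule prod_basisE)
  have "(Q, \<lambda>x. (c * q x) / q x) \<in> prod_basis"
    by (rule prod_basisI[OF pq(1,2) tensor_mult[OF tensor_const[OF pq(1,2), of c] pq(4)] pq(4)]) (auto simp: pq(5))
  then show "\<exists>k. (Q, k) \<in> prod_basis \<and> (\<forall>y\<in>Q. k y = c)"
    by - (rule exI, rule conjI, assumption, simp add: pq(5))
  have "({y \<in> Q. g y \<noteq> 0}, \<lambda>x. (q x * q x) / (p x * q x)) \<in> prod_basis"
    by (rule prod_basisI[OF pq(1,2) tensor_mult[OF pq(4,4)] tensor_mult[OF pq(3,4)]]) (auto simp: pq(5,6))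
  then show "\<exists>k. ({y \<in> Q. g y \<noteq> 0}, k) \<in> prod_basis \<and> (\<forall>y\<in>{y \<in> Q. g y \<noteq> 0}. k y = 1 / g y)"
    by - (rule exI, rule conjI, assumption, simp add: pq(5,6))
  {
    assume "(R, h) \<in> prod_basis"
    then obtain U' V' p' q' where pq': "openin (zar X) U'" "openin (zar Y) V'" "tensor_fun X Y U' V' p'"
      "tensor_fun X Y U' V' q'" "R = {z \<in> U' \<times> V'. q' z \<noteq> 0}" "h = (\<lambda>z. p' z / q' z)"
      by (rule prod_basisE)
    have o: "openin (zar X) (U \<inter> U')" "openin (zar Y) (V \<inter> V')" using pq pq' by auto
    have r: "tensor_fun X Y (U \<inter> U') (V \<inter> V') p" "tensor_fun X Y (U \<inter> U') (V \<inter> V') q"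
      "tensor_fun X Y (U \<inter> U') (V \<inter> V') p'" "tensor_fun X Y (U \<inter> U') (V \<inter> V') q'"
      by (rule tensor_restrict[OF _ o(1) _ o(2)], rule pq pq', simp, simp)+
    have "(Q \<inter> R, \<lambda>x. (p x * q' x + p' x * q x) / (q x * q' x)) \<in> prod_basis"
      by (rule prod_basisI[OF o tensor_add[OF tensor_mult[OF r(1,4)] tensor_mult[OF r(3,2)]] tensor_mult[OF r(2,4)]])
        (auto simp: pq(5) pq'(5))
    then show "\<exists>k. (Q \<inter> R, k) \<in> prod_basis \<and> (\<forall>y\<in>Q \<inter> R. k y = g y + h y)"
      by - (rule exI, rule conjI, assumption, simp add: pq(5,6) pq'(5,6) field_simps)
    have "(Q \<inter> R, \<lambda>x. (p x * p' x) / (q x * q' x)) \<in> prod_basis"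
      by (rule prod_basisI[OF o tensor_mult[OF r(1,3)] tensor_mult[OF r(2,4)]])
        (auto simp: pq(5) pq'(5))
    then show "\<exists>k. (Q \<inter> R, k) \<in> prod_basis \<and> (\<forall>y\<in>Q \<inter> R. k y = g y * h y)"
      by - (rule exI, rule conjI, assumption, simp add: pq(5,6) pq'(5,6))
  }
qed

lemma zar_prod: "zar (X \<times>\<^sub>v Y) = topology_generated_by (fst ` prod_basis)"
  unfolding fst_prod_basis by (simp add: fprod_def prod_zar_def)

lemma reg_prod:
  "reg (X \<times>\<^sub>v Y) U f \<longleftrightarrow> openin (zar (X \<times>\<^sub>v Y)) U \<and>
     (\<forall>x\<in>U. \<exists>Q g. (Q, g) \<in> prod_basis \<and> x \<in> Q \<and> (\<forall>y\<in>U \<inter> Q. f y = g y))"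
proof -
  have "(\<exists>S T p q. openin (zar X) S \<and> openin (zar Y) T \<and> z \<in> S \<times> T \<and>
          tensor_fun X Y S T p \<and> tensor_fun X Y S T q \<and> q z \<noteq> 0 \<and>
          (\<forall>z'\<in>U \<inter> (S \<times> T). q z' \<noteq> 0 \<longrightarrow> f z' = p z' / q z')) \<longleftrightarrow>
     (\<exists>Q g. (Q, g) \<in> prod_basis \<and> z \<in> Q \<and> (\<forall>y\<in>U \<inter> Q. f y = g y))" (is "?L \<longleftrightarrow> ?R") for z
  proof
    assume ?L
    then obtain S T p q where *: "openin (zar X) S" "openin (zar Y) T" "z \<in> S \<times> T"
          "tensor_fun X Y S T p" "tensor_fun X Y S T q" "q z \<noteq> 0"
          "\<forall>z'\<in>U \<inter> (S \<times> T). q z' \<noteq> 0 \<longrightarrow> f z' = p z' / q z'" by (elim exE conjE)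
    have "({z \<in> S \<times> T. q z \<noteq> 0}, \<lambda>z. p z / q z) \<in> prod_basis" by (rule prod_basisI[OF *(1,2,4,5)]) auto
    then show ?R by - (rule exI, rule exI, rule conjI, assumption, use * in auto)
  next
    assume ?R
    then obtain Q g where Q: "(Q, g) \<in> prod_basis" "z \<in> Q" "\<forall>y\<in>U \<inter> Q. f y = g y" by blast
    from Q(1) obtain S T p q where *: "openin (zar X) S" "openin (zar Y) T" "tensor_fun X Y S T p" "tensor_fun X Y S T q"
      "Q = {z \<in> S \<times> T. q z \<noteq> 0}" "g = (\<lambda>z. p z / q z)" by (rule prod_basisE)
    show ?L by (rule exI[of _ S], rule exI[of _ T], rule exI[of _ p], rule exI[of _ q]) (use * Q in auto)
  qed
  then show ?thesis by (simp add: fprod_def)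
qed

lemma ringed_fprod: "ringed (X \<times>\<^sub>v Y)"
  and openin_prod_basis:
    "openin (zar (X \<times>\<^sub>v Y)) U \<longleftrightarrow> (\<forall>x\<in>U. \<exists>Q\<in>fst ` prod_basis. x \<in> Q \<and> Q \<subseteq> U)"
proof -
  note r = ringed_from_basis[OF zar_prod reg_prod prod_basis_laws]
  show "ringed (X \<times>\<^sub>v Y)" by (rule r(1))
  show "openin (zar (X \<times>\<^sub>v Y)) U \<longleftrightarrow> (\<forall>x\<in>U. \<exists>Q\<in>fst ` prod_basis. x \<in> Q \<and> Q \<subseteq> U)"
    by (rule r(2))
qed

lemma openin_prodE:
  assumes "openin (zar (X \<times>\<^sub>v Y)) N" "z \<in> N"
  obtains U V h where "openin (zar X) U" "openin (zar Y) V" "tensor_fun X Y U V h" "z \<in> U \<times> V" "h z \<noteq> 0"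
    "{z \<in> U \<times> V. h z \<noteq> 0} \<subseteq> N"
proof -
  from assms obtain Q g where Q: "(Q, g) \<in> prod_basis" "z \<in> Q" "Q \<subseteq> N" unfolding openin_prod_basis by fastforce
  from Q(1) show ?thesis
  proof (rule prod_basisE)
    fix U V p q assume "openin (zar X) U" "openin (zar Y) V" "tensor_fun X Y U V q" "Q = {z \<in> U \<times> V. q z \<noteq> 0}"
    with Q that[of U V q] show ?thesis by blast
  qed
qed

lemma openin_prodI:
  assumes "openin (zar X) U" "openin (zar Y) V" "tensor_fun X Y U V h"
  shows "openin (zar (X \<times>\<^sub>v Y)) {z \<in> U \<times> V. h z \<noteq> 0}"
  unfolding zar_prod fst_prod_basis
  by (rule topology_generated_by_Basis) (use assms in blast)

lemma openin_times:
  assumes "openin (zar X) U" "openin (zar Y) V"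
  shows "openin (zar (X \<times>\<^sub>v Y)) (U \<times> V)"
  using openin_prodI[OF assms tensor_const[OF assms, of 1]] by simp

lemma pts_fprod: "pts (X \<times>\<^sub>v Y) = pts X \<times> pts Y"
proof
  show "pts (X \<times>\<^sub>v Y) \<subseteq> pts X \<times> pts Y"
  proof
    fix z assume "z \<in> pts (X \<times>\<^sub>v Y)"
    from openin_prodE[OF openin_topspace this] obtain U V
      where UV: "openin (zar X) U" "openin (zar Y) V" "z \<in> U \<times> V" by blast
    show "z \<in> pts X \<times> pts Y" using openin_subset[OF UV(1)] openin_subset[OF UV(2)] UV(3) by blast
  qed
  show "pts X \<times> pts Y \<subseteq> pts (X \<times>\<^sub>v Y)"
    by (rule openin_subset[OF openin_times]) auto
qed

end

section \<open>Morphisms\<close>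

lemma morphismI:
  assumes "\<And>x. x \<in> pts X \<Longrightarrow> f x \<in> pts Y"
    "\<And>V. openin (zar Y) V \<Longrightarrow> openin (zar X) {x \<in> pts X. f x \<in> V}"
    "\<And>V g. reg Y V g \<Longrightarrow> reg X {x \<in> pts X. f x \<in> V} (\<lambda>x. g (f x))"
  shows "morphism X Y f"
  using assms by (auto simp: morphism_def continuous_map_def comp_def Pi_iff)

lemma morphism_pts: "morphism X Y f \<Longrightarrow> x \<in> pts X \<Longrightarrow> f x \<in> pts Y"
  by (auto simp: morphism_def continuous_map_def)

lemma morphism_openin: "morphism X Y f \<Longrightarrow> openin (zar Y) V \<Longrightarrow> openin (zar X) {x \<in> pts X. f x \<in> V}"
  by (auto simp: morphism_def continuous_map_def)

lemma morphism_reg: "morphism X Y f \<Longrightarrow> reg Y V g \<Longrightarrow> reg X {x \<in> pts X. f x \<in> V} (\<lambda>x. g (f x))"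
  by (auto simp: morphism_def comp_def)

lemma morphism_reg_all:
  assumes "morphism X Y f" "reg Y (pts Y) g"
  shows "reg X (pts X) (\<lambda>x. g (f x))"
proof -
  have "{x \<in> pts X. f x \<in> pts Y} = pts X" using morphism_pts[OF assms(1)] by blast
  then show ?thesis using morphism_reg[OF assms] by simp
qed

lemma morphism_cong:
  assumes "ringed X" "morphism X Y f" "\<And>x. x \<in> pts X \<Longrightarrow> f x = g x"
  shows "morphism X Y g"
proof (rule morphismI)
  fix x assume "x \<in> pts X" then show "g x \<in> pts Y" using morphism_pts[OF assms(2)] assms(3) by simp
next
  have eq: "{x \<in> pts X. g x \<in> V} = {x \<in> pts X. f x \<in> V}" for V using assms(3) by auto
  show "openin (zar X) {x \<in> pts X. g x \<in> V}" if "openin (zar Y) V" for V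
    unfolding eq by (rule morphism_openin[OF assms(2) that])
  show "reg X {x \<in> pts X. g x \<in> V} (\<lambda>x. h (g x))" if "reg Y V h" for V h
    unfolding eq by (rule ringed_cong[OF assms(1) morphism_reg[OF assms(2) that]]) (use assms(3) in auto)
qed

lemma morphism_compose:
  assumes "morphism X Y f" "morphism Y Z g"
  shows "morphism X Z (\<lambda>x. g (f x))"
proof (rule morphismI)
  have eq: "{x \<in> pts X. f x \<in> {y \<in> pts Y. g y \<in> V}} = {x \<in> pts X. g (f x) \<in> V}" for V
    using morphism_pts[OF assms(1)] by auto
  show "openin (zar X) {x \<in> pts X. g (f x) \<in> V}" if "openin (zar Z) V" for V
    using morphism_openin[OF assms(1) morphism_openin[OF assms(2) that]] unfolding eq .
  show "reg X {x \<in> pts X. g (f x) \<in> V} (\<lambda>x. h (g (f x)))" if "reg Z V h" for V h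
    using morphism_reg[OF assms(1) morphism_reg[OF assms(2) that]] unfolding eq .
qed (rule morphism_pts[OF assms(2) morphism_pts[OF assms(1)]])

text \<open>Regular functions on a subspace are locally restrictions of regular functions on the ambient
  space, so there is nothing more to test.\<close>

lemma morphism_into_subspace:
  assumes "ringed X" "morphism X Y f" "\<And>x. x \<in> pts X \<Longrightarrow> f x \<in> A"
  shows "morphism X (subspace_on Y A) f"
proof (rule morphismI)
  show "f x \<in> pts (subspace_on Y A)" if "x \<in> pts X" for x
    using that assms(3) morphism_pts[OF assms(2)] by simp
  show o: "openin (zar X) {x \<in> pts X. f x \<in> V}" if "openin (zar (subspace_on Y A)) V" for V
  proof -
    from that obtain T where T: "openin (zar Y) T" "V = T \<inter> A" by (auto simp: openin_subtopology)
    have "{x \<in> pts X. f x \<in> V} = {x \<in> pts X. f x \<in> T}" using T assms(3) by auto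
    then show ?thesis using morphism_openin[OF assms(2) T(1)] by simp
  qed
  show "reg X {x \<in> pts X. f x \<in> V} (\<lambda>x. g (f x))" if V: "reg (subspace_on Y A) V g" for V g
  proof (rule ringed_local[OF assms(1)])
    show "openin (zar X) {x \<in> pts X. f x \<in> V}" by (rule o) (use V in \<open>simp add: reg_subspace\<close>)
    fix x assume x: "x \<in> {x \<in> pts X. f x \<in> V}"
    with V obtain W h where W: "f x \<in> W" "reg Y W h" "\<forall>y\<in>V \<inter> W. g y = h y" unfolding reg_subspace by blast
    show "\<exists>U k. x \<in> U \<and> reg X U k \<and> (\<forall>y\<in>{x \<in> pts X. f x \<in> V} \<inter> U. g (f y) = k y)"
      by (rule exI[of _ "{x \<in> pts X. f x \<in> W}"], rule exI[of _ "\<lambda>x. h (f x)"])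
        (use x W morphism_reg[OF assms(2) W(2)] in auto)
  qed
qed

lemma morphism_restrict:
  assumes "ringed X" "morphism X Y f"
  shows "morphism (subspace_on X A) Y f"
proof (rule morphismI)
  have eq: "{x \<in> pts (subspace_on X A). f x \<in> V} = {x \<in> pts X. f x \<in> V} \<inter> A" for V by auto
  show "openin (zar (subspace_on X A)) {x \<in> pts (subspace_on X A). f x \<in> V}" if "openin (zar Y) V" for V
    unfolding eq using morphism_openin[OF assms(2) that] by (auto simp: openin_subtopology)
  show "reg (subspace_on X A) {x \<in> pts (subspace_on X A). f x \<in> V} (\<lambda>x. g (f x))" if "reg Y V g" for V g
    unfolding eq by (rule reg_subspaceI[OF assms(1) morphism_reg[OF assms(2) that]])
qed (use morphism_pts[OF assms(2)] in auto)

lemma morphism_id: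
  assumes "ringed X"
  shows "morphism X X (\<lambda>x. x)"
proof (rule morphismI)
  have eq: "{x \<in> pts X. x \<in> V} = V" if "openin (zar X) V" for V using openin_subset[OF that] by auto
  show "openin (zar X) {x \<in> pts X. x \<in> V}" if "openin (zar X) V" for V using that by (simp add: eq)
  show "reg X {x \<in> pts X. x \<in> V} (\<lambda>x. g x)" if "reg X V g" for V g
    using that by (simp add: eq[OF ringed_openin[OF assms that]])
qed

lemma morphism_subspace: "ringed X \<Longrightarrow> morphism (subspace_on X A) X (\<lambda>x. x)"
  by (rule morphism_restrict[OF _ morphism_id])

lemma morphism_from_subspace:
  assumes "ringed Y" "morphism X (subspace_on Y A) f"
  shows "morphism X Y f"
  using morphism_compose[OF assms(2) morphism_subspace[OF assms(1)]] .

text \<open>Basic open sets and regular functions on affine space are built from polynomials in the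
  coordinates, and the regular functions on \<open>X\<close> form rings.\<close>

lemma morphism_affineI:
  assumes "ringed X" "\<And>x. x \<in> pts X \<Longrightarrow> length (f x) = n" "\<And>i. i < n \<Longrightarrow> reg X (pts X) (\<lambda>x. f x ! i)"
  shows "morphism X (affine_space n) f"
proof -
  have p: "reg X (pts X) (\<lambda>x. peval p (f x))" if "pvars p \<subseteq> {..<n}" for p
    by (rule ringed_peval[OF assms(1)]) (use that assms(3) in auto)
  have o: "openin (zar X) {x \<in> pts X. f x \<in> V}" if V: "openin (zar (affine_space n)) V" for V
  proof (subst openin_subopen, intro ballI)
    fix x assume x: "x \<in> {x \<in> pts X. f x \<in> V}"
    with V obtain q where q: "pvars q \<subseteq> {..<n}" "peval q (f x) \<noteq> 0" "{y. length y = n \<and> peval q y \<noteq> 0} \<subseteq> V"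
      unfolding zar_affine openin_affine by blast
    show "\<exists>T. openin (zar X) T \<and> x \<in> T \<and> T \<subseteq> {x \<in> pts X. f x \<in> V}"
      by (rule exI[of _ "{x \<in> pts X. peval q (f x) \<noteq> 0}"])
        (use q x assms(2) ringed_nonzero[OF assms(1) p[OF q(1)]] in auto)
  qed
  show ?thesis
  proof (rule morphismI[OF _ o])
    fix V g assume g: "reg (affine_space n) V g"
    show "reg X {x \<in> pts X. f x \<in> V} (\<lambda>x. g (f x))"
    proof (rule ringed_local[OF assms(1) o[OF ringed_openin[OF ringed_affine g]]])
      fix x assume x: "x \<in> {x \<in> pts X. f x \<in> V}"
      then obtain r q where *: "pvars r \<subseteq> {..<n}" "pvars q \<subseteq> {..<n}" "peval q (f x) \<noteq> 0"
        "\<And>y. y \<in> V \<Longrightarrow> peval q y \<noteq> 0 \<Longrightarrow> g y = peval r y / peval q y"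
        using reg_affineE[OF g, of "f x"] by auto
      let ?U = "{x \<in> pts X. peval q (f x) \<noteq> 0}"
      have "openin (zar X) ?U" by (rule ringed_nonzero[OF assms(1) p[OF *(2)]])
      then have "reg X ?U (\<lambda>x. peval r (f x) / peval q (f x))"
        by (intro ringed_divide[OF assms(1)] ringed_restrict[OF assms(1) p] *) auto
      then show "\<exists>U k. x \<in> U \<and> reg X U k \<and> (\<forall>y\<in>{x \<in> pts X. f x \<in> V} \<inter> U. g (f y) = k y)"
        by (intro exI[of _ ?U] exI[of _ "\<lambda>x. peval r (f x) / peval q (f x)"]) (use x * in auto)
    qed
  qed (use assms in auto)
qed

lemma morphism_affineD:
  assumes "morphism X (affine_space n) f"
  shows "x \<in> pts X \<Longrightarrow> length (f x) = n" "i < n \<Longrightarrow> reg X (pts X) (\<lambda>x. f x ! i)"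
  using morphism_pts[OF assms] morphism_reg_all[OF assms reg_affine_coord] by auto

text \<open>The form in which maps into weighted projective space are given: by homogeneous coordinates
  that are regular functions without common zero.\<close>

lemma morphism_wprojI:
  assumes "ringed X" "\<And>x. x \<in> pts X \<Longrightarrow> f x \<in> nonzero_vecs (length a)"
    "\<And>i. i < length a \<Longrightarrow> reg X (pts X) (\<lambda>x. f x ! i)"
  shows "morphism X (wproj_space a) (\<lambda>x. orbit a (f x))"
proof -
  have p: "reg X (pts X) (\<lambda>x. peval p (f x))" if "whomog a d p" for p d
    by (rule ringed_peval[OF assms(1)]) (use that assms(3) in \<open>auto simp: whomog_def\<close>)
  have eq: "{x \<in> pts X. orbit a (f x) \<in> wopen a q} = {x \<in> pts X. peval q (f x) \<noteq> 0}" if "whomog a d q" for q d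
    using orbit_in_wopen[OF that assms(2)] by auto
  have o: "openin (zar X) {x \<in> pts X. orbit a (f x) \<in> V}" if V: "openin (zar (wproj_space a)) V" for V
  proof (subst openin_subopen, intro ballI)
    fix x assume x: "x \<in> {x \<in> pts X. orbit a (f x) \<in> V}"
    with V obtain q d where q: "whomog a d q" "orbit a (f x) \<in> wopen a q" "wopen a q \<subseteq> V"
      unfolding openin_wproj_basis fst_wproj_basis by auto
    show "\<exists>T. openin (zar X) T \<and> x \<in> T \<and> T \<subseteq> {x \<in> pts X. orbit a (f x) \<in> V}"
      by (rule exI[of _ "{x \<in> pts X. orbit a (f x) \<in> wopen a q}"])
        (use q x ringed_nonzero[OF assms(1) p[OF q(1)]] eq[OF q(1)] in auto)
  qed
  show ?thesis
  proof (rule morphismI[OF _ o])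
    fix V g assume g: "reg (wproj_space a) V g"
    show "reg X {x \<in> pts X. orbit a (f x) \<in> V} (\<lambda>x. g (orbit a (f x)))"
    proof (rule ringed_local[OF assms(1) o[OF ringed_openin[OF ringed_wproj g]]])
      fix x assume x: "x \<in> {x \<in> pts X. orbit a (f x) \<in> V}"
      then have fx: "f x \<in> nonzero_vecs (length a)" "orbit a (f x) \<in> V" using assms(2) by auto
      from g fx obtain d r q where *: "whomog a d r" "whomog a d q" "peval q (f x) \<noteq> 0"
        "\<forall>v'\<in>nonzero_vecs (length a). orbit a v' \<in> V \<and> peval q v' \<noteq> 0 \<longrightarrow>
            g (orbit a v') = peval r v' / peval q v'"
        unfolding wproj_space_def by simp blast
      let ?U = "{x \<in> pts X. peval q (f x) \<noteq> 0}"
      have "openin (zar X) ?U" by (rule ringed_nonzero[OF assms(1) p[OF *(2)]])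
      then have "reg X ?U (\<lambda>x. peval r (f x) / peval q (f x))"
        by (intro ringed_divide[OF assms(1)] ringed_restrict[OF assms(1) p[OF *(1)]] ringed_restrict[OF assms(1) p[OF *(2)]]) auto
      then show "\<exists>U k. x \<in> U \<and> reg X U k \<and>
            (\<forall>y\<in>{x \<in> pts X. orbit a (f x) \<in> V} \<inter> U. g (orbit a (f y)) = k y)"
        by (intro exI[of _ ?U] exI[of _ "\<lambda>x. peval r (f x) / peval q (f x)"]) (use x * assms(2) in auto)
    qed
  qed (use assms(2) in \<open>auto simp: pts_wproj[unfolded zar_wproj]\<close>)
qed

lemma morphism_fst:
  assumes "ringed X" "ringed Y"
  shows "morphism (X \<times>\<^sub>v Y) X fst"
proof (rule morphismI)
  have eq: "{z \<in> pts (X \<times>\<^sub>v Y). fst z \<in> V} = V \<times> pts Y" if "openin (zar X) V" for V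
    using openin_subset[OF that] by (auto simp: pts_fprod[OF assms])
  show o: "openin (zar (X \<times>\<^sub>v Y)) {z \<in> pts (X \<times>\<^sub>v Y). fst z \<in> V}" if "openin (zar X) V" for V
    unfolding eq[OF that] by (rule openin_times[OF assms that openin_topspace])
  fix V g assume g: "reg X V g"
  have V: "openin (zar X) V" by (rule ringed_openin[OF assms(1) g])
  have "(V \<times> pts Y, \<lambda>z. g (fst z)) \<in> prod_basis X Y"
    by (rule prod_basisI[OF assms V openin_topspace tensor_single[OF assms g ringed_const_pts[OF assms(2), of 1]]
          tensor_const[OF assms V openin_topspace, of 1]]) auto
  with o[OF V] show "reg (X \<times>\<^sub>v Y) {z \<in> pts (X \<times>\<^sub>v Y). fst z \<in> V} (\<lambda>z. g (fst z))"
    unfolding reg_prod[OF assms] eq[OF V] by blast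
qed (simp add: pts_fprod[OF assms] mem_Times_iff)

lemma morphism_snd:
  assumes "ringed X" "ringed Y"
  shows "morphism (X \<times>\<^sub>v Y) Y snd"
proof (rule morphismI)
  have eq: "{z \<in> pts (X \<times>\<^sub>v Y). snd z \<in> V} = pts X \<times> V" if "openin (zar Y) V" for V
    using openin_subset[OF that] by (auto simp: pts_fprod[OF assms])
  show o: "openin (zar (X \<times>\<^sub>v Y)) {z \<in> pts (X \<times>\<^sub>v Y). snd z \<in> V}" if "openin (zar Y) V" for V
    unfolding eq[OF that] by (rule openin_times[OF assms openin_topspace that])
  fix V g assume g: "reg Y V g"
  have V: "openin (zar Y) V" by (rule ringed_openin[OF assms(2) g])
  have "(pts X \<times> V, \<lambda>z. g (snd z)) \<in> prod_basis X Y"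
    by (rule prod_basisI[OF assms openin_topspace V tensor_single[OF assms ringed_const_pts[OF assms(1), of 1] g]
          tensor_const[OF assms openin_topspace V, of 1]]) auto
  with o[OF V] show "reg (X \<times>\<^sub>v Y) {z \<in> pts (X \<times>\<^sub>v Y). snd z \<in> V} (\<lambda>z. g (snd z))"
    unfolding reg_prod[OF assms] eq[OF V] by blast
qed (simp add: pts_fprod[OF assms] mem_Times_iff)

text \<open>With the two projections, this makes \<open>X \<times>\<^sub>v Y\<close> the categorical product.\<close>

lemma morphism_pair:
  assumes "ringed X" "ringed Y" "ringed Z" "morphism Z X f" "morphism Z Y g"
  shows "morphism Z (X \<times>\<^sub>v Y) (\<lambda>z. (f z, g z))"
proof -
  have t: "openin (zar Z) {z \<in> pts Z. f z \<in> U \<and> g z \<in> V}"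
    "reg Z {z \<in> pts Z. f z \<in> U \<and> g z \<in> V} (\<lambda>z. h (f z, g z))"
    if UV: "openin (zar X) U" "openin (zar Y) V" and h: "tensor_fun X Y U V h" for U V h
  proof -
    let ?N = "{z \<in> pts Z. f z \<in> U \<and> g z \<in> V}"
    have "?N = {z \<in> pts Z. f z \<in> U} \<inter> {z \<in> pts Z. g z \<in> V}" by auto
    also have "openin (zar Z) \<dots>"
      using morphism_openin[OF assms(4) UV(1)] morphism_openin[OF assms(5) UV(2)] by blast
    finally show N: "openin (zar Z) ?N" .
    from h obtain n :: nat and a b where ab: "\<And>i. i < n \<Longrightarrow> reg X U (a i)" "\<And>i. i < n \<Longrightarrow> reg Y V (b i)"
      "\<And>x y. h (x, y) = (\<Sum>i<n. a i x * b i y)" by (rule tensor_funE) blast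
    have "reg Z ?N (\<lambda>z. a i (f z))" "reg Z ?N (\<lambda>z. b i (g z))" if "i < n" for i
      by (rule ringed_restrict[OF assms(3) morphism_reg[OF assms(4) ab(1)[OF that]] N], blast)
        (rule ringed_restrict[OF assms(3) morphism_reg[OF assms(5) ab(2)[OF that]] N], blast)
    then show "reg Z ?N (\<lambda>z. h (f z, g z))"
      unfolding ab(3) by (intro ringed_sum[OF assms(3) N] ringed_mult[OF assms(3)]) auto
  qed
  have o: "openin (zar Z) {z \<in> pts Z. (f z, g z) \<in> N}" if N: "openin (zar (X \<times>\<^sub>v Y)) N" for N
  proof (subst openin_subopen, intro ballI)
    fix z assume z: "z \<in> {z \<in> pts Z. (f z, g z) \<in> N}"
    then have "(f z, g z) \<in> N" by simp
    from openin_prodE[OF assms(1,2) N this] obtain U V h where *: "openin (zar X) U" "openin (zar Y) V"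
      "tensor_fun X Y U V h" "(f z, g z) \<in> U \<times> V" "h (f z, g z) \<noteq> 0" "{z \<in> U \<times> V. h z \<noteq> 0} \<subseteq> N" by blast
    show "\<exists>T. openin (zar Z) T \<and> z \<in> T \<and> T \<subseteq> {z \<in> pts Z. (f z, g z) \<in> N}"
      by (rule exI, rule conjI, rule ringed_nonzero[OF assms(3) t(2)[OF *(1-3)]]) (use * z in auto)
  qed
  show ?thesis
  proof (rule morphismI[OF _ o])
    fix N k assume k: "reg (X \<times>\<^sub>v Y) N k"
    show "reg Z {z \<in> pts Z. (f z, g z) \<in> N} (\<lambda>z. k (f z, g z))"
    proof (rule ringed_local[OF assms(3) o[OF ringed_openin[OF ringed_fprod[OF assms(1,2)] k]]])
      fix z assume z: "z \<in> {z \<in> pts Z. (f z, g z) \<in> N}"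
      with k obtain Q u where Q: "(Q, u) \<in> prod_basis X Y" "(f z, g z) \<in> Q" "\<forall>y\<in>N \<inter> Q. k y = u y"
        unfolding reg_prod[OF assms(1,2)] by blast
      from prod_basisE[OF assms(1,2) Q(1)] obtain U V p q where *: "openin (zar X) U" "openin (zar Y) V"
        "tensor_fun X Y U V p" "tensor_fun X Y U V q" "Q = {z \<in> U \<times> V. q z \<noteq> 0}" "u = (\<lambda>z. p z / q z)" by blast
      let ?N = "{z \<in> pts Z. f z \<in> U \<and> g z \<in> V}"
      have o': "openin (zar Z) {z \<in> ?N. q (f z, g z) \<noteq> 0}" by (rule ringed_nonzero[OF assms(3) t(2)[OF *(1,2,4)]])
      have "reg Z {z \<in> ?N. q (f z, g z) \<noteq> 0} (\<lambda>z. p (f z, g z) / q (f z, g z))"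
        by (rule ringed_divide[OF assms(3) ringed_restrict[OF assms(3) t(2)[OF *(1,2,3)] o']
              ringed_restrict[OF assms(3) t(2)[OF *(1,2,4)] o']]) auto
      then show "\<exists>S j. z \<in> S \<and> reg Z S j \<and> (\<forall>y\<in>{z \<in> pts Z. (f z, g z) \<in> N} \<inter> S. k (f y, g y) = j y)"
        by (intro exI[of _ "{z \<in> ?N. q (f z, g z) \<noteq> 0}"] exI[of _ "\<lambda>z. p (f z, g z) / q (f z, g z)"])
          (use * Q z in auto)
    qed
  qed (use morphism_pts[OF assms(4)] morphism_pts[OF assms(5)] in \<open>simp add: pts_fprod[OF assms(1,2)]\<close>)
qed

lemma isomorphismI:
  assumes "ringed X" "ringed Y" "morphism X Y f" "morphism Y X g"
    "\<And>x. x \<in> pts X \<Longrightarrow> g (f x) = x" "\<And>y. y \<in> pts Y \<Longrightarrow> f (g y) = y"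
  shows "isomorphism X Y f"
proof -
  have b: "bij_betw f (pts X) (pts Y)"
    by (rule bij_betwI[of _ _ _ g]) (use assms morphism_pts in auto)
  have "inv_into (pts X) f y = g y" if "y \<in> pts Y" for y
    using inv_into_f_eq[of f "pts X" "g y" y] b that assms(6)[OF that] morphism_pts[OF assms(4) that]
    by (auto simp: bij_betw_def)
  then have "morphism Y X (inv_into (pts X) f)" by (intro morphism_cong[OF assms(2,4)]) simp
  with b assms(3) show ?thesis by (simp add: isomorphism_def)
qed

lemma isomorphismE:
  assumes "isomorphism X Y f"
  obtains g where "morphism X Y f" "morphism Y X g" "\<And>x. x \<in> pts X \<Longrightarrow> g (f x) = x"
    "\<And>y. y \<in> pts Y \<Longrightarrow> f (g y) = y"
  by (rule that[of "inv_into (pts X) f"])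
    (use assms in \<open>auto simp: isomorphism_def bij_betw_inv_into_left bij_betw_inv_into_right\<close>)

text \<open>Continuity of a morphism that is defined on an open subset only.\<close>

lemma morphism_open_subspace:
  assumes "morphism (subspace_on X A) Y f" "openin (zar X) A" "openin (zar Y) B"
  shows "openin (zar X) {x \<in> A. f x \<in> B}"
proof -
  have "openin (zar X) {x \<in> pts (subspace_on X A). f x \<in> B}"
    using morphism_openin[OF assms(1,3)] assms(2) by (simp add: openin_open_subtopology)
  moreover have "{x \<in> pts (subspace_on X A). f x \<in> B} = {x \<in> A. f x \<in> B}"
    using openin_subset[OF assms(2)] by auto
  ultimately show ?thesis by simp
qed

lemma ringed_fibre_product [simp]: "ringed X \<Longrightarrow> ringed Y \<Longrightarrow> ringed (fibre_product X f Y g)"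
  by (simp add: fibre_product_def ringed_fprod)

lemma pts_fibre_product:
  "ringed X \<Longrightarrow> ringed Y \<Longrightarrow> pts (fibre_product X f Y g) = {(x, y). x \<in> pts X \<and> y \<in> pts Y \<and> f x = g y}"
  by (auto simp: fibre_product_def pts_fprod)

lemma morphism_fibre_product_fst:
  "ringed X \<Longrightarrow> ringed Y \<Longrightarrow> morphism (fibre_product X f Y g) X fst"
  unfolding fibre_product_def by (intro morphism_restrict morphism_fst ringed_fprod)

lemma morphism_fibre_product_snd:
  "ringed X \<Longrightarrow> ringed Y \<Longrightarrow> morphism (fibre_product X f Y g) Y snd"
  unfolding fibre_product_def by (intro morphism_restrict morphism_snd ringed_fprod)

lemma morphism_fibre_productI:
  assumes "ringed X" "ringed Y" "ringed Z" "morphism Z X h" "morphism Z Y k"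
    "\<And>z. z \<in> pts Z \<Longrightarrow> f (h z) = g (k z)"
  shows "morphism Z (fibre_product X f Y g) (\<lambda>z. (h z, k z))"
  unfolding fibre_product_def
  by (intro morphism_into_subspace morphism_pair assms) (use assms(6) in auto)

lemma binary_form_whomog:
  assumes "binary_form d G"
  shows "whomog [1, 1, 1] d G"
  unfolding whomog_alt
proof (intro conjI ballI)
  show "pvars G \<subseteq> {..<length [1, 1, 1 :: nat]}" using assms by (auto simp: binary_form_def)
  fix m assume m: "m \<in> Poly_Mapping.keys G"
  then have "Poly_Mapping.keys m \<subseteq> {1, 2}" using assms by (auto simp: binary_form_def pvars_def)
  then have "mweight [1, 1, 1] m = (\<Sum>i\<in>{1, 2}. [1, 1, 1] ! i * Poly_Mapping.lookup m i)"
    by (intro mweight_superset) auto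
  then show "mweight [1, 1, 1] m = d" using assms m by (simp add: binary_form_def numeral_2_eq_2)
qed

lemma bval_scale:
  assumes "binary_form d G"
  shows "bval G (l * x) (l * y) = l ^ d * bval G x y"
  using peval_scale[OF binary_form_whomog[OF assms], of "[0, x, y]" l] by (simp add: bval_def)

lemma bval_dehom:
  assumes "binary_form d G"
  shows "bval G x (t * x) = x ^ d * dehom G t"
  using bval_scale[OF assms, of x 1 t] by (simp add: dehom_def mult.commute)

lemma binary_form_pvars: "binary_form d G \<Longrightarrow> pvars G \<subseteq> {1, 2}"
  by (simp add: binary_form_def)

lemma ringed_dehom:
  assumes "ringed X" "pvars G \<subseteq> {1, 2}" "reg X U g"
  shows "reg X U (\<lambda>x. dehom G (g x))"
  unfolding dehom_def bval_def
proof (rule ringed_peval[OF assms(1) ringed_openin[OF assms(1,3)]])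
  fix i assume "i \<in> pvars G"
  then have "i = 1 \<or> i = 2" using assms(2) by auto
  then show "reg X U (\<lambda>x. [0, 1, g x] ! i)"
    using assms(3) ringed_const[OF assms(1) ringed_openin[OF assms(1,3)], of 1] by (auto simp: numeral_2_eq_2)
qed

lemma P1_wproj: "P1 = wproj_space [1, 1]"
  by (simp add: proj_space_def numeral_2_eq_2)

lemma length_2_iff: "length v = 2 \<longleftrightarrow> (\<exists>a b. v = [a, b])"
  by (auto simp: numeral_2_eq_2 length_Suc_conv)

lemma pts_P1: "pts P1 = {pt2 x y | x y. (x, y) \<noteq> (0, 0)}"
proof -
  have "nonzero_vecs 2 = {[x, y] | x y. (x, y) \<noteq> (0, 0)}"
    by (auto simp: nonzero_vecs_def length_2_iff)
  then show ?thesis unfolding P1_wproj pts_wproj by (auto simp: numeral_2_eq_2)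
qed

lemma pt2_eq_iff: "pt2 a b = pt2 c d \<longleftrightarrow> (\<exists>l. l \<noteq> 0 \<and> a = l * c \<and> b = l * d)"
proof
  assume "pt2 a b = pt2 c d"
  from orbit_eqD[OF this] show "\<exists>l. l \<noteq> 0 \<and> a = l * c \<and> b = l * d" by auto
next
  assume "\<exists>l. l \<noteq> 0 \<and> a = l * c \<and> b = l * d"
  then obtain l where l: "l \<noteq> 0" "a = l * c" "b = l * d" by blast
  show "pt2 a b = pt2 c d" by (rule orbit_eqI[OF l(1)]) (use l in auto)
qed

text \<open>Simplification turns the weights \<open>[1, 1]\<close> into \<open>[Suc 0, Suc 0]\<close>; the variants with this ending
  match such terms.\<close>

lemmas pt2_eq_iff_Suc = pt2_eq_iff[unfolded One_nat_def]

lemma pt2_inject: "pt2 1 t = pt2 1 t' \<longleftrightarrow> t = t'"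
  by (auto simp: pt2_eq_iff_Suc)

lemma pt2_normal: "x \<noteq> 0 \<Longrightarrow> pt2 x y = pt2 1 (y / x)"
  unfolding pt2_eq_iff by (rule exI[of _ x]) simp

lemma in_zeros_P1_iff:
  assumes "binary_form d G"
  shows "pt2 1 t \<in> zeros_P1 G \<longleftrightarrow> dehom G t = 0"
proof
  assume "pt2 1 t \<in> zeros_P1 G"
  then obtain x y where xy: "pt2 1 t = pt2 x y" "bval G x y = 0" by (auto simp: zeros_P1_def)
  then obtain l where l: "1 = l * x" "t = l * y" unfolding pt2_eq_iff by blast
  have "dehom G t = l ^ d * bval G x y" unfolding dehom_def using bval_scale[OF assms, of l x y] l by simp
  then show "dehom G t = 0" using xy by simp
next
  assume "dehom G t = 0"
  then show "pt2 1 t \<in> zeros_P1 G" unfolding zeros_P1_def dehom_def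
    by (intro CollectI exI[of _ 1] exI[of _ t]) simp
qed

lemma P_circ_iff:
  assumes "binary_form d3 F3" "binary_form d6 F6"
  shows "pt2 1 t \<in> P_circ F3 F6 \<longleftrightarrow> t \<noteq> 0 \<and> dehom F3 t \<noteq> 0 \<and> dehom F6 t \<noteq> 0"
proof -
  have "pt2 1 t \<in> pts P1" unfolding pts_P1 by (intro CollectI exI[of _ 1] exI[of _ t]) simp
  moreover have "pt2 1 t \<noteq> pt2 0 1" by (simp add: pt2_eq_iff_Suc)
  moreover have "pt2 1 t = pt2 1 0 \<longleftrightarrow> t = 0" by (rule pt2_inject)
  ultimately show ?thesis
    unfolding P_circ_def Diff_iff Un_iff insert_iff in_zeros_P1_iff[OF assms(1)] in_zeros_P1_iff[OF assms(2)]
    by blast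
qed

lemma t_proj_eq_iff: "t_proj z = t_proj z' \<longleftrightarrow> last z = last z'"
  unfolding t_proj_def by (rule pt2_inject)

section \<open>The isomorphism over the affine pieces\<close>

locale sextic_pair =
  fixes F3 F6 :: mpol
  assumes V: "(F3, F6) \<in> V_circ"
begin

lemma F3: "binary_form 3 F3" and F6: "binary_form 6 F6"
  using V by (auto simp: V_circ_def)

abbreviation f3 where "f3 \<equiv> dehom F3"
abbreviation f6 where "f6 \<equiv> dehom F6"

lemma P_circ: "pt2 1 t \<in> P_circ F3 F6 \<longleftrightarrow> t \<noteq> 0 \<and> f3 t \<noteq> 0 \<and> f6 t \<noteq> 0"
  by (rule P_circ_iff[OF F3 F6])

lemmas P_circ_Suc = P_circ[unfolded One_nat_def]

abbreviation Wo where "Wo \<equiv> W_circ F3 F6"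
abbreviation Co where "Co \<equiv> C_circ F3 F6"
abbreviation WCo where "WCo \<equiv> WC_circ F3 F6"

lemma ringed_circ [simp]: "ringed Wo" "ringed Co" "ringed D_circ" "ringed (C_plane F3 F6)"
  by (simp_all add: W_circ_def C_circ_def D_circ_def C_plane_def)

lemma ringed_WCo [simp]: "ringed WCo" "ringed (D_circ \<times>\<^sub>v Co)"
  by (simp_all add: ringed_fprod)

lemma pts_Wo: "pts Wo = {[w, x, t] | w x t. t \<noteq> 0 \<and> f3 t \<noteq> 0 \<and> f6 t \<noteq> 0 \<and> w ^ 2 = x * f3 t + x ^ 4 * f6 t}"
  by (auto simp: W_circ_def P_circ_Suc)

lemma pts_Co: "pts Co = {[y, t] | y t. t \<noteq> 0 \<and> f3 t \<noteq> 0 \<and> f6 t \<noteq> 0 \<and> y ^ 6 = f3 t ^ 2 * f6 t}"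
  by (auto simp: C_circ_def P_circ_Suc)

lemma pts_Do: "pts D_circ = {[u, v] | u v. u ^ 2 = v * (v ^ 3 + 1)}"
  by (auto simp: D_circ_def)

lemma pts_WCo: "pts WCo = {([w, x, t], [y, t]) | w x y t. [w, x, t] \<in> pts Wo \<and> [y, t] \<in> pts Co}"
  by (auto simp: pts_fibre_product t_proj_eq_iff pts_Wo pts_Co)

text \<open>The component of \<open>kappa\<close> in \<open>D\<close>; the component in \<open>C\<close> is the projection.\<close>

definition kappa1 :: "complex list \<times> complex list \<Rightarrow> complex list" where
  "kappa1 z = [fst z ! 0 * snd z ! 0 / f3 (fst z ! 2), fst z ! 1 * (snd z ! 0) ^ 2 / f3 (fst z ! 2)]"

text \<open>The component in \<open>W\<close> of the inverse, obtained by solving \<open>u = w y / f\<^sub>3(t)\<close> and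
  \<open>v = x\<^sub>1 y\<^sup>2 / f\<^sub>3(t)\<close> for \<open>w\<close> and \<open>x\<^sub>1\<close>.\<close>

definition lambda1 :: "complex list \<times> complex list \<Rightarrow> complex list" where
  "lambda1 z = [fst z ! 0 * f3 (snd z ! 1) / snd z ! 0, fst z ! 1 * f3 (snd z ! 1) / (snd z ! 0) ^ 2, snd z ! 1]"

lemma kappa_eq: "z \<in> pts WCo \<Longrightarrow> kappa F3 z = (kappa1 z, snd z)"
  unfolding pts_WCo by (auto simp: kappa_def kappa1_def numeral_2_eq_2)

text \<open>The equation of \<open>W\<close> gives \<open>u\<^sup>2 = x y\<^sup>2 / f\<^sub>3 + x\<^sup>4 y\<^sup>2 f\<^sub>6 / f\<^sub>3\<^sup>2\<close>, and by \<open>y\<^sup>6 = f\<^sub>3\<^sup>2 f\<^sub>6\<close> the second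
  summand is \<open>(x y\<^sup>2 / f\<^sub>3)\<^sup>4\<close>.\<close>

lemma kappa1_pts:
  assumes "z \<in> pts WCo"
  shows "kappa1 z \<in> pts D_circ"
proof -
  from assms obtain w x y t where z: "z = ([w, x, t], [y, t])" "f3 t \<noteq> 0"
    "w ^ 2 = x * f3 t + x ^ 4 * f6 t" "y ^ 6 = f3 t ^ 2 * f6 t"
    unfolding pts_WCo pts_Wo pts_Co by auto
  have "(w * y / f3 t) ^ 2 = (x * f3 t + x ^ 4 * f6 t) * y ^ 2 / f3 t ^ 2"
    by (simp add: power_mult_distrib power_divide z(3))
  also have "\<dots> = x * y ^ 2 / f3 t + (x ^ 4 * y ^ 2 * (f3 t ^ 2 * f6 t)) / f3 t ^ 4"
    using z(2) by (simp add: field_simps eval_nat_numeral)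
  also have "\<dots> = x * y ^ 2 / f3 t + (x * y ^ 2) ^ 4 / f3 t ^ 4"
    unfolding z(4)[symmetric] by (simp add: power_mult_distrib flip: power_mult power_add)
  also have "\<dots> = (x * y ^ 2 / f3 t) * ((x * y ^ 2 / f3 t) ^ 3 + 1)"
    by (simp add: power_divide algebra_simps eval_nat_numeral)
  finally show ?thesis unfolding pts_Do by (simp add: z kappa1_def numeral_2_eq_2)
qed

lemma Co_nonzero: "[y, t] \<in> pts Co \<Longrightarrow> y \<noteq> 0"
  unfolding pts_Co by auto

lemma lambda1_pts:
  assumes "z \<in> pts (D_circ \<times>\<^sub>v Co)"
  shows "lambda1 z \<in> pts Wo" "(lambda1 z, snd z) \<in> pts WCo"
proof -
  from assms obtain u v y t where z: "z = ([u, v], [y, t])" "[y, t] \<in> pts Co" "u ^ 2 = v * (v ^ 3 + 1)"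
    "t \<noteq> 0" "f3 t \<noteq> 0" "f6 t \<noteq> 0" "y ^ 6 = f3 t ^ 2 * f6 t"
    by (auto simp: pts_fprod pts_Do pts_Co)
  have y: "y \<noteq> 0" using Co_nonzero z(2) by blast
  have "(u * f3 t / y) ^ 2 = v * (v ^ 3 + 1) * f3 t ^ 2 / y ^ 2"
    by (simp add: power_mult_distrib power_divide z(3))
  also have "\<dots> = v * f3 t ^ 2 / y ^ 2 + v ^ 4 * f3 t ^ 2 * y ^ 6 / y ^ 8"
    using y by (simp add: field_simps eval_nat_numeral)
  also have "\<dots> = (v * f3 t / y ^ 2) * f3 t + (v * f3 t / y ^ 2) ^ 4 * f6 t"
    unfolding z(7) by (simp add: power_mult_distrib power_divide eval_nat_numeral mult_ac)
  finally show l: "lambda1 z \<in> pts Wo"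
    using z unfolding pts_Wo by (simp add: lambda1_def numeral_2_eq_2)
  then show "(lambda1 z, snd z) \<in> pts WCo"
    unfolding pts_WCo using z by (simp add: lambda1_def numeral_2_eq_2)
qed

lemma kappa_lambda:
  assumes "z \<in> pts (D_circ \<times>\<^sub>v Co)"
  shows "kappa1 (lambda1 z, snd z) = fst z"
proof -
  from assms obtain u v y t where z: "z = ([u, v], [y, t])" "[y, t] \<in> pts Co" "f3 t \<noteq> 0"
    by (auto simp: pts_fprod pts_Do pts_Co)
  have y: "y \<noteq> 0" using Co_nonzero z(2) by blast
  then show ?thesis using z by (simp add: kappa1_def lambda1_def numeral_2_eq_2)
qed

lemma lambda_kappa:
  assumes "z \<in> pts WCo"
  shows "lambda1 (kappa1 z, snd z) = fst z"
proof -
  from assms obtain w x y t where z: "z = ([w, x, t], [y, t])" "[y, t] \<in> pts Co" "f3 t \<noteq> 0"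
    by (auto simp: pts_WCo pts_Wo)
  have y: "y \<noteq> 0" using Co_nonzero z(2) by blast
  then show ?thesis using z by (simp add: kappa1_def lambda1_def numeral_2_eq_2)
qed

lemma morphism_circ_affine:
  "morphism Wo (affine_space 3) (\<lambda>z. z)" "morphism Co (affine_space 2) (\<lambda>z. z)"
  "morphism D_circ (affine_space 2) (\<lambda>z. z)" "morphism (C_plane F3 F6) (affine_space 2) (\<lambda>z. z)"
  unfolding W_circ_def C_circ_def D_circ_def C_plane_def by (rule morphism_subspace[OF ringed_affine])+

lemma morphism_kappa1: "morphism WCo D_circ kappa1"
proof -
  have fst: "morphism WCo (affine_space 3) (\<lambda>z. fst z)"
    by (rule morphism_compose[OF morphism_fibre_product_fst morphism_circ_affine(1)]) auto
  have snd: "morphism WCo (affine_space 2) (\<lambda>z. snd z)"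
    by (rule morphism_compose[OF morphism_fibre_product_snd morphism_circ_affine(2)]) auto
  note c = morphism_affineD(2)[OF fst] morphism_affineD(2)[OF snd]
  have f3: "reg WCo (pts WCo) (\<lambda>z. f3 (fst z ! 2))"
    by (rule ringed_dehom[OF _ binary_form_pvars[OF F3]]) (auto intro: c)
  have nz: "f3 (fst z ! 2) \<noteq> 0" if "z \<in> pts WCo" for z
    using that by (auto simp: pts_WCo pts_Wo)
  have "morphism WCo (affine_space 2) kappa1"
  proof (rule morphism_affineI)
    fix i :: nat assume "i < 2"
    then have "i = 0 \<or> i = 1" by auto
    then show "reg WCo (pts WCo) (\<lambda>z. kappa1 z ! i)"
    proof
      assume i: "i = 0"
      show ?thesis unfolding kappa1_def i nth_Cons_0
        by (intro ringed_divide ringed_mult c f3 nz) auto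
    next
      assume i: "i = 1"
      show ?thesis unfolding kappa1_def i One_nat_def nth_Cons_Suc nth_Cons_0
        by (intro ringed_divide ringed_mult ringed_power c[unfolded One_nat_def] f3 nz) auto
    qed
  qed (auto simp: kappa1_def)
  then show ?thesis unfolding D_circ_def
    by (rule morphism_into_subspace[rotated]) (use kappa1_pts pts_Do in auto)
qed

lemma morphism_lambda1: "morphism (D_circ \<times>\<^sub>v Co) Wo lambda1"
proof -
  let ?Z = "D_circ \<times>\<^sub>v Co"
  have fst: "morphism ?Z (affine_space 2) (\<lambda>z. fst z)"
    by (rule morphism_compose[OF morphism_fst morphism_circ_affine(3)]) auto
  have snd: "morphism ?Z (affine_space 2) (\<lambda>z. snd z)"
    by (rule morphism_compose[OF morphism_snd morphism_circ_affine(2)]) auto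
  note c = morphism_affineD(2)[OF fst] morphism_affineD(2)[OF snd]
  have f3: "reg ?Z (pts ?Z) (\<lambda>z. f3 (snd z ! 1))"
    by (rule ringed_dehom[OF _ binary_form_pvars[OF F3] c(2)]) simp_all
  have nz: "snd z ! 0 \<noteq> 0" if "z \<in> pts ?Z" for z
  proof -
    have "snd z \<in> pts Co" using that by (simp add: pts_fprod mem_Times_iff)
    then obtain y t where "snd z = [y, t]" unfolding pts_Co by blast
    with \<open>snd z \<in> pts Co\<close> Co_nonzero show ?thesis by simp
  qed
  then have nz2: "(snd z ! 0) ^ 2 \<noteq> 0" if "z \<in> pts ?Z" for z
    using that by simp
  have "morphism ?Z (affine_space 3) lambda1"
  proof (rule morphism_affineI)
    fix i :: nat assume "i < 3"
    then consider "i = 0" | "i = 1" | "i = 2" by linarith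
    then show "reg ?Z (pts ?Z) (\<lambda>z. lambda1 z ! i)"
    proof cases
      case i: 1
      show ?thesis unfolding lambda1_def i nth_Cons_0
        by (intro ringed_divide ringed_mult c f3 nz) auto
    next
      case i: 2
      have "(\<lambda>z. lambda1 z ! i) = (\<lambda>z. fst z ! 1 * f3 (snd z ! 1) / (snd z ! 0) ^ 2)"
        by (simp add: lambda1_def i)
      then show ?thesis
        by (simp only:) (intro ringed_divide ringed_mult ringed_power c f3 nz2; simp)
    next
      case i: 3
      have "(\<lambda>z. lambda1 z ! i) = (\<lambda>z. snd z ! 1)" by (simp add: lambda1_def i numeral_2_eq_2)
      then show ?thesis by (simp only:) (intro c; simp)
    qed
  qed (auto simp: lambda1_def)
  then have "morphism ?Z (subspace_on (affine_space 3) (pts Wo)) lambda1"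
    by (rule morphism_into_subspace[rotated]) (use lambda1_pts(1) in auto)
  moreover have "subspace_on (affine_space 3) (pts Wo) = Wo"
    unfolding W_circ_def by (rule arg_cong2[where f = subspace_on]) auto
  ultimately show ?thesis by simp
qed

lemma kappa_isomorphism: "isomorphism WCo (D_circ \<times>\<^sub>v Co) (kappa F3)"
proof (rule isomorphismI[where g = "\<lambda>z. (lambda1 z, snd z)"])
  have "morphism WCo (D_circ \<times>\<^sub>v Co) (\<lambda>z. (kappa1 z, snd z))"
    by (intro morphism_pair morphism_kappa1 morphism_fibre_product_snd) auto
  then show "morphism WCo (D_circ \<times>\<^sub>v Co) (kappa F3)"
    by (rule morphism_cong[rotated]) (auto simp: kappa_eq)
  show "morphism (D_circ \<times>\<^sub>v Co) WCo (\<lambda>z. (lambda1 z, snd z))"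
  proof (intro morphism_fibre_productI morphism_lambda1 morphism_snd)
    show "t_proj (lambda1 z) = t_proj (snd z)" if "z \<in> pts (D_circ \<times>\<^sub>v Co)" for z
      using that by (auto simp: pts_fprod pts_Co lambda1_def t_proj_eq_iff)
  qed auto
  show "(lambda1 (kappa F3 z), snd (kappa F3 z)) = z" if "z \<in> pts WCo" for z
    using that by (simp add: kappa_eq lambda_kappa)
  show "kappa F3 (lambda1 z, snd z) = z" if "z \<in> pts (D_circ \<times>\<^sub>v Co)" for z
    using that by (simp add: kappa_eq lambda1_pts kappa_lambda)
qed auto

end

section \<open>Linear systems\<close>

text \<open>Gaussian elimination, by induction on the equations.\<close>

lemma underdetermined_system:
  fixes A :: "'i \<Rightarrow> 'j \<Rightarrow> 'k :: field"
  assumes "finite I" "finite J" "card I < card J"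
  shows "\<exists>c. (\<exists>j\<in>J. c j \<noteq> 0) \<and> (\<forall>i\<in>I. (\<Sum>j\<in>J. A i j * c j) = 0)"
  using assms
proof (induction I arbitrary: J A rule: finite_induct)
  case empty
  then obtain j where "j \<in> J" by fastforce
  then show ?case by (intro exI[of _ "\<lambda>_. 1"]) auto
next
  case (insert i0 I)
  show ?case
  proof (cases "\<forall>j\<in>J. A i0 j = 0")
    case True
    from insert have "card I < card J" by simp
    from insert.IH[OF insert.prems(1) this, of A] obtain c where
      c: "\<exists>j\<in>J. c j \<noteq> 0" "\<forall>i\<in>I. (\<Sum>j\<in>J. A i j * c j) = 0" by blast
    with True show ?thesis by (intro exI[of _ c]) auto
  next
    case False
    then obtain j0 where j0: "j0 \<in> J" "A i0 j0 \<noteq> 0" by blast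
    let ?J = "J - {j0}"
    have "card I < card ?J" using insert j0 by simp
    from insert.IH[OF _ this, of "\<lambda>i j. A i j - A i j0 * A i0 j / A i0 j0"] insert.prems obtain c where
      c: "\<exists>j\<in>?J. c j \<noteq> 0" "\<forall>i\<in>I. (\<Sum>j\<in>?J. (A i j - A i j0 * A i0 j / A i0 j0) * c j) = 0" by auto
    define d where "d = c(j0 := - (\<Sum>j\<in>?J. A i0 j * c j) / A i0 j0)"
    have d: "(\<Sum>j\<in>J. A i j * d j) = A i j0 * d j0 + (\<Sum>j\<in>?J. A i j * c j)" for i
      unfolding sum.remove[OF insert.prems(1) j0(1)] by (simp add: d_def)
    have "(\<Sum>j\<in>J. A i j * d j) = 0" if "i \<in> insert i0 I" for i
    proof (cases "i = i0")
      case True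
      then show ?thesis unfolding d using j0(2) by (simp add: d_def)
    next
      case False
      with that c(2) have "0 = (\<Sum>j\<in>?J. (A i j - A i j0 * A i0 j / A i0 j0) * c j)" by simp
      also have "\<dots> = (\<Sum>j\<in>?J. A i j * c j) - (A i j0 / A i0 j0) * (\<Sum>j\<in>?J. A i0 j * c j)"
        unfolding sum_distrib_left sum_subtractf[symmetric] by (rule sum.cong) (auto simp: algebra_simps)
      finally show ?thesis unfolding d by (simp add: d_def)
    qed
    moreover have "\<exists>j\<in>J. d j \<noteq> 0" using c(1) by (auto simp: d_def)
    ultimately show ?thesis by blast
  qed
qed

text \<open>Take for \<open>I\<close> a smallest set of columns on which the rows remain independent.  If some column
  relation on \<open>I\<close> existed, one of its columns could be left out; hence the block \<open>I\<close> is square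
  and injective, and it is inverted by treating the right hand side as one more unknown.  The
  columns outside \<open>I\<close> will serve as free coordinates, on which \<open>Q\<close> has no influence.\<close>

lemma independent_rows_right_inverse:
  fixes J :: "nat \<Rightarrow> nat \<Rightarrow> complex"
  assumes ind: "\<And>c. (\<And>j. j < n \<Longrightarrow> (\<Sum>i<m. c i * J i j) = 0) \<Longrightarrow> \<forall>i<m. c i = 0"
  obtains I Q where "I \<subseteq> {..<n}" "card I = m" "\<And>j l. j \<notin> I \<Longrightarrow> Q j l = 0"
    "\<And>i l. i < m \<Longrightarrow> l < m \<Longrightarrow> (\<Sum>j<n. J i j * Q j l) = (if i = l then 1 else 0)"
proof -
  define indep where "indep I \<longleftrightarrow> I \<subseteq> {..<n} \<and> (\<forall>c. (\<forall>j\<in>I. (\<Sum>i<m. c i * J i j) = 0) \<longrightarrow> (\<forall>i<m. c i = 0))" for I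
  have "indep {..<n}" unfolding indep_def using ind by simp
  then obtain I where I: "indep I" and min: "\<And>I'. indep I' \<Longrightarrow> card I \<le> card I'"
    using ex_has_least_nat[of indep "{..<n}" card] by blast
  have sub: "I \<subseteq> {..<n}" and fin: "finite I"
    using I finite_subset unfolding indep_def by auto
  have ker: "y j0 = 0" if y: "\<And>i. i < m \<Longrightarrow> (\<Sum>j\<in>I. J i j * y j) = 0" and j0: "j0 \<in> I" for y j0
  proof (rule ccontr)
    assume yj0: "y j0 \<noteq> 0"
    have "indep (I - {j0})"
      unfolding indep_def
    proof (intro conjI allI impI)
      show "I - {j0} \<subseteq> {..<n}" using sub by blast
      fix c i assume c: "\<forall>j\<in>I - {j0}. (\<Sum>i<m. c i * J i j) = 0" and i: "i < m"
      have "0 = (\<Sum>i<m. c i * (\<Sum>j\<in>I. J i j * y j))" using y by simp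
      also have "\<dots> = (\<Sum>j\<in>I. (\<Sum>i<m. c i * J i j) * y j)"
        unfolding sum_distrib_left sum_distrib_right by (subst sum.swap) (simp add: mult.assoc)
      also have "\<dots> = (\<Sum>i<m. c i * J i j0) * y j0"
        unfolding sum.remove[OF fin j0] using c by simp
      finally have "\<forall>j\<in>I. (\<Sum>i<m. c i * J i j) = 0" using c yj0 by auto
      with I i show "c i = 0" unfolding indep_def by blast
    qed
    from min[OF this] show False using card_Diff1_less[OF fin j0] by simp
  qed
  have "card I = m"
  proof (rule antisym)
    show "card I \<le> m"
    proof (rule ccontr)
      assume "\<not> card I \<le> m"
      then have "card {..<m} < card I" by simp
      from underdetermined_system[OF _ fin this, of J] ker show False by fastforce
    qed
    show "m \<le> card I"
    proof (rule ccontr)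
      assume "\<not> m \<le> card I"
      then have "card I < card {..<m}" by simp
      from underdetermined_system[OF fin _ this, of "\<lambda>j i. J i j"] obtain c where
        c: "\<exists>i<m. c i \<noteq> 0" "\<forall>j\<in>I. (\<Sum>i<m. J i j * c i) = 0" by auto
      have "\<forall>j\<in>I. (\<Sum>i<m. c i * J i j) = 0" using c(2) by (simp add: mult.commute)
      with I have "\<forall>i<m. c i = 0" unfolding indep_def by blast
      with c(1) show False by blast
    qed
  qed
  have "\<exists>q. \<forall>i<m. (\<Sum>j\<in>I. J i j * q j) = (if i = l then 1 else 0)" if l: "l < m" for l
  proof -
    let ?K = "insert None (Some ` I)"
    define A where "A i k = (case k of None \<Rightarrow> - (if i = l then 1 else 0) | Some j \<Rightarrow> J i j)" for i k
    have card: "card {..<m} < card ?K" using fin \<open>card I = m\<close> by (simp add: card_image)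
    have "finite ?K" using fin by simp
    from underdetermined_system[OF _ this card, of A] obtain c where
      c: "\<exists>j\<in>?K. c j \<noteq> 0" "\<And>i. i < m \<Longrightarrow> (\<Sum>j\<in>?K. A i j * c j) = 0" by auto
    have c': "(\<Sum>j\<in>I. J i j * c (Some j)) = (if i = l then c None else 0)" if "i < m" for i
      using c(2)[OF that] fin by (auto simp: sum.reindex A_def)
    have "c None \<noteq> 0"
    proof
      assume "c None = 0"
      then have "c (Some j) = 0" if "j \<in> I" for j
        using ker[of "\<lambda>j. c (Some j)" j] c' that by auto
      with \<open>c None = 0\<close> c(1) show False by auto
    qed
    then show ?thesis
      by (intro exI[of _ "\<lambda>j. c (Some j) / c None"])
        (auto simp: c' sum_divide_distrib[symmetric])
  qed
  then obtain q where q: "\<And>l i. l < m \<Longrightarrow> i < m \<Longrightarrow> (\<Sum>j\<in>I. J i j * q l j) = (if i = l then 1 else 0)"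
    by metis
  define Q where "Q j l = (if j \<in> I then q l j else 0)" for j l
  have "(\<Sum>j<n. J i j * Q j l) = (if i = l then 1 else 0)" if "i < m" "l < m" for i l
  proof -
    have "(\<Sum>j<n. J i j * Q j l) = (\<Sum>j\<in>I. J i j * Q j l)"
      by (rule sum.mono_neutral_right) (auto simp: Q_def sub[THEN subsetD, simplified] dest: subsetD[OF sub])
    also have "\<dots> = (\<Sum>j\<in>I. J i j * q l j)" by (rule sum.cong) (auto simp: Q_def)
    finally show ?thesis using q[OF that(2,1)] by simp
  qed
  with sub \<open>card I = m\<close> show ?thesis by (intro that[of I Q]) (auto simp: Q_def)
qed

section \<open>First-order expansion of polynomial functions\<close>

definition norm1 :: "nat \<Rightarrow> (nat \<Rightarrow> complex) \<Rightarrow> real" where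
  "norm1 n h = (\<Sum>j<n. cmod (h j))"

lemma norm1_nonneg [simp]: "norm1 n h \<ge> 0"
  by (simp add: norm1_def sum_nonneg)

lemma norm1_coord: "j < n \<Longrightarrow> cmod (h j) \<le> norm1 n h"
  unfolding norm1_def by (rule member_le_sum) auto

lemma norm1_triangle: "norm1 n (\<lambda>j. g j + h j) \<le> norm1 n g + norm1 n h"
  unfolding norm1_def sum.distrib[symmetric] by (rule sum_mono) (rule norm_triangle_ineq)

lemma norm1_diff_triangle: "norm1 n g \<le> norm1 n (\<lambda>j. g j - h j) + norm1 n h"
  using norm1_triangle[of n "\<lambda>j. g j - h j" h] by simp

definition lin :: "nat \<Rightarrow> (nat \<Rightarrow> complex) \<Rightarrow> (nat \<Rightarrow> complex) \<Rightarrow> complex" where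
  "lin n a h = (\<Sum>j<n. a j * h j)"

lemma lin_bound: "cmod (lin n a h) \<le> norm1 n a * norm1 n h"
proof -
  have "cmod (lin n a h) \<le> (\<Sum>j<n. cmod (a j) * cmod (h j))"
    unfolding lin_def norm_mult[symmetric] by (rule norm_sum)
  also have "\<dots> \<le> (\<Sum>j<n. cmod (a j) * norm1 n h)"
    by (intro sum_mono mult_left_mono norm1_coord) auto
  finally show ?thesis by (simp add: norm1_def sum_distrib_right)
qed

text \<open>Differentiability at the origin with derivative \<open>a\<close>, in the strong form that the remainder
  is Lipschitz with a constant that tends to zero near the origin.  This is the estimate that makes
  Newton iteration with a fixed derivative contract, and it is stable under sums and products.\<close>

definition expands :: "nat \<Rightarrow> (nat \<Rightarrow> complex) \<Rightarrow> ((nat \<Rightarrow> complex) \<Rightarrow> complex) \<Rightarrow> bool" where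
  "expands n a f \<longleftrightarrow> (\<exists>C\<ge>0. \<forall>h k. norm1 n h \<le> 1 \<longrightarrow> norm1 n k \<le> 1 \<longrightarrow>
     cmod (f h - f k - lin n a (\<lambda>j. h j - k j)) \<le> C * (norm1 n h + norm1 n k) * norm1 n (\<lambda>j. h j - k j))"

lemma expands_const: "expands n (\<lambda>_. 0) (\<lambda>_. c)"
  unfolding expands_def by (intro exI[of _ 0]) (simp add: lin_def)

lemma expands_coord:
  assumes "i < n"
  shows "expands n (\<lambda>j. if j = i then 1 else 0) (\<lambda>h. c + h i)"
proof -
  have "lin n (\<lambda>j. if j = i then 1 else 0) g = g i" for g
    using assms by (simp add: lin_def if_distrib[of "\<lambda>x. x * _"] cong: if_cong)
  then show ?thesis unfolding expands_def by (intro exI[of _ 0]) simp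
qed

lemma expands_add:
  assumes "expands n a f" "expands n b g"
  shows "expands n (\<lambda>j. a j + b j) (\<lambda>h. f h + g h)"
proof -
  from assms obtain C D where C: "C \<ge> 0" "\<And>h k. norm1 n h \<le> 1 \<Longrightarrow> norm1 n k \<le> 1 \<Longrightarrow>
     cmod (f h - f k - lin n a (\<lambda>j. h j - k j)) \<le> C * (norm1 n h + norm1 n k) * norm1 n (\<lambda>j. h j - k j)"
    and D: "D \<ge> 0" "\<And>h k. norm1 n h \<le> 1 \<Longrightarrow> norm1 n k \<le> 1 \<Longrightarrow>
     cmod (g h - g k - lin n b (\<lambda>j. h j - k j)) \<le> D * (norm1 n h + norm1 n k) * norm1 n (\<lambda>j. h j - k j)"
    unfolding expands_def by blast
  have l: "lin n (\<lambda>j. a j + b j) d = lin n a d + lin n b d" for d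
    by (simp add: lin_def distrib_right sum.distrib)
  have "cmod (f h + g h - (f k + g k) - lin n (\<lambda>j. a j + b j) (\<lambda>j. h j - k j))
      \<le> (C + D) * (norm1 n h + norm1 n k) * norm1 n (\<lambda>j. h j - k j)" if "norm1 n h \<le> 1" "norm1 n k \<le> 1" for h k
  proof -
    let ?d = "\<lambda>j. h j - k j"
    have "f h + g h - (f k + g k) - lin n (\<lambda>j. a j + b j) ?d = (f h - f k - lin n a ?d) + (g h - g k - lin n b ?d)"
      by (simp add: l)
    also have "cmod \<dots> \<le> C * (norm1 n h + norm1 n k) * norm1 n ?d + D * (norm1 n h + norm1 n k) * norm1 n ?d"
      by (rule norm_triangle_le[OF add_mono[OF C(2) D(2)]]) (use that in auto)
    finally show ?thesis by (simp add: algebra_simps)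
  qed
  with C D show ?thesis unfolding expands_def by (intro exI[of _ "C + D"]) auto
qed

lemma expands_lipschitz:
  assumes "expands n a f"
  obtains M where "M \<ge> 0" "\<And>h k. norm1 n h \<le> 1 \<Longrightarrow> norm1 n k \<le> 1 \<Longrightarrow> cmod (f h - f k) \<le> M * norm1 n (\<lambda>j. h j - k j)"
proof -
  from assms obtain C where C: "C \<ge> 0" "\<And>h k. norm1 n h \<le> 1 \<Longrightarrow> norm1 n k \<le> 1 \<Longrightarrow>
     cmod (f h - f k - lin n a (\<lambda>j. h j - k j)) \<le> C * (norm1 n h + norm1 n k) * norm1 n (\<lambda>j. h j - k j)"
    unfolding expands_def by blast
  have "cmod (f h - f k) \<le> (2 * C + norm1 n a) * norm1 n (\<lambda>j. h j - k j)" if "norm1 n h \<le> 1" "norm1 n k \<le> 1" for h k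
  proof -
    let ?d = "\<lambda>j. h j - k j"
    have "cmod (f h - f k) \<le> cmod (f h - f k - lin n a ?d) + cmod (lin n a ?d)"
      using norm_triangle_ineq[of "f h - f k - lin n a ?d" "lin n a ?d"] by simp
    also have "\<dots> \<le> C * (norm1 n h + norm1 n k) * norm1 n ?d + norm1 n a * norm1 n ?d"
      by (intro add_mono C(2) that lin_bound)
    also have "\<dots> \<le> C * 2 * norm1 n ?d + norm1 n a * norm1 n ?d"
      using that C(1) by (intro add_mono mult_right_mono mult_left_mono) auto
    finally show ?thesis by (simp add: algebra_simps)
  qed
  then show ?thesis by (rule that[rotated]) (use C(1) in auto)
qed

text \<open>Leibniz' rule.  The remainder of the product splits into four terms, each of which contains
  either a remainder of a factor or a product of two increments.\<close>

lemma expands_mult: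
  assumes "expands n a f" "expands n b g"
  shows "expands n (\<lambda>j. f (\<lambda>_. 0) * b j + g (\<lambda>_. 0) * a j) (\<lambda>h. f h * g h)"
proof -
  let ?o = "\<lambda>_::nat. 0::complex"
  have o: "norm1 n ?o = 0" by (simp add: norm1_def)
  from assms obtain C D where C: "C \<ge> 0" "\<And>h k. norm1 n h \<le> 1 \<Longrightarrow> norm1 n k \<le> 1 \<Longrightarrow>
     cmod (f h - f k - lin n a (\<lambda>j. h j - k j)) \<le> C * (norm1 n h + norm1 n k) * norm1 n (\<lambda>j. h j - k j)"
    and D: "D \<ge> 0" "\<And>h k. norm1 n h \<le> 1 \<Longrightarrow> norm1 n k \<le> 1 \<Longrightarrow>
     cmod (g h - g k - lin n b (\<lambda>j. h j - k j)) \<le> D * (norm1 n h + norm1 n k) * norm1 n (\<lambda>j. h j - k j)"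
    unfolding expands_def by blast
  from expands_lipschitz[OF assms(1)] obtain M where
    M: "M \<ge> 0" "\<And>h k. norm1 n h \<le> 1 \<Longrightarrow> norm1 n k \<le> 1 \<Longrightarrow> cmod (f h - f k) \<le> M * norm1 n (\<lambda>j. h j - k j)" by blast
  from expands_lipschitz[OF assms(2)] obtain N where
    N: "N \<ge> 0" "\<And>h k. norm1 n h \<le> 1 \<Longrightarrow> norm1 n k \<le> 1 \<Longrightarrow> cmod (g h - g k) \<le> N * norm1 n (\<lambda>j. h j - k j)" by blast
  define E where "E = (cmod (f ?o) + M) * D + M * norm1 n b + ((cmod (g ?o) + N) * C + N * norm1 n a)"
  have "cmod (f h * g h - f k * g k - lin n (\<lambda>j. f ?o * b j + g ?o * a j) (\<lambda>j. h j - k j))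
      \<le> E * (norm1 n h + norm1 n k) * norm1 n (\<lambda>j. h j - k j)"
    if h: "norm1 n h \<le> 1" and k: "norm1 n k \<le> 1" for h k
  proof -
    let ?d = "\<lambda>j. h j - k j" and ?s = "norm1 n h + norm1 n k"
    have l: "lin n (\<lambda>j. f ?o * b j + g ?o * a j) d = f ?o * lin n b d + g ?o * lin n a d" for d
      by (simp add: lin_def sum_distrib_left sum.distrib distrib_right mult.assoc)
    have f0: "cmod (f h - f ?o) \<le> M * norm1 n h" using M(2)[OF h, of ?o] o by simp
    have g0: "cmod (g k - g ?o) \<le> N * norm1 n k" using N(2)[OF k, of ?o] o by simp
    have "M * norm1 n h \<le> M * 1" using h M by (intro mult_left_mono)
    then have fh: "cmod (f h) \<le> cmod (f ?o) + M"
      using f0 norm_triangle_sub[of "f h" "f ?o"] by linarith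
    have "N * norm1 n k \<le> N * 1" using k N by (intro mult_left_mono)
    then have gk: "cmod (g k) \<le> cmod (g ?o) + N"
      using g0 norm_triangle_sub[of "g k" "g ?o"] by linarith
    have f1: "cmod (f h - f ?o) \<le> M * ?s"
      using f0 M(1) by (smt (verit) mult_left_mono norm1_nonneg)
    have g1: "cmod (g k - g ?o) \<le> N * ?s"
      using g0 N(1) by (smt (verit) mult_left_mono norm1_nonneg)
    have t1: "cmod (f h * (g h - g k - lin n b ?d)) \<le> (cmod (f ?o) + M) * (D * ?s * norm1 n ?d)"
      unfolding norm_mult by (rule mult_mono[OF fh D(2)[OF h k]]) (use M in auto)
    have t2: "cmod ((f h - f ?o) * lin n b ?d) \<le> (M * ?s) * (norm1 n b * norm1 n ?d)"
      unfolding norm_mult by (rule mult_mono[OF f1 lin_bound]) (use M in auto)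
    have t3: "cmod (g k * (f h - f k - lin n a ?d)) \<le> (cmod (g ?o) + N) * (C * ?s * norm1 n ?d)"
      unfolding norm_mult by (rule mult_mono[OF gk C(2)[OF h k]]) (use N in auto)
    have t4: "cmod ((g k - g ?o) * lin n a ?d) \<le> (N * ?s) * (norm1 n a * norm1 n ?d)"
      unfolding norm_mult by (rule mult_mono[OF g1 lin_bound]) (use N in auto)
    have "f h * g h - f k * g k - lin n (\<lambda>j. f ?o * b j + g ?o * a j) ?d =
      (f h * (g h - g k - lin n b ?d) + (f h - f ?o) * lin n b ?d) +
      (g k * (f h - f k - lin n a ?d) + (g k - g ?o) * lin n a ?d)"
      unfolding l by (simp add: algebra_simps)
    then have "cmod (f h * g h - f k * g k - lin n (\<lambda>j. f ?o * b j + g ?o * a j) ?d) \<le>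
        ((cmod (f ?o) + M) * (D * ?s * norm1 n ?d) + (M * ?s) * (norm1 n b * norm1 n ?d)) +
        ((cmod (g ?o) + N) * (C * ?s * norm1 n ?d) + (N * ?s) * (norm1 n a * norm1 n ?d))"
      using norm_triangle_mono[OF norm_triangle_mono[OF t1 t2] norm_triangle_mono[OF t3 t4]] by presburger
    also have "\<dots> = E * ?s * norm1 n ?d" by (simp add: E_def algebra_simps)
    finally show ?thesis .
  qed
  moreover have "E \<ge> 0" unfolding E_def using C D M N by (intro add_nonneg_nonneg mult_nonneg_nonneg) auto
  ultimately show ?thesis unfolding expands_def by (intro exI[of _ E]) auto
qed

lemma expands_sum:
  assumes "\<And>i. i \<in> I \<Longrightarrow> \<exists>a. expands n a (f i)"
  shows "\<exists>a. expands n a (\<lambda>h. \<Sum>i\<in>I. f i h)"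
  using assms
proof (induction I rule: infinite_finite_induct)
  case (insert x F)
  then have "\<exists>a. expands n a (f x)" "\<exists>b. expands n b (\<lambda>h. \<Sum>i\<in>F. f i h)" by simp_all
  then obtain a b where "expands n a (f x)" "expands n b (\<lambda>h. \<Sum>i\<in>F. f i h)" by blast
  from expands_add[OF this] show ?case using insert(1,2) by auto
qed (auto intro: expands_const)

lemma expands_prod:
  assumes "\<And>i. i \<in> I \<Longrightarrow> \<exists>a. expands n a (f i)"
  shows "\<exists>a. expands n a (\<lambda>h. \<Prod>i\<in>I. f i h)"
  using assms
proof (induction I rule: infinite_finite_induct)
  case (insert x F)
  then have "\<exists>a. expands n a (f x)" "\<exists>b. expands n b (\<lambda>h. \<Prod>i\<in>F. f i h)" by simp_all
  then obtain a b where "expands n a (f x)" "expands n b (\<lambda>h. \<Prod>i\<in>F. f i h)" by blast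
  from expands_mult[OF this] show ?case using insert(1,2) by auto
qed (auto intro: expands_const)

lemma expands_power:
  assumes "\<exists>a. expands n a f"
  shows "\<exists>a. expands n a (\<lambda>h. f h ^ k)"
  using expands_prod[of "{..<k}" n "\<lambda>_. f"] assms by simp

definition shift :: "complex list \<Rightarrow> (nat \<Rightarrow> complex) \<Rightarrow> complex list" where
  "shift z h = map (\<lambda>j. z ! j + h j) [0..<length z]"

lemma shift_simps [simp]: "length (shift z h) = length z" "j < length z \<Longrightarrow> shift z h ! j = z ! j + h j"
  by (simp_all add: shift_def)

lemma shift_0 [simp]: "shift z (\<lambda>_. 0) = z"
  by (rule nth_equalityI) auto

lemma expands_peval:
  assumes "pvars p \<subseteq> {..<length z}"
  shows "\<exists>a. expands (length z) a (\<lambda>h. peval p (shift z h))"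
  unfolding peval_def
proof (intro expands_sum)
  fix m assume m: "m \<in> Poly_Mapping.keys p"
  have "\<exists>a. expands (length z) a (\<lambda>h. shift z h ! i)" if "i \<in> Poly_Mapping.keys m" for i
  proof -
    have "i < length z" using that m assms by (auto simp: pvars_def)
    then show ?thesis using expands_coord[of i "length z" "z ! i"] by auto
  qed
  then have "\<exists>a. expands (length z) a (\<lambda>h. \<Prod>i\<in>Poly_Mapping.keys m. shift z h ! i ^ poly_mapping.lookup m i)"
    by (intro expands_prod expands_power)
  then show "\<exists>a. expands (length z) a (\<lambda>h. poly_mapping.lookup p m *
     (\<Prod>i\<in>Poly_Mapping.keys m. shift z h ! i ^ poly_mapping.lookup m i))"
    using expands_mult[OF expands_const] by blast
qed

text \<open>Increments along the \<open>j\<close>-th axis identify the coefficient \<open>a j\<close> with the partial derivative.\<close>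

lemma expands_peval_partial:
  assumes "expands (length z) a (\<lambda>h. peval p (shift z h))" "j < length z"
  shows "partial j p z = a j"
proof -
  let ?n = "length z" and ?f = "\<lambda>s. peval p (z[j := s])"
  from assms obtain C where C: "C \<ge> 0" "\<And>h k. norm1 ?n h \<le> 1 \<Longrightarrow> norm1 ?n k \<le> 1 \<Longrightarrow>
     cmod (peval p (shift z h) - peval p (shift z k) - lin ?n a (\<lambda>j. h j - k j))
       \<le> C * (norm1 ?n h + norm1 ?n k) * norm1 ?n (\<lambda>j. h j - k j)"
    unfolding expands_def by blast
  have est: "cmod (?f (z ! j + e) - ?f (z ! j) - a j * e) \<le> C * cmod e * cmod e" if "cmod e \<le> 1" for e
  proof -
    let ?h = "\<lambda>i. if i = j then e else 0"
    have "norm1 ?n ?h = cmod e"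
      using assms(2) by (simp add: norm1_def if_distrib[of cmod] cong: if_cong)
    moreover have "lin ?n a ?h = a j * e"
      using assms(2) by (simp add: lin_def if_distrib[of "(*) _"] cong: if_cong)
    moreover have "shift z ?h = z[j := z ! j + e]"
      by (rule nth_equalityI) (auto simp: nth_list_update)
    moreover have "norm1 ?n (\<lambda>_. 0) = 0" by (simp add: norm1_def)
    ultimately show ?thesis using C(2)[of ?h "\<lambda>_. 0"] that by simp
  qed
  have "(\<lambda>e. (?f (z ! j + e) - ?f (z ! j)) / e) \<midarrow>0\<rightarrow> a j"
  proof (rule LIM_zero_cancel, rule Lim_null_comparison)
    show "\<forall>\<^sub>F e in at 0. norm ((?f (z ! j + e) - ?f (z ! j)) / e - a j) \<le> C * cmod e"
      unfolding eventually_at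
    proof (intro exI[of _ 1] conjI ballI impI)
      fix e :: complex assume e: "e \<noteq> 0 \<and> dist e 0 < 1"
      have "norm ((?f (z ! j + e) - ?f (z ! j)) / e - a j) = cmod (?f (z ! j + e) - ?f (z ! j) - a j * e) / cmod e"
        using e by (simp add: norm_divide[symmetric] diff_divide_distrib)
      also have "\<dots> \<le> C * cmod e" using est[of e] e by (simp add: divide_le_eq)
      finally show "norm ((?f (z ! j + e) - ?f (z ! j)) / e - a j) \<le> C * cmod e" .
    qed simp
    show "((\<lambda>e. C * cmod e) \<longlongrightarrow> 0) (at 0)" by (intro tendsto_mult_right_zero tendsto_norm_zero tendsto_ident_at)
  qed
  then have "DERIV ?f (z ! j) :> a j" by (simp add: DERIV_def)
  then show ?thesis unfolding partial_def by (rule DERIV_imp_deriv)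
qed

section \<open>Analytic arcs\<close>

lemma holomorphic_peval:
  assumes "\<And>i. i \<in> pvars p \<Longrightarrow> (\<lambda>s. g s ! i) holomorphic_on S"
  shows "(\<lambda>s. peval p (g s)) holomorphic_on S"
  unfolding peval_def using assms
  by (intro holomorphic_intros) (auto simp: pvars_def)

lemma tendsto_peval:
  assumes "\<And>i. i \<in> pvars p \<Longrightarrow> ((\<lambda>s. g s ! i) \<longlongrightarrow> l ! i) F"
  shows "((\<lambda>s. peval p (g s)) \<longlongrightarrow> peval p l) F"
  unfolding peval_def using assms
  by (intro tendsto_intros) (auto simp: pvars_def)

text \<open>An implicit function theorem along the line \<open>z0 + s v\<close>.  The correction \<open>Q y(s)\<close> is found by the
  Newton iteration \<open>y \<mapsto> y - p(z0 + s v + Q y)\<close> with the derivative frozen at \<open>z0\<close>.  Since \<open>Q\<close> is a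
  right inverse of the Jacobian matrix, the linear part of this map in \<open>y\<close> is zero, so it halves distances
  on a small ball.  All iterates are polynomials in \<open>s\<close>; as they converge uniformly, the solution is
  holomorphic.\<close>

lemma implicit_arc:
  fixes ps :: "mpol list" and z0 :: "complex list" and Q :: "nat \<Rightarrow> nat \<Rightarrow> complex" and v :: "nat \<Rightarrow> complex"
  defines "m \<equiv> length ps" and "n \<equiv> length z0"
  assumes vars: "\<And>p. p \<in> set ps \<Longrightarrow> pvars p \<subseteq> {..<n}"
    and zero: "\<And>p. p \<in> set ps \<Longrightarrow> peval p z0 = 0"
    and inv: "\<And>i l. i < m \<Longrightarrow> l < m \<Longrightarrow> (\<Sum>j<n. partial j (ps ! i) z0 * Q j l) = (if i = l then 1 else 0)"
  obtains r y where "r > 0" "\<And>l. l < m \<Longrightarrow> y l holomorphic_on ball 0 r" "\<And>l. l < m \<Longrightarrow> y l 0 = 0"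
    "\<And>s p. s \<in> ball 0 r \<Longrightarrow> p \<in> set ps \<Longrightarrow> peval p (shift z0 (\<lambda>j. s * v j + (\<Sum>l<m. Q j l * y l s))) = 0"
proof -
  define h where "h s y = (\<lambda>j. s * v j + (\<Sum>l<m. Q j l * y l))" for s :: complex and y :: "nat \<Rightarrow> complex"
  define G where "G i s y = peval (ps ! i) (shift z0 (h s y))" for i s y
  define a where "a i j = partial j (ps ! i) z0" for i j
  have "\<exists>b. expands n b (\<lambda>g. peval (ps ! i) (shift z0 g))" if "i < m" for i
    using expands_peval[of "ps ! i" z0] vars[of "ps ! i"] that unfolding n_def m_def by simp
  then have ex: "expands n (a i) (\<lambda>g. peval (ps ! i) (shift z0 g))" if "i < m" for i
  proof -
    from \<open>\<And>i. i < m \<Longrightarrow> \<exists>b. expands n b (\<lambda>g. peval (ps ! i) (shift z0 g))\<close>[OF that]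
    obtain b where b: "expands n b (\<lambda>g. peval (ps ! i) (shift z0 g))" by blast
    have "lin n (a i) d = lin n b d" for d
      unfolding lin_def by (rule sum.cong) (use expands_peval_partial[of z0 b "ps ! i"] b in \<open>auto simp: a_def n_def\<close>)
    with b show ?thesis unfolding expands_def by simp
  qed
  define P where "P i c \<longleftrightarrow> (\<forall>g k. norm1 n g \<le> 1 \<longrightarrow> norm1 n k \<le> 1 \<longrightarrow>
     cmod (peval (ps ! i) (shift z0 g) - peval (ps ! i) (shift z0 k) - lin n (a i) (\<lambda>j. g j - k j))
       \<le> c * (norm1 n g + norm1 n k) * norm1 n (\<lambda>j. g j - k j))" for i c
  have "\<exists>c. 0 \<le> c \<and> P i c" if "i < m" for i
    using ex[OF that] unfolding expands_def P_def by blast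
  then have "\<forall>i\<in>{..<m}. \<exists>c. 0 \<le> c \<and> P i c" by blast
  then obtain C where Call: "\<forall>i\<in>{..<m}. 0 \<le> C i \<and> P i (C i)" by (rule bchoice[THEN exE])
  have C1: "C i \<ge> 0" if "i < m" for i using Call that by blast
  have C2: "cmod (peval (ps ! i) (shift z0 g) - peval (ps ! i) (shift z0 k) - lin n (a i) (\<lambda>j. g j - k j))
       \<le> C i * (norm1 n g + norm1 n k) * norm1 n (\<lambda>j. g j - k j)"
    if "i < m" "norm1 n g \<le> 1" "norm1 n k \<le> 1" for i g k
  proof -
    have "P i (C i)" using Call that(1) by blast
    from this[unfolded P_def, rule_format, OF that(2,3)] show ?thesis .
  qed
  define R where "R i c \<longleftrightarrow> (\<forall>g k. norm1 n g \<le> 1 \<longrightarrow> norm1 n k \<le> 1 \<longrightarrow>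
     cmod (peval (ps ! i) (shift z0 g) - peval (ps ! i) (shift z0 k)) \<le> c * norm1 n (\<lambda>j. g j - k j))" for i c
  have "\<exists>c. 0 \<le> c \<and> R i c" if "i < m" for i
  proof -
    from expands_lipschitz[OF ex[OF that]] obtain c where "0 \<le> c"
      "\<And>g k. norm1 n g \<le> 1 \<Longrightarrow> norm1 n k \<le> 1 \<Longrightarrow>
        cmod (peval (ps ! i) (shift z0 g) - peval (ps ! i) (shift z0 k)) \<le> c * norm1 n (\<lambda>j. g j - k j)"
      by metis
    then show ?thesis unfolding R_def by (intro exI[of _ c] conjI allI impI)
  qed
  then have "\<forall>i\<in>{..<m}. \<exists>c. 0 \<le> c \<and> R i c" by blast
  then obtain L where Lall: "\<forall>i\<in>{..<m}. 0 \<le> L i \<and> R i (L i)" by (rule bchoice[THEN exE])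
  have L1: "L i \<ge> 0" if "i < m" for i using Lall that by blast
  have L2: "cmod (peval (ps ! i) (shift z0 g) - peval (ps ! i) (shift z0 k)) \<le> L i * norm1 n (\<lambda>j. g j - k j)"
    if "i < m" "norm1 n g \<le> 1" "norm1 n k \<le> 1" for i g k
  proof -
    have "R i (L i)" using Lall that(1) by blast
    from this[unfolded R_def, rule_format, OF that(2,3)] show ?thesis .
  qed
  define V where "V = norm1 n v"
  define B where "B = (\<Sum>j<n. \<Sum>l<m. cmod (Q j l))"
  have V0: "V \<ge> 0" and B0: "B \<ge> 0" unfolding V_def B_def by (auto intro!: sum_nonneg)
  have Qb: "norm1 n (\<lambda>j. \<Sum>l<m. Q j l * y l) \<le> B * norm1 m y" for y
  proof -
    have "norm1 n (\<lambda>j. \<Sum>l<m. Q j l * y l) \<le> (\<Sum>j<n. \<Sum>l<m. cmod (Q j l) * norm1 m y)"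
      unfolding norm1_def[of n]
    proof (rule sum_mono)
      fix j
      have "cmod (\<Sum>l<m. Q j l * y l) \<le> (\<Sum>l<m. cmod (Q j l) * cmod (y l))"
        unfolding norm_mult[symmetric] by (rule norm_sum)
      also have "\<dots> \<le> (\<Sum>l<m. cmod (Q j l) * norm1 m y)"
        by (intro sum_mono mult_left_mono norm1_coord) auto
      finally show "cmod (\<Sum>l<m. Q j l * y l) \<le> (\<Sum>l<m. cmod (Q j l) * norm1 m y)" .
    qed
    then show ?thesis by (simp add: B_def sum_distrib_right)
  qed
  have hb: "norm1 n (h s y) \<le> cmod s * V + B * norm1 m y" for s y
  proof -
    have "norm1 n (h s y) \<le> norm1 n (\<lambda>j. s * v j) + norm1 n (\<lambda>j. \<Sum>l<m. Q j l * y l)"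
      unfolding h_def by (rule norm1_triangle)
    moreover have "norm1 n (\<lambda>j. s * v j) = cmod s * V"
      by (simp add: norm1_def V_def norm_mult sum_distrib_left)
    ultimately show ?thesis using Qb[of y] by linarith
  qed
  have hd: "(\<lambda>j. h s y j - h s y' j) = (\<lambda>j. \<Sum>l<m. Q j l * (y l - y' l))" for s y y'
    by (simp add: h_def fun_eq_iff sum_subtractf[symmetric] algebra_simps)
  have la: "lin n (a i) (\<lambda>j. \<Sum>l<m. Q j l * y l) = y i" if "i < m" for i y
  proof -
    have "lin n (a i) (\<lambda>j. \<Sum>l<m. Q j l * y l) = (\<Sum>l<m. (\<Sum>j<n. a i j * Q j l) * y l)"
      unfolding lin_def sum_distrib_left sum_distrib_right by (subst sum.swap) (simp add: mult.assoc)
    also have "\<dots> = (\<Sum>l<m. (if i = l then 1 else 0) * y l)"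
      by (rule sum.cong) (use inv that in \<open>auto simp: a_def\<close>)
    also have "\<dots> = (\<Sum>l<m. if i = l then y l else 0)" by (rule sum.cong) auto
    also have "\<dots> = y i" using that by simp
    finally show ?thesis .
  qed
  define K where "K = (\<Sum>i<m. C i) * (2 * V + B) * B"
  have K0: "K \<ge> 0" unfolding K_def using V0 B0 C1 by (intro mult_nonneg_nonneg sum_nonneg add_nonneg_nonneg) auto
  define T where "T s y = (\<lambda>i. y i - G i s y)" for s y
  have contr: "norm1 m (\<lambda>i. T s y i - T s y' i) \<le> K * (cmod s + norm1 m y + norm1 m y') * norm1 m (\<lambda>i. y i - y' i)"
    if "cmod s * V + B * norm1 m y \<le> 1" "cmod s * V + B * norm1 m y' \<le> 1" for s y y'
  proof -
    have n1: "norm1 n (h s y) \<le> 1" "norm1 n (h s y') \<le> 1"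
      using hb[of s y] hb[of s y'] that by (linarith, linarith)
    let ?N = "norm1 m (\<lambda>i. y i - y' i)" and ?S = "cmod s + norm1 m y + norm1 m y'"
    have hs: "norm1 n (h s y) + norm1 n (h s y') \<le> (2 * V + B) * ?S"
    proof -
      have "norm1 n (h s y) + norm1 n (h s y') \<le> 2 * V * cmod s + B * (norm1 m y + norm1 m y')"
        using hb[of s y] hb[of s y'] by (simp add: algebra_simps)
      also have "\<dots> \<le> 2 * V * ?S + B * ?S"
        by (intro add_mono mult_left_mono) (use V0 B0 in auto)
      finally show ?thesis by (simp add: algebra_simps)
    qed
    have hq: "norm1 n (\<lambda>j. h s y j - h s y' j) \<le> B * ?N" unfolding hd by (rule Qb)
    have "cmod (T s y i - T s y' i) \<le> C i * ((2 * V + B) * ?S) * (B * ?N)" if i: "i < m" for i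
    proof -
      have "T s y i - T s y' i = - (G i s y - G i s y' - lin n (a i) (\<lambda>j. h s y j - h s y' j))"
        unfolding hd la[OF i] by (simp add: T_def)
      also have "cmod \<dots> \<le> C i * (norm1 n (h s y) + norm1 n (h s y')) * norm1 n (\<lambda>j. h s y j - h s y' j)"
        unfolding norm_minus_cancel G_def by (rule C2[OF i n1])
      also have "\<dots> \<le> C i * ((2 * V + B) * ?S) * (B * ?N)"
        by (intro mult_mono mult_left_mono hs hq mult_nonneg_nonneg C1 i add_nonneg_nonneg V0 B0) (use V0 B0 in auto)
      finally show ?thesis .
    qed
    then have "norm1 m (\<lambda>i. T s y i - T s y' i) \<le> (\<Sum>i<m. C i * ((2 * V + B) * ?S) * (B * ?N))"
      unfolding norm1_def[of m "\<lambda>i. T s y i - T s y' i"] by (intro sum_mono) auto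
    also have "\<dots> = K * ?S * ?N" unfolding K_def sum_distrib_right[symmetric] by (simp add: algebra_simps)
    finally show ?thesis .
  qed
  define D where "D = (\<Sum>i<m. L i) * V"
  have D0: "D \<ge> 0" unfolding D_def using V0 L1 by (intro mult_nonneg_nonneg sum_nonneg) auto
  let ?o = "\<lambda>_::nat. 0::complex"
  have no: "norm1 k ?o = 0" for k by (simp add: norm1_def)
  have init: "norm1 m (T s ?o) \<le> D * cmod s" if "cmod s * V \<le> 1" for s
  proof -
    have "cmod (T s ?o i) \<le> L i * (cmod s * V)" if i: "i < m" for i
    proof -
      have "peval (ps ! i) (shift z0 ?o) = 0" using zero i by (simp add: m_def)
      then have "cmod (T s ?o i) = cmod (peval (ps ! i) (shift z0 (h s ?o)) - peval (ps ! i) (shift z0 ?o))"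
        by (simp add: T_def G_def)
      also have "\<dots> \<le> L i * norm1 n (\<lambda>j. h s ?o j - 0)"
        using hb[of s ?o] that \<open>cmod s * V \<le> 1\<close> by (intro L2 i) (auto simp: no)
      also have "\<dots> \<le> L i * (cmod s * V)"
        using hb[of s ?o] by (intro mult_left_mono L1 i) (auto simp: no)
      finally show ?thesis .
    qed
    then have "norm1 m (T s ?o) \<le> (\<Sum>i<m. L i * (cmod s * V))"
      unfolding norm1_def by (intro sum_mono) auto
    also have "\<dots> = D * cmod s"
      unfolding D_def sum_distrib_right[symmetric] by (simp add: mult_ac)
    finally show ?thesis .
  qed
  \<comment> \<open>the first bound keeps the increments in the unit ball, the second makes the iteration halve distances\<close>
  define \<rho> where "\<rho> = min (1 / (V + B + 1)) (1 / (6 * (K + 1)))"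
  have \<rho>0: "\<rho> > 0" unfolding \<rho>_def using V0 B0 K0 by auto
  have "\<rho> * (V + B + 1) \<le> 1 / (V + B + 1) * (V + B + 1)"
    unfolding \<rho>_def using V0 B0 by (intro mult_right_mono) auto
  then have \<rho>1: "\<rho> * V + B * \<rho> \<le> 1" using V0 B0 \<rho>0 by (simp add: algebra_simps)
  have "\<rho> * (6 * (K + 1)) \<le> 1 / (6 * (K + 1)) * (6 * (K + 1))"
    unfolding \<rho>_def using K0 by (intro mult_right_mono) auto
  then have \<rho>2: "K * (3 * \<rho>) \<le> 1 / 2" using K0 \<rho>0 by (simp add: algebra_simps)
  \<comment> \<open>for smaller \<open>s\<close> the first step has length at most \<open>\<rho> / 2\<close>, so the iteration stays in the ball of radius \<open>\<rho>\<close>\<close>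
  define r where "r = min \<rho> (\<rho> / (2 * (D + 1)))"
  have r0: "r > 0" unfolding r_def using \<rho>0 D0 by auto
  have "D * r \<le> (D + 1) * (\<rho> / (2 * (D + 1)))"
    unfolding r_def using D0 \<rho>0 by (intro mult_mono) auto
  also have "\<dots> = \<rho> / 2" using D0 by (simp add: field_simps)
  finally have r1: "D * r \<le> \<rho> / 2" .
  have small: "cmod s * V + B * norm1 m y \<le> 1" if "cmod s \<le> \<rho>" "norm1 m y \<le> \<rho>" for s y
    using mult_right_mono[OF that(1) V0] mult_left_mono[OF that(2) B0] \<rho>1 by linarith
  have half: "norm1 m (\<lambda>i. T s y i - T s y' i) \<le> norm1 m (\<lambda>i. y i - y' i) / 2"
    if "cmod s \<le> \<rho>" "norm1 m y \<le> \<rho>" "norm1 m y' \<le> \<rho>" for s y y'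
  proof -
    have "norm1 m (\<lambda>i. T s y i - T s y' i) \<le> K * (cmod s + norm1 m y + norm1 m y') * norm1 m (\<lambda>i. y i - y' i)"
      by (intro contr small that)
    also have "\<dots> \<le> K * (3 * \<rho>) * norm1 m (\<lambda>i. y i - y' i)"
      using that K0 by (intro mult_right_mono mult_left_mono) auto
    also have "\<dots> \<le> 1 / 2 * norm1 m (\<lambda>i. y i - y' i)"
      by (intro mult_right_mono \<rho>2) auto
    finally show ?thesis by simp
  qed
  define Y where "Y = (\<lambda>k s. (T s ^^ k) ?o)"
  have YS: "Y (Suc k) s = T s (Y k s)" and Y0: "Y 0 s = ?o" for k s by (simp_all add: Y_def)
  have rs: "cmod s \<le> \<rho>" "norm1 m (T s ?o) \<le> \<rho> / 2" if "s \<in> ball 0 r" for s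
  proof -
    have sr: "cmod s < r" using that by simp
    then show "cmod s \<le> \<rho>" unfolding r_def by simp
    have "norm1 m (T s ?o) \<le> D * cmod s" using small[of s ?o] \<open>cmod s \<le> \<rho>\<close> \<rho>0 by (intro init) (simp add: no)
    also have "\<dots> \<le> D * r" using sr D0 by (intro mult_left_mono) auto
    finally show "norm1 m (T s ?o) \<le> \<rho> / 2" using r1 by simp
  qed
  have Yb: "norm1 m (Y k s) \<le> \<rho>" if s: "s \<in> ball 0 r" for k s
  proof (induction k)
    case 0 then show ?case using \<rho>0 by (simp add: Y0 no)
  next
    case (Suc k)
    have "norm1 m (Y (Suc k) s) \<le> norm1 m (\<lambda>i. T s (Y k s) i - T s ?o i) + norm1 m (T s ?o)"
      unfolding YS by (rule norm1_diff_triangle)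
    also have "\<dots> \<le> norm1 m (\<lambda>i. Y k s i - 0) / 2 + \<rho> / 2"
      by (intro add_mono half rs[OF s] Suc) (use \<rho>0 in \<open>simp add: no\<close>)
    finally show ?case using Suc by simp
  qed
  have Yd: "norm1 m (\<lambda>i. Y (Suc k) s i - Y k s i) \<le> \<rho> / 2 * (1 / 2) ^ k" if s: "s \<in> ball 0 r" for k s
  proof (induction k)
    case 0 then show ?case using rs(2)[OF s] by (simp add: YS Y0)
  next
    case (Suc k)
    have "norm1 m (\<lambda>i. Y (Suc (Suc k)) s i - Y (Suc k) s i) \<le> norm1 m (\<lambda>i. Y (Suc k) s i - Y k s i) / 2"
      unfolding YS[of "Suc k"] YS[of k] using half[OF rs(1)[OF s] Yb[OF s, of "Suc k"] Yb[OF s, of k]] unfolding YS[of k] .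
    then show ?case using Suc by simp
  qed
  have hol: "(\<lambda>s. Y k s l) holomorphic_on ball 0 r" if "l < m" for k l
    using that
  proof (induction k arbitrary: l)
    case 0 then show ?case by (simp add: Y0)
  next
    case (Suc k)
    have "(\<lambda>s. G l s (Y k s)) holomorphic_on ball 0 r"
      unfolding G_def
    proof (rule holomorphic_peval)
      fix i assume "i \<in> pvars (ps ! l)"
      then have "i < length z0" using vars[of "ps ! l"] Suc.prems by (auto simp: m_def n_def)
      then have "(\<lambda>s. shift z0 (h s (Y k s)) ! i) = (\<lambda>s. z0 ! i + (s * v i + (\<Sum>l<m. Q i l * Y k s l)))"
        by (simp add: h_def)
      moreover have "\<dots> holomorphic_on ball 0 r"
        by (intro holomorphic_intros Suc.IH) auto
      ultimately show "(\<lambda>s. shift z0 (h s (Y k s)) ! i) holomorphic_on ball 0 r" by simp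
    qed
    then show ?case unfolding YS T_def by (intro holomorphic_intros Suc)
  qed
  define y where "y l s = suminf (\<lambda>k. Y (Suc k) s l - Y k s l)" for l s
  have tele: "(\<Sum>k<N. Y (Suc k) s l - Y k s l) = Y N s l" for N s l
    using sum_lessThan_telescope[of "\<lambda>k. Y k s l" N] by (simp add: Y0)
  have ul: "uniform_limit (ball 0 r) (\<lambda>N s. Y N s l) (y l) sequentially" if l: "l < m" for l
  proof -
    have "uniform_limit (ball 0 r) (\<lambda>N s. \<Sum>k<N. Y (Suc k) s l - Y k s l) (\<lambda>s. suminf (\<lambda>k. Y (Suc k) s l - Y k s l)) sequentially"
    proof (rule Weierstrass_m_test)
      show "norm (Y (Suc k) s l - Y k s l) \<le> \<rho> / 2 * (1 / 2) ^ k" if "s \<in> ball 0 r" for k s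
        using Yd[OF that, of k] norm1_coord[OF l, of "\<lambda>i. Y (Suc k) s i - Y k s i"] by linarith
      show "summable (\<lambda>k. \<rho> / 2 * (1 / 2) ^ k)" by (intro summable_mult summable_geometric) simp
    qed
    then show ?thesis unfolding tele y_def[abs_def] .
  qed
  have lim: "(\<lambda>N. Y N s l) \<longlonglongrightarrow> y l s" if "l < m" "s \<in> ball 0 r" for l s
    using tendsto_uniform_limitI[OF ul[OF that(1)] that(2)] .
  show thesis
  proof (rule that[OF r0])
    show "y l holomorphic_on ball 0 r" if l: "l < m" for l
    proof (rule holomorphic_uniform_sequence[OF open_ball hol[OF l]])
      fix x :: complex assume "x \<in> ball 0 r"
      then obtain d where d: "d > 0" "cball x d \<subseteq> ball 0 r" using open_contains_cball[of "ball 0 r", THEN iffD1, OF open_ball] by blast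
      then show "\<exists>d>0. cball x d \<subseteq> ball 0 r \<and> uniform_limit (cball x d) (\<lambda>N s. Y N s l) (y l) sequentially"
        using uniform_limit_on_subset[OF ul[OF l] d(2)] by blast
    qed
    show "y l 0 = 0" if l: "l < m" for l
    proof -
      have "Y k 0 l = 0" if "l < m" for k l
        using that
      proof (induction k arbitrary: l)
        case (Suc k)
        then have "h 0 (Y k 0) = ?o" by (simp add: h_def fun_eq_iff)
        then show ?case using Suc zero by (simp add: YS T_def G_def m_def)
      qed (simp add: Y0)
      with l show ?thesis by (simp add: y_def)
    qed
    fix s :: complex and p assume s: "s \<in> ball 0 r" and "p \<in> set ps"
    then obtain i where i: "i < m" "p = ps ! i" by (auto simp: in_set_conv_nth m_def)
    have "(\<lambda>N. G i s (Y N s)) \<longlonglongrightarrow> G i s (\<lambda>l. y l s)"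
      unfolding G_def
    proof (rule tendsto_peval)
      fix j assume "j \<in> pvars (ps ! i)"
      then have "j < length z0" using vars[of "ps ! i"] i by (auto simp: m_def n_def)
      then show "(\<lambda>N. shift z0 (h s (Y N s)) ! j) \<longlonglongrightarrow> shift z0 (h s (\<lambda>l. y l s)) ! j"
        unfolding h_def by (simp, intro tendsto_intros lim s) auto
    qed
    moreover have "(\<lambda>N. Y N s i - Y (Suc N) s i) \<longlonglongrightarrow> y i s - y i s"
      using lim[OF i(1) s] by (intro tendsto_diff LIMSEQ_Suc)
    then have "(\<lambda>N. G i s (Y N s)) \<longlonglongrightarrow> 0" by (simp add: YS T_def)
    ultimately have "G i s (\<lambda>l. y l s) = 0" using LIMSEQ_unique by blast
    then show "peval p (shift z0 (\<lambda>j. s * v j + (\<Sum>l<m. Q j l * y l s))) = 0"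
      by (simp add: G_def h_def i)
  qed
qed

section \<open>Algebraic dependence by counting monomials\<close>

abbreviation exps :: "nat \<Rightarrow> nat \<Rightarrow> nat list set" where
  "exps K d \<equiv> {xs. set xs \<subseteq> {..<K} \<and> length xs = d}"

definition monomials_le :: "nat \<Rightarrow> nat list \<Rightarrow> nat \<Rightarrow> (nat \<Rightarrow>\<^sub>0 nat) set" where
  "monomials_le d W N = {m. Poly_Mapping.keys m \<subseteq> {..<Suc d} \<and> mweight W m \<le> N}"

lemma keys_Cst_mult: "Poly_Mapping.keys (Cst c * p) \<subseteq> Poly_Mapping.keys p"
proof
  fix m assume "m \<in> Poly_Mapping.keys (Cst c * p)"
  with Poly_Mapping.keys_mult[of "Cst c" p] obtain a b where
    "a \<in> Poly_Mapping.keys (Cst c)" "b \<in> Poly_Mapping.keys p" "m = a + b" by blast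
  then show "m \<in> Poly_Mapping.keys p" by (auto simp: Cst_def split: if_splits)
qed

lemma keys_sum_subset:
  fixes f :: "'i \<Rightarrow> mpol"
  assumes "\<And>i. i \<in> I \<Longrightarrow> Poly_Mapping.keys (f i) \<subseteq> S"
  shows "Poly_Mapping.keys (\<Sum>i\<in>I. f i) \<subseteq> S"
  using assms
proof (induction I rule: infinite_finite_induct)
  case (insert x F)
  then show ?case using Poly_Mapping.keys_add[of "f x" "\<Sum>i\<in>F. f i"] by auto
qed auto

lemma peval_sum: "peval (\<Sum>i\<in>I. f i) xs = (\<Sum>i\<in>I. peval (f i) xs)"
  by (induction I rule: infinite_finite_induct) (auto simp: peval_add)

lemma monomials_le_mult:
  assumes "Poly_Mapping.keys p \<subseteq> monomials_le d W N" "Poly_Mapping.keys q \<subseteq> monomials_le d W N'"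
  shows "Poly_Mapping.keys (p * q :: mpol) \<subseteq> monomials_le d W (N + N')"
proof
  fix m assume "m \<in> Poly_Mapping.keys (p * q)"
  with Poly_Mapping.keys_mult[of p q] obtain a b where
    ab: "a \<in> Poly_Mapping.keys p" "b \<in> Poly_Mapping.keys q" "m = a + b" by blast
  then have "a \<in> monomials_le d W N" "b \<in> monomials_le d W N'" using assms by auto
  then show "m \<in> monomials_le d W (N + N')"
    unfolding ab(3) monomials_le_def using Poly_Mapping.keys_add[of a b] by (auto simp: mweight_add)
qed

lemma monomials_le_one: "Poly_Mapping.keys (1 :: mpol) \<subseteq> monomials_le d W 0"
  by (auto simp: monomials_le_def mweight_def)

lemma monomials_le_power:
  assumes "Poly_Mapping.keys p \<subseteq> monomials_le d W N"
  shows "Poly_Mapping.keys (p ^ k :: mpol) \<subseteq> monomials_le d W (N * k)"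
proof (induction k)
  case (Suc k)
  from monomials_le_mult[OF assms Suc] show ?case by simp
qed (simp add: monomials_le_one del: keys_one)

lemma monomials_le_prod:
  assumes "\<And>i. i \<in> I \<Longrightarrow> Poly_Mapping.keys (f i) \<subseteq> monomials_le d W (N i)"
  shows "Poly_Mapping.keys (\<Prod>i\<in>I. f i :: mpol) \<subseteq> monomials_le d W (\<Sum>i\<in>I. N i)"
  using assms
proof (induction I rule: infinite_finite_induct)
  case (insert x F)
  then show ?case using monomials_le_mult[of "f x" d W "N x" "\<Prod>i\<in>F. f i"] by simp
qed (simp_all add: monomials_le_one del: keys_one)

lemma peval_prod: "peval (\<Prod>i\<in>I. f i) xs = (\<Prod>i\<in>I. peval (f i) xs)"
  by (induction I rule: infinite_finite_induct) (auto simp: peval_mult one_mpol)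

lemma monomials_le_exists:
  assumes "pvars p \<subseteq> {..<Suc d}"
  obtains N where "Poly_Mapping.keys p \<subseteq> monomials_le d W N"
proof (rule that[of "\<Sum>m\<in>Poly_Mapping.keys p. mweight W m"])
  show "Poly_Mapping.keys p \<subseteq> monomials_le d W (\<Sum>m\<in>Poly_Mapping.keys p. mweight W m)"
    using assms by (auto simp: monomials_le_def pvars_def intro: member_le_sum)
qed

lemma monomials_le_mono: "N \<le> N' \<Longrightarrow> monomials_le d W N \<subseteq> monomials_le d W N'"
  by (auto simp: monomials_le_def)

text \<open>The first coordinate is integral over the polynomials in the other \<open>d\<close> coordinates.  The affine
  pieces \<open>w ^ 2 = x f3(t) + x ^ 4 f6(t)\<close> and \<open>y ^ 6 = f3(t) ^ 2 f6(t)\<close> have this form with \<open>d = 2\<close> and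
  \<open>d = 1\<close>.\<close>

definition integral_model :: "nat \<Rightarrow> complex list set \<Rightarrow> bool" where
  "integral_model d M \<longleftrightarrow> (\<exists>k G. 0 < k \<and> pvars G \<subseteq> {1..d} \<and> (\<forall>xs\<in>M. xs ! 0 ^ k = peval G xs))"

text \<open>Replacing a \<open>k\<close>-th power of the first coordinate by \<open>G\<close> lowers its exponent, and does not raise
  the weight if the first coordinate has been given a large enough weight.\<close>

lemma monomial_reduce:
  fixes G :: mpol
  assumes k: "0 < k" and G: "pvars G \<subseteq> {1..d}" "Poly_Mapping.keys G \<subseteq> monomials_le d W (W ! 0 * k)"
    and M: "\<And>xs. xs \<in> M \<Longrightarrow> xs ! 0 ^ k = peval G xs"
    and m: "m \<in> monomials_le d W N"
  shows "\<exists>q. Poly_Mapping.keys q \<subseteq> {m \<in> monomials_le d W N. Poly_Mapping.lookup m 0 < k} \<and>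
     (\<forall>xs\<in>M. monev m xs = peval q xs)"
  using m
proof (induction "Poly_Mapping.lookup m 0" arbitrary: m rule: less_induct)
  case less
  show ?case
  proof (cases "Poly_Mapping.lookup m 0 < k")
    case True
    then show ?thesis using less.prems
      by (intro exI[of _ "Poly_Mapping.single m 1"]) (auto simp: peval_single)
  next
    case False
    define m0 where "m0 = m - Poly_Mapping.single 0 k"
    have m_eq: "m = m0 + Poly_Mapping.single 0 k"
      by (rule poly_mapping_eqI) (use False in \<open>auto simp: m0_def lookup_add lookup_minus lookup_single when_def\<close>)
    have "mweight W (Poly_Mapping.single 0 k) = W ! 0 * k" using k by (simp add: mweight_def)
    then have w: "mweight W m = mweight W m0 + W ! 0 * k" unfolding m_eq mweight_add by simp
    have key0: "Poly_Mapping.keys m0 \<subseteq> {..<Suc d}"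
    proof
      fix i assume "i \<in> Poly_Mapping.keys m0"
      then have "i \<in> Poly_Mapping.keys m" by (simp add: m_eq in_keys_iff lookup_add)
      then show "i \<in> {..<Suc d}" using less.prems by (auto simp: monomials_le_def)
    qed
    have IH: "\<exists>q. Poly_Mapping.keys q \<subseteq> {m \<in> monomials_le d W N. Poly_Mapping.lookup m 0 < k} \<and>
        (\<forall>xs\<in>M. monev (m0 + g) xs = peval q xs)" if g: "g \<in> Poly_Mapping.keys G" for g
    proof (rule less.hyps)
      have "0 \<notin> Poly_Mapping.keys g" using G(1) g by (auto simp: pvars_def)
      then have "Poly_Mapping.lookup g 0 = 0" by (simp add: in_keys_iff)
      then show "Poly_Mapping.lookup (m0 + g) 0 < Poly_Mapping.lookup m 0"
        using k by (simp add: m_eq lookup_add)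
      have "g \<in> monomials_le d W (W ! 0 * k)" using G(2) g by blast
      then show "m0 + g \<in> monomials_le d W N"
        using key0 w less.prems Poly_Mapping.keys_add[of m0 g] unfolding monomials_le_def by (auto simp: mweight_add)
    qed
    define qq where "qq g = (SOME q. Poly_Mapping.keys q \<subseteq> {m \<in> monomials_le d W N. Poly_Mapping.lookup m 0 < k} \<and>
        (\<forall>xs\<in>M. monev (m0 + g) xs = peval q xs))" for g
    have qq: "Poly_Mapping.keys (qq g) \<subseteq> {m \<in> monomials_le d W N. Poly_Mapping.lookup m 0 < k}"
      "\<And>xs. xs \<in> M \<Longrightarrow> monev (m0 + g) xs = peval (qq g) xs" if "g \<in> Poly_Mapping.keys G" for g
      using someI_ex[OF IH[OF that]] unfolding qq_def[symmetric] by auto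
    show ?thesis
    proof (intro exI[of _ "\<Sum>g\<in>Poly_Mapping.keys G. Cst (Poly_Mapping.lookup G g) * qq g"] conjI ballI)
      show "Poly_Mapping.keys (\<Sum>g\<in>Poly_Mapping.keys G. Cst (Poly_Mapping.lookup G g) * qq g)
          \<subseteq> {m \<in> monomials_le d W N. Poly_Mapping.lookup m 0 < k}"
        by (rule keys_sum_subset, rule order_trans[OF keys_Cst_mult qq(1)])
      fix xs assume xs: "xs \<in> M"
      have "monev m xs = monev m0 xs * peval G xs"
        unfolding m_eq monev_add monev_single using M[OF xs] by simp
      also have "\<dots> = (\<Sum>g\<in>Poly_Mapping.keys G. Poly_Mapping.lookup G g * monev (m0 + g) xs)"
        by (simp add: peval_alt sum_distrib_left monev_add mult_ac)
      also have "\<dots> = peval (\<Sum>g\<in>Poly_Mapping.keys G. Cst (Poly_Mapping.lookup G g) * qq g) xs"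
        unfolding peval_sum by (rule sum.cong) (auto simp: peval_mult qq(2)[OF _ xs])
      finally show "monev m xs = peval (\<Sum>g\<in>Poly_Mapping.keys G. Cst (Poly_Mapping.lookup G g) * qq g) xs" .
    qed
  qed
qed

lemma polynomial_reduce:
  fixes G p :: mpol
  assumes "0 < k" "pvars G \<subseteq> {1..d}" "Poly_Mapping.keys G \<subseteq> monomials_le d W (W ! 0 * k)"
    "\<And>xs. xs \<in> M \<Longrightarrow> xs ! 0 ^ k = peval G xs" "Poly_Mapping.keys p \<subseteq> monomials_le d W N"
  shows "\<exists>q. Poly_Mapping.keys q \<subseteq> {m \<in> monomials_le d W N. Poly_Mapping.lookup m 0 < k} \<and>
     (\<forall>xs\<in>M. peval p xs = peval q xs)"
proof -
  have ex: "\<exists>q. Poly_Mapping.keys q \<subseteq> {m \<in> monomials_le d W N. Poly_Mapping.lookup m 0 < k} \<and>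
     (\<forall>xs\<in>M. monev m xs = peval q xs)" if "m \<in> Poly_Mapping.keys p" for m
    by (rule monomial_reduce[OF assms(1-4)]) (use that assms(5) in auto)
  define qq where "qq m = (SOME q. Poly_Mapping.keys q \<subseteq> {m \<in> monomials_le d W N. Poly_Mapping.lookup m 0 < k} \<and>
        (\<forall>xs\<in>M. monev m xs = peval q xs))" for m
  have qq: "Poly_Mapping.keys (qq m) \<subseteq> {m \<in> monomials_le d W N. Poly_Mapping.lookup m 0 < k}"
    "\<And>xs. xs \<in> M \<Longrightarrow> monev m xs = peval (qq m) xs" if "m \<in> Poly_Mapping.keys p" for m
    using someI_ex[OF ex[OF that]] unfolding qq_def[symmetric] by auto
  show ?thesis
  proof (intro exI[of _ "\<Sum>m\<in>Poly_Mapping.keys p. Cst (Poly_Mapping.lookup p m) * qq m"] conjI ballI)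
    show "Poly_Mapping.keys (\<Sum>m\<in>Poly_Mapping.keys p. Cst (Poly_Mapping.lookup p m) * qq m)
        \<subseteq> {m \<in> monomials_le d W N. Poly_Mapping.lookup m 0 < k}"
      by (rule keys_sum_subset, rule order_trans[OF keys_Cst_mult qq(1)])
    show "peval p xs = peval (\<Sum>m\<in>Poly_Mapping.keys p. Cst (Poly_Mapping.lookup p m) * qq m) xs" if "xs \<in> M" for xs
      unfolding peval_sum peval_alt[of p] by (rule sum.cong) (auto simp: peval_mult qq(2)[OF _ that])
  qed
qed

text \<open>There are \<open>k\<close> choices for the first exponent and at most \<open>N + 1\<close> for each of the others.  The growth
  of order \<open>N ^ d\<close> is what bounds the transcendence degree.\<close>

lemma card_reduced_monomials:
  assumes W: "W = e # replicate d 1"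
  shows "finite {m \<in> monomials_le d W N. Poly_Mapping.lookup m 0 < k}"
    "card {m \<in> monomials_le d W N. Poly_Mapping.lookup m 0 < k} \<le> k * (N + 1) ^ d"
proof -
  let ?S = "{m \<in> monomials_le d W N. Poly_Mapping.lookup m 0 < k}" and ?L = "{xs. set xs \<subseteq> {..N} \<and> length xs = d}"
  define \<phi> where "\<phi> m = (Poly_Mapping.lookup m 0, map (Poly_Mapping.lookup m) [1..<Suc d])" for m :: "nat \<Rightarrow>\<^sub>0 nat"
  have inj: "inj_on \<phi> ?S"
  proof (rule inj_onI)
    fix m m' assume m: "m \<in> ?S" "m' \<in> ?S" and eq: "\<phi> m = \<phi> m'"
    show "m = m'"
    proof (rule poly_mapping_eqI)
      fix i
      consider "i = 0" | "1 \<le> i" "i < Suc d" | "Suc d \<le> i" by linarith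
      then show "Poly_Mapping.lookup m i = Poly_Mapping.lookup m' i"
      proof cases
        case 3
        then have "i \<notin> Poly_Mapping.keys m" "i \<notin> Poly_Mapping.keys m'" using m by (auto simp: monomials_le_def)
        then show ?thesis by (simp add: in_keys_iff)
      next
        case 2
        then have "i \<in> set [1..<Suc d]" by (simp only: set_upt atLeastLessThan_iff)
        then show ?thesis using eq unfolding \<phi>_def prod.inject map_eq_conv by blast
      qed (use eq in \<open>simp add: \<phi>_def\<close>)
    qed
  qed
  have img: "\<phi> ` ?S \<subseteq> {..<k} \<times> ?L"
  proof
    fix z assume "z \<in> \<phi> ` ?S"
    then obtain m where m: "z = \<phi> m" "m \<in> monomials_le d W N" "Poly_Mapping.lookup m 0 < k" by blast
    have "Poly_Mapping.lookup m i \<le> N" if "1 \<le> i" "i < Suc d" for i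
    proof -
      have "Poly_Mapping.lookup m i = W ! i * Poly_Mapping.lookup m i" using that by (cases i) (auto simp: W)
      also have "\<dots> \<le> (\<Sum>i\<in>{..<Suc d}. W ! i * Poly_Mapping.lookup m i)"
        by (rule member_le_sum) (use that in auto)
      also have "\<dots> = mweight W m" using m(2) by (intro mweight_superset[symmetric]) (auto simp: monomials_le_def)
      finally show ?thesis using m(2) by (simp add: monomials_le_def)
    qed
    then show "z \<in> {..<k} \<times> ?L" unfolding m(1) \<phi>_def using m(3) by auto
  qed
  have fin: "finite ({..<k} \<times> ?L)" using finite_lists_length_eq[of "{..N}" d] by simp
  then show "finite ?S" using finite_subset[OF img] finite_imageD[OF _ inj] by blast
  have "card ?S \<le> card ({..<k} \<times> ?L)" by (rule card_inj_on_le[OF inj img fin])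
  also have "\<dots> = k * (N + 1) ^ d" using card_lists_length_eq[of "{..N}" d] by (simp add: card_cartesian_product)
  finally show "card ?S \<le> k * (N + 1) ^ d" .
qed

text \<open>Transcendence degree at most \<open>d\<close>.  The relation between \<open>d + 1\<close> functions is written as a
  polynomial in one of them, \<open>q\<close>, because its lowest nonzero coefficient will be extracted.\<close>

definition alg_dim_le :: "nat \<Rightarrow> 'a fspace \<Rightarrow> bool" where
  "alg_dim_le d X \<longleftrightarrow> (\<forall>U q x. openin (zar X) U \<and> U \<noteq> {} \<and> reg X U q \<and> (\<forall>i<d. reg X U (x i)) \<longrightarrow>
     (\<exists>K c. (\<exists>a<K. \<exists>\<alpha>\<in>exps K d. c a \<alpha> \<noteq> 0) \<and>
        (\<forall>z\<in>U. (\<Sum>a<K. q z ^ a * (\<Sum>\<alpha>\<in>exps K d. c a \<alpha> * (\<Prod>i<d. x i z ^ (\<alpha> ! i)))) = 0)))"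

definition rational_chart :: "'a fspace \<Rightarrow> 'a set \<Rightarrow> nat \<Rightarrow> ('a \<Rightarrow> complex list) \<Rightarrow> bool" where
  "rational_chart X U n e \<longleftrightarrow> openin (zar X) U \<and> U \<noteq> {} \<and>
     (\<forall>V f x. reg X V f \<and> x \<in> V \<inter> U \<longrightarrow> (\<exists>p q V'. openin (zar X) V' \<and> x \<in> V' \<and> V' \<subseteq> V \<inter> U \<and>
        pvars p \<subseteq> {..<n} \<and> pvars q \<subseteq> {..<n} \<and>
        (\<forall>y\<in>V'. peval q (e y) \<noteq> 0 \<and> f y = peval p (e y) / peval q (e y))))"

text \<open>Nonempty open sets of an irreducible space are dense.\<close>

lemma irreducible_regular_zero:
  assumes "ringed X" "irreducible_fs X" "openin (zar X) V" "V \<noteq> {}" "reg X U f" "\<And>x. x \<in> U \<inter> V \<Longrightarrow> f x = 0"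
  shows "x \<in> U \<Longrightarrow> f x = 0"
proof (rule ccontr)
  assume "x \<in> U" "f x \<noteq> 0"
  then have "{x \<in> U. f x \<noteq> 0} \<noteq> {}" by blast
  moreover have "openin (zar X) {x \<in> U. f x \<noteq> 0}" by (rule ringed_nonzero[OF assms(1,5)])
  ultimately have "{x \<in> U. f x \<noteq> 0} \<inter> V \<noteq> {}" using assms(2,3,4) unfolding irreducible_fs_def by blast
  with assms(6) show False by blast
qed

text \<open>Near a common point write the \<open>d + 1\<close> functions as fractions of polynomials in the coordinates.
  With denominators cleared, the \<open>K ^ (d + 1)\<close> monomials in the functions with exponents below
  \<open>K\<close> become polynomials of weight \<open>O(K)\<close>, and on the model these reduce to combinations of
  \<open>O(K ^ d)\<close> monomials.  For large \<open>K\<close> there are more of the former than of the latter, which forces a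
  linear relation; it spreads from the neighbourhood to \<open>U\<close> by irreducibility.\<close>

lemma alg_dim_le_model:
  assumes X: "ringed X" "irreducible_fs X" and ch: "rational_chart X U1 (Suc d) e"
    and M: "integral_model d M" "\<And>x. x \<in> U1 \<Longrightarrow> e x \<in> M"
  shows "alg_dim_le d X"
  unfolding alg_dim_le_def
proof (intro allI impI, elim conjE)
  fix U q and x :: "nat \<Rightarrow> 'a \<Rightarrow> complex"
  assume U: "openin (zar X) U" "U \<noteq> {}" and q: "reg X U q" and x: "\<forall>i<d. reg X U (x i)"
  define g where "g i = (if i = d then q else x i)" for i
  have g: "reg X U (g i)" if "i \<le> d" for i using q x that by (auto simp: g_def)
  have "U \<inter> U1 \<noteq> {}" using X(2) U ch unfolding irreducible_fs_def rational_chart_def by blast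
  then obtain z0 where z0: "z0 \<in> U \<inter> U1" by blast
  define Qd where "Qd i = (\<lambda>(p, r, V'). openin (zar X) V' \<and> z0 \<in> V' \<and> V' \<subseteq> U \<inter> U1 \<and>
        pvars p \<subseteq> {..<Suc d} \<and> pvars r \<subseteq> {..<Suc d} \<and>
        (\<forall>y\<in>V'. peval r (e y) \<noteq> 0 \<and> g i y = peval p (e y) / peval r (e y)))" for i
  have "\<exists>z. Qd i z" if "i \<le> d" for i
    using ch g[OF that] z0 unfolding rational_chart_def Qd_def by simp
  then have "\<forall>i\<in>{..d}. \<exists>z. Qd i z" by blast
  then obtain z where zQ: "\<forall>i\<in>{..d}. Qd i (z i)" by (rule bchoice[THEN exE])
  define p r V' where "p i = fst (z i)" and "r i = fst (snd (z i))" and "V' i = snd (snd (z i))" for i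
  have Q: "Qd i (p i, r i, V' i)" if "i \<le> d" for i
    using zQ that by (simp add: p_def r_def V'_def)
  have pr: "openin (zar X) (V' i)" "z0 \<in> V' i" "V' i \<subseteq> U \<inter> U1" "pvars (p i) \<subseteq> {..<Suc d}"
    "pvars (r i) \<subseteq> {..<Suc d}" if "i \<le> d" for i
    using Q[OF that] unfolding Qd_def by simp_all
  have pr6: "peval (r i) (e y) \<noteq> 0" "g i y = peval (p i) (e y) / peval (r i) (e y)" if "i \<le> d" "y \<in> V' i" for i y
    using Q[OF that(1)] that(2) unfolding Qd_def by simp_all
  define V where "V = (\<Inter>i\<in>{..d}. V' i)"
  have "V \<subseteq> V' 0" unfolding V_def by auto
  then have V: "openin (zar X) V" "z0 \<in> V" "V \<subseteq> U \<inter> U1"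
    using pr(3)[of 0] pr(1,2) unfolding V_def by (auto intro!: openin_Inter)
  from M(1) obtain k G where kG: "0 < k" "pvars G \<subseteq> {1..d}" "\<And>xs. xs \<in> M \<Longrightarrow> xs ! 0 ^ k = peval G xs"
    unfolding integral_model_def by blast
  \<comment> \<open>for this weight of the first coordinate the reduction does not raise weights\<close>
  have "pvars G \<subseteq> {..<Suc d}" using kG(2) by auto
  then obtain w where w: "Poly_Mapping.keys G \<subseteq> monomials_le d (0 # replicate d 1) w" by (rule monomials_le_exists)
  define W where "W = w # replicate d (1::nat)"
  have wt: "mweight W m = mweight (0 # replicate d 1) m" if "m \<in> Poly_Mapping.keys G" for m
  proof -
    have "0 \<notin> Poly_Mapping.keys m" using that kG(2) by (auto simp: pvars_def)
    then have "W ! i = (0 # replicate d 1) ! i" if "i \<in> Poly_Mapping.keys m" for i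
      using that by (cases i) (auto simp: W_def)
    then show ?thesis unfolding mweight_def by (intro sum.cong) auto
  qed
  have G: "Poly_Mapping.keys G \<subseteq> monomials_le d W (W ! 0 * k)"
  proof
    fix m assume m: "m \<in> Poly_Mapping.keys G"
    then have "m \<in> monomials_le d (0 # replicate d 1) w" using w by blast
    moreover have "w \<le> W ! 0 * k" using kG(1) by (simp add: W_def)
    ultimately show "m \<in> monomials_le d W (W ! 0 * k)"
      unfolding monomials_le_def mem_Collect_eq wt[OF m] using le_trans by blast
  qed
  have "\<exists>N. Poly_Mapping.keys (p i) \<subseteq> monomials_le d W N \<and> Poly_Mapping.keys (r i) \<subseteq> monomials_le d W N" if i: "i \<le> d" for i
  proof -
    obtain A where A: "Poly_Mapping.keys (p i) \<subseteq> monomials_le d W A" using monomials_le_exists[OF pr(4)[OF i]] .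
    obtain B where B: "Poly_Mapping.keys (r i) \<subseteq> monomials_le d W B" using monomials_le_exists[OF pr(5)[OF i]] .
    show ?thesis using A B monomials_le_mono[of A "max A B" d W] monomials_le_mono[of B "max A B" d W]
      by (intro exI[of _ "max A B"]) auto
  qed
  then have "\<forall>i\<in>{..d}. \<exists>N. Poly_Mapping.keys (p i) \<subseteq> monomials_le d W N \<and> Poly_Mapping.keys (r i) \<subseteq> monomials_le d W N" by blast
  then obtain Nf where Nfall: "\<forall>i\<in>{..d}. Poly_Mapping.keys (p i) \<subseteq> monomials_le d W (Nf i) \<and> Poly_Mapping.keys (r i) \<subseteq> monomials_le d W (Nf i)"
    by (rule bchoice[THEN exE])
  then have Nf: "\<And>i. i \<le> d \<Longrightarrow> Poly_Mapping.keys (p i) \<subseteq> monomials_le d W (Nf i)"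
    "\<And>i. i \<le> d \<Longrightarrow> Poly_Mapping.keys (r i) \<subseteq> monomials_le d W (Nf i)" by auto
  define D where "D = (\<Sum>i\<le>d. Nf i)"
  have ND: "Nf i \<le> D" if "i \<le> d" for i unfolding D_def using that by (intro member_le_sum) auto
  have D: "Poly_Mapping.keys (p i) \<subseteq> monomials_le d W D" "Poly_Mapping.keys (r i) \<subseteq> monomials_le d W D" if "i \<le> d" for i
    using Nf[OF that] monomials_le_mono[OF ND[OF that], of d W] by auto
  \<comment> \<open>\<open>K ^ (d + 1)\<close> products against at most \<open>k (D (d + 1) K + 1) ^ d\<close> reduced monomials\<close>
  define K where "K = k * (D * Suc d + 1) ^ d + 1"
  define N where "N = Suc d * (D * K)"
  let ?S = "{m \<in> monomials_le d W N. Poly_Mapping.lookup m 0 < k}"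
  let ?J = "{..<K} \<times> exps K d"
  have "finite (exps K d)" using finite_lists_length_eq[of "{..<K}" d] by simp
  then have finJ: "finite ?J" by simp
  have cardJ: "card ?J = K * K ^ d"
    using card_lists_length_eq[of "{..<K}" d] by (simp add: card_cartesian_product)
  have "card ?S \<le> k * (N + 1) ^ d" by (rule card_reduced_monomials(2)[OF W_def])
  also have "\<dots> \<le> k * ((D * Suc d + 1) * K) ^ d"
  proof (intro mult_left_mono power_mono)
    have "1 \<le> K" by (simp add: K_def)
    then show "N + 1 \<le> (D * Suc d + 1) * K" by (simp add: N_def algebra_simps)
  qed auto
  also have "\<dots> = k * (D * Suc d + 1) ^ d * K ^ d" by (simp only: power_mult_distrib mult.assoc)
  also have "\<dots> < K * K ^ d" by (intro mult_strict_right_mono) (auto simp: K_def)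
  finally have card: "card ?S < card ?J" unfolding cardJ .
  define E where "E = (\<lambda>(a, \<alpha>) i. if i = d then a else \<alpha> ! i :: nat)"
  have E: "E j i < K" if "j \<in> ?J" "i \<le> d" for j i
  proof -
    obtain a \<alpha> where j: "j = (a, \<alpha>)" "a < K" "set \<alpha> \<subseteq> {..<K}" "length \<alpha> = d" using \<open>j \<in> ?J\<close> by auto
    have "\<alpha> ! i < K" if "i < d"
    proof -
      have "\<alpha> ! i \<in> set \<alpha>" using j that by simp
      then show ?thesis using j(3) by blast
    qed
    then show ?thesis using j that by (auto simp: E_def)
  qed
  define P where "P j = (\<Prod>i\<le>d. p i ^ E j i * r i ^ (K - E j i))" for j
  have P: "Poly_Mapping.keys (P j) \<subseteq> monomials_le d W N" if j: "j \<in> ?J" for j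
  proof -
    have "Poly_Mapping.keys (P j) \<subseteq> monomials_le d W (\<Sum>i\<le>d. D * E j i + D * (K - E j i))"
      unfolding P_def by (intro monomials_le_prod monomials_le_mult monomials_le_power D) auto
    also have "(\<Sum>i\<le>d. D * E j i + D * (K - E j i)) = (\<Sum>i\<le>d. D * K)"
      using E[OF j] by (intro sum.cong) (auto simp flip: distrib_left simp: less_imp_le)
    finally show ?thesis by (simp add: N_def)
  qed
  have "\<exists>s. Poly_Mapping.keys s \<subseteq> ?S \<and> (\<forall>xs\<in>M. peval (P j) xs = peval s xs)" if "j \<in> ?J" for j
    by (rule polynomial_reduce[OF kG(1,2) G kG(3) P[OF that]])
  then have "\<forall>j\<in>?J. \<exists>s. Poly_Mapping.keys s \<subseteq> ?S \<and> (\<forall>xs\<in>M. peval (P j) xs = peval s xs)" by blast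
  then obtain s where "\<forall>j\<in>?J. Poly_Mapping.keys (s j) \<subseteq> ?S \<and> (\<forall>xs\<in>M. peval (P j) xs = peval (s j) xs)"
    by (rule bchoice[THEN exE])
  then have s: "\<And>j. j \<in> ?J \<Longrightarrow> Poly_Mapping.keys (s j) \<subseteq> ?S"
    "\<And>j xs. j \<in> ?J \<Longrightarrow> xs \<in> M \<Longrightarrow> peval (P j) xs = peval (s j) xs" by (blast, blast)
  obtain c where c: "\<exists>j\<in>?J. c j \<noteq> 0" "\<forall>m\<in>?S. (\<Sum>j\<in>?J. Poly_Mapping.lookup (s j) m * c j) = 0"
    using underdetermined_system[OF card_reduced_monomials(1)[OF W_def] finJ card, of "\<lambda>m j. Poly_Mapping.lookup (s j) m"]
    by blast
  define Fn where "Fn y = (\<Sum>a<K. q y ^ a * (\<Sum>\<alpha>\<in>exps K d. c (a, \<alpha>) * (\<Prod>i<d. x i y ^ (\<alpha> ! i))))" for y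
  have Fn: "Fn y = (\<Sum>j\<in>?J. c j * (\<Prod>i\<le>d. g i y ^ E j i))" for y
  proof -
    have "(\<Prod>i\<le>d. g i y ^ E (a, \<alpha>) i) = q y ^ a * (\<Prod>i<d. x i y ^ (\<alpha> ! i))" for a \<alpha>
    proof -
      have "(\<Prod>i\<le>d. g i y ^ E (a, \<alpha>) i) = g d y ^ E (a, \<alpha>) d * (\<Prod>i<d. g i y ^ E (a, \<alpha>) i)"
        unfolding lessThan_Suc_atMost[symmetric] prod.lessThan_Suc by simp
      also have "(\<Prod>i<d. g i y ^ E (a, \<alpha>) i) = (\<Prod>i<d. x i y ^ (\<alpha> ! i))"
        by (rule prod.cong) (auto simp: g_def E_def)
      finally show ?thesis by (simp add: g_def E_def)
    qed
    then show ?thesis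
      unfolding Fn_def sum_distrib_left sum.cartesian_product
      by (intro sum.cong refl) (auto simp: mult_ac)
  qed
  have zero: "Fn y = 0" if y: "y \<in> U \<inter> V" for y
  proof -
    have yV: "y \<in> V' i" if "i \<le> d" for i using y that by (auto simp: V_def)
    have eM: "e y \<in> M" using y V(3) M(2) by blast
    define R where "R = (\<Prod>i\<le>d. peval (r i) (e y) ^ K)"
    have R: "R \<noteq> 0" unfolding R_def using pr6(1) yV by auto
    have "R * (\<Prod>i\<le>d. g i y ^ E j i) = peval (P j) (e y)" if j: "j \<in> ?J" for j
      unfolding R_def P_def peval_prod prod.distrib[symmetric]
    proof (rule prod.cong[OF refl])
      fix i assume "i \<in> {..d}"
      then have i: "i \<le> d" by simp
      have "peval (r i) (e y) ^ K = peval (r i) (e y) ^ E j i * peval (r i) (e y) ^ (K - E j i)"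
        using E[OF j i] by (simp flip: power_add)
      then show "peval (r i) (e y) ^ K * g i y ^ E j i = peval (p i ^ E j i * r i ^ (K - E j i)) (e y)"
        using pr6[OF i yV[OF i]] by (simp add: peval_mult peval_power power_divide)
    qed
    then have "R * Fn y = (\<Sum>j\<in>?J. c j * peval (P j) (e y))"
      unfolding Fn sum_distrib_left by (intro sum.cong refl) (simp add: mult.left_commute)
    also have "\<dots> = (\<Sum>j\<in>?J. c j * (\<Sum>m\<in>?S. Poly_Mapping.lookup (s j) m * monev m (e y)))"
      by (intro sum.cong refl) (simp only: s(2)[OF _ eM] peval_superset[OF card_reduced_monomials(1)[OF W_def] s(1)])
    also have "\<dots> = (\<Sum>m\<in>?S. (\<Sum>j\<in>?J. Poly_Mapping.lookup (s j) m * c j) * monev m (e y))"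
      unfolding sum_distrib_left sum_distrib_right by (subst sum.swap) (simp add: mult_ac)
    also have "\<dots> = 0" using c(2) by (intro sum.neutral) simp
    finally show ?thesis using R by simp
  qed
  have regF: "reg X U Fn" unfolding Fn_def
    by (intro ringed_sum ringed_mult ringed_power ringed_const ringed_prod X(1) U(1) q) (use x in auto)
  have "Fn y = 0" if "y \<in> U" for y
    by (rule irreducible_regular_zero[OF X V(1) _ regF zero that]) (use V(2) in auto)
  with c(1) show "\<exists>K c. (\<exists>a<K. \<exists>\<alpha>\<in>exps K d. c a \<alpha> \<noteq> 0) \<and>
        (\<forall>z\<in>U. (\<Sum>a<K. q z ^ a * (\<Sum>\<alpha>\<in>exps K d. c a \<alpha> * (\<Prod>i<d. x i z ^ (\<alpha> ! i)))) = 0)"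
    unfolding Fn_def by (intro exI[of _ K] exI[of _ "\<lambda>a \<alpha>. c (a, \<alpha>)"]) auto
qed

text \<open>A regular function on \<open>X\<close> is pulled back along the inverse \<open>g\<close>, where it is locally a fraction of
  polynomials.\<close>

lemma rational_chartI:
  assumes X: "ringed X" "openin (zar X) U" "U \<noteq> {}"
    and e: "morphism (subspace_on X U) (affine_space n) e"
    and g: "morphism (subspace_on (affine_space n) A) X g"
    and eg: "\<And>x. x \<in> U \<Longrightarrow> e x \<in> A" "\<And>x. x \<in> U \<Longrightarrow> g (e x) = x"
  shows "rational_chart X U n e"
  unfolding rational_chart_def
proof (intro conjI allI impI X(2,3), elim conjE)
  fix V f x assume f: "reg X V f" and x: "x \<in> V \<inter> U"
  let ?Z = "subspace_on (affine_space n) A"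
  have len: "length (e y) = n" if "y \<in> U" for y
    using morphism_affineD(1)[OF e, of y] that openin_subset[OF X(2)] by auto
  have "reg ?Z {z \<in> pts ?Z. g z \<in> V} (\<lambda>z. f (g z))" by (rule morphism_reg[OF g f])
  moreover have ex: "e x \<in> {z \<in> pts ?Z. g z \<in> V}" using eg x len by auto
  ultimately obtain W h where W: "e x \<in> W" "reg (affine_space n) W h"
    "\<forall>y\<in>{z \<in> pts ?Z. g z \<in> V} \<inter> W. f (g y) = h y"
    unfolding reg_subspace by blast
  from reg_affineE[OF W(2,1)] obtain p q where pq: "pvars p \<subseteq> {..<n}" "pvars q \<subseteq> {..<n}" "peval q (e x) \<noteq> 0"
    "\<And>y. y \<in> W \<Longrightarrow> peval q y \<noteq> 0 \<Longrightarrow> h y = peval p y / peval q y" by blast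
  let ?O = "{z \<in> W. peval q z \<noteq> 0}"
  have Wo: "openin (affine_zar n) W" using ringed_openin[OF ringed_affine W(2)] by simp
  have "reg (affine_space n) W (\<lambda>z. peval q z)"
    by (rule ringed_peval[OF ringed_affine])
      (use Wo pq(2) openin_subset[OF Wo] in \<open>auto intro!: ringed_restrict[OF ringed_affine reg_affine_coord]\<close>)
  from ringed_nonzero[OF ringed_affine this] have O: "openin (zar (affine_space n)) ?O" .
  have o: "openin (zar X) ({y \<in> U. e y \<in> ?O} \<inter> V)"
    by (rule openin_Int[OF morphism_open_subspace[OF e X(2) O] ringed_openin[OF X(1) f]])
  show "\<exists>p q V'. openin (zar X) V' \<and> x \<in> V' \<and> V' \<subseteq> V \<inter> U \<and>
        pvars p \<subseteq> {..<n} \<and> pvars q \<subseteq> {..<n} \<and>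
        (\<forall>y\<in>V'. peval q (e y) \<noteq> 0 \<and> f y = peval p (e y) / peval q (e y))"
  proof (rule exI[of _ p], rule exI[of _ q], rule exI[of _ "{y \<in> U. e y \<in> ?O} \<inter> V"], intro conjI ballI o pq)
    fix y assume y: "y \<in> {y \<in> U. e y \<in> ?O} \<inter> V"
    then show "peval q (e y) \<noteq> 0" by simp
    have "e y \<in> {z \<in> pts ?Z. g z \<in> V} \<inter> W" using y eg len by auto
    then have "f (g (e y)) = h (e y)" using W(3) by blast
    then show "f y = peval p (e y) / peval q (e y)" using y eg(2) pq(4)[of "e y"] by simp
  qed (use x W pq in auto)
qed

section \<open>Analytic arcs in a space\<close>

text \<open>A holomorphic germ of a curve in \<open>X\<close>, as seen by the regular functions.\<close>

definition arc :: "'a fspace \<Rightarrow> (complex \<Rightarrow> 'a) \<Rightarrow> bool" where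
  "arc X \<beta> \<longleftrightarrow> \<beta> 0 \<in> pts X \<and> (\<forall>V f. reg X V f \<and> \<beta> 0 \<in> V \<longrightarrow>
     eventually (\<lambda>s. \<beta> s \<in> V) (nhds 0) \<and> (\<lambda>s. f (\<beta> s)) analytic_on {0})"

lemma arcD:
  assumes "arc X \<beta>"
  shows "\<beta> 0 \<in> pts X" "reg X V f \<Longrightarrow> \<beta> 0 \<in> V \<Longrightarrow> eventually (\<lambda>s. \<beta> s \<in> V) (nhds 0)"
    "reg X V f \<Longrightarrow> \<beta> 0 \<in> V \<Longrightarrow> (\<lambda>s. f (\<beta> s)) analytic_on {0}"
  using assms unfolding arc_def by blast+

lemma arc_open:
  assumes "arc X \<beta>" "ringed X" "openin (zar X) V" "\<beta> 0 \<in> V"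
  shows "eventually (\<lambda>s. \<beta> s \<in> V) (nhds 0)"
  by (rule arcD(2)[OF assms(1) ringed_const[OF assms(2,3)] assms(4)])

lemma arc_compose:
  assumes "arc X \<beta>" "morphism X Y f"
  shows "arc Y (\<lambda>s. f (\<beta> s))"
  unfolding arc_def
proof (intro conjI allI impI)
  show "f (\<beta> 0) \<in> pts Y" by (rule morphism_pts[OF assms(2) arcD(1)[OF assms(1)]])
  fix V g assume g: "reg Y V g \<and> f (\<beta> 0) \<in> V"
  then have r: "reg X {x \<in> pts X. f x \<in> V} (\<lambda>x. g (f x))" by (intro morphism_reg[OF assms(2)]) blast
  have i: "\<beta> 0 \<in> {x \<in> pts X. f x \<in> V}" using g arcD(1)[OF assms(1)] by simp
  show "(\<lambda>s. g (f (\<beta> s))) analytic_on {0}" using arcD(3)[OF assms(1) r i] .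
  show "eventually (\<lambda>s. f (\<beta> s) \<in> V) (nhds 0)"
    by (rule eventually_mono[OF arcD(2)[OF assms(1) r i]]) simp
qed

lemma arc_subspace:
  assumes "arc X \<beta>" "ringed X" "eventually (\<lambda>s. \<beta> s \<in> A) (nhds 0)"
  shows "arc (subspace_on X A) \<beta>"
  unfolding arc_def
proof (intro conjI allI impI)
  show "\<beta> 0 \<in> pts (subspace_on X A)"
    using arcD(1)[OF assms(1)] eventually_nhds_x_imp_x[OF assms(3)] by simp
  fix V f assume f: "reg (subspace_on X A) V f \<and> \<beta> 0 \<in> V"
  then have "openin (subtopology (zar X) A) V" by (simp add: reg_subspace)
  then obtain T where T: "openin (zar X) T" "V = T \<inter> A" unfolding openin_subtopology by blast
  have "eventually (\<lambda>s. \<beta> s \<in> T) (nhds 0)" using f T by (intro arc_open[OF assms(1,2)]) auto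
  then show ev: "eventually (\<lambda>s. \<beta> s \<in> V) (nhds 0)" using assms(3) unfolding T(2)
    by eventually_elim simp
  from f obtain W h where W: "\<beta> 0 \<in> W" "reg X W h" "\<forall>y\<in>V \<inter> W. f y = h y"
    unfolding reg_subspace by blast
  have "eventually (\<lambda>s. f (\<beta> s) = h (\<beta> s)) (nhds 0)"
    using ev arcD(2)[OF assms(1) W(2,1)] by eventually_elim (use W(3) in blast)
  from analytic_at_cong[OF this refl] arcD(3)[OF assms(1) W(2,1)]
  show "(\<lambda>s. f (\<beta> s)) analytic_on {0}" by blast
qed

lemma analytic_peval:
  assumes "\<And>i. i \<in> pvars p \<Longrightarrow> (\<lambda>s. g s ! i) analytic_on S"
  shows "(\<lambda>s. peval p (g s)) analytic_on S"
  unfolding peval_def using assms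
  by (intro analytic_intros) (auto simp: pvars_def)

lemma analytic_eventually_nonzero:
  assumes "f analytic_on {0}" "f 0 \<noteq> (0::complex)"
  shows "eventually (\<lambda>s. f s \<noteq> 0) (nhds 0)"
proof -
  have "(f \<longlongrightarrow> f 0) (nhds 0)" using analytic_at_imp_isCont[OF assms(1)] isContD
    by (metis continuous_at_imp_continuous_within filterlim_at_within_not_equal isCont_def tendsto_nhds_iff)
  then show ?thesis by (rule tendsto_imp_eventually_ne) (rule assms(2))
qed

lemma arc_affine:
  assumes len: "\<And>s. length (\<beta> s) = n" and an: "\<And>i. i < n \<Longrightarrow> (\<lambda>s. \<beta> s ! i) analytic_on {0}"
  shows "arc (affine_space n) \<beta>"
  unfolding arc_def
proof (intro conjI allI impI)
  show "\<beta> 0 \<in> pts (affine_space n)" using len by simp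
  have p: "(\<lambda>s. peval p (\<beta> s)) analytic_on {0}" if "pvars p \<subseteq> {..<n}" for p
    using that an by (intro analytic_peval) auto
  fix V f assume f: "reg (affine_space n) V f \<and> \<beta> 0 \<in> V"
  then have V: "openin (affine_zar n) V" using ringed_openin[OF ringed_affine, of n V f] by simp
  with f obtain q where q: "pvars q \<subseteq> {..<n}" "peval q (\<beta> 0) \<noteq> 0" "{y. length y = n \<and> peval q y \<noteq> 0} \<subseteq> V"
    unfolding openin_affine by blast
  have "eventually (\<lambda>s. peval q (\<beta> s) \<noteq> 0) (nhds 0)"
    by (rule analytic_eventually_nonzero[OF p[OF q(1)] q(2)])
  then show ev: "eventually (\<lambda>s. \<beta> s \<in> V) (nhds 0)"
    by eventually_elim (use q(3) len in auto)
  from f reg_affineE[of n V f "\<beta> 0"] obtain a b where ab: "pvars a \<subseteq> {..<n}" "pvars b \<subseteq> {..<n}" "peval b (\<beta> 0) \<noteq> 0"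
    "\<And>y. y \<in> V \<Longrightarrow> peval b y \<noteq> 0 \<Longrightarrow> f y = peval a y / peval b y" by metis
  have eq: "eventually (\<lambda>s. f (\<beta> s) = peval a (\<beta> s) / peval b (\<beta> s)) (nhds 0)"
    using ev analytic_eventually_nonzero[OF p[OF ab(2)] ab(3)] by eventually_elim (use ab(4) in blast)
  have "(\<lambda>s. peval a (\<beta> s) / peval b (\<beta> s)) analytic_on {0}"
    by (intro analytic_intros p ab(1,2)) (use ab(3) in auto)
  then show "(\<lambda>s. f (\<beta> s)) analytic_on {0}" using analytic_at_cong[OF eq refl] by blast
qed

text \<open>By induction a point can be found for one coefficient with respect to the first variable; then
  the first variable has to avoid the roots of a nonzero polynomial.\<close>

lemma nonzero_polynomial_point:
  fixes c :: "nat list \<Rightarrow> complex"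
  assumes "\<exists>\<alpha>\<in>exps K d. c \<alpha> \<noteq> 0"
  shows "\<exists>\<xi>. (\<Sum>\<alpha>\<in>exps K d. c \<alpha> * (\<Prod>i<d. \<xi> i ^ (\<alpha> ! i))) \<noteq> 0"
  using assms
proof (induction d arbitrary: c)
  case 0
  have "exps K 0 = {[]}" by auto
  with 0 show ?case by auto
next
  case (Suc d)
  then obtain \<alpha> where "\<alpha> \<in> exps K (Suc d)" "c \<alpha> \<noteq> 0" by blast
  then obtain a0 \<alpha>0 where a0: "a0 < K" "\<alpha>0 \<in> exps K d" "c (a0 # \<alpha>0) \<noteq> 0"
    by (cases \<alpha>) auto
  then obtain \<xi> where \<xi>: "(\<Sum>\<alpha>\<in>exps K d. c (a0 # \<alpha>) * (\<Prod>i<d. \<xi> i ^ (\<alpha> ! i))) \<noteq> 0"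
    using Suc.IH[of "\<lambda>\<alpha>. c (a0 # \<alpha>)"] by blast
  define b where "b a = (\<Sum>\<alpha>\<in>exps K d. c (a # \<alpha>) * (\<Prod>i<d. \<xi> i ^ (\<alpha> ! i)))" for a
  define p where "p = (\<Sum>a<K. monom (b a) a)"
  have "coeff p a0 = b a0" using a0(1) by (simp add: p_def coeff_sum)
  then have "p \<noteq> 0" using \<xi> unfolding b_def[symmetric] by auto
  then have "finite {t. poly p t = 0}" by (rule poly_roots_finite)
  then obtain t where t: "poly p t \<noteq> 0" using infinite_UNIV_char_0[where 'a = complex]
    by (metis (mono_tags, lifting) UNIV_eq_I mem_Collect_eq)
  define \<zeta> where "\<zeta> i = (case i of 0 \<Rightarrow> t | Suc j \<Rightarrow> \<xi> j)" for i
  have bij: "bij_betw (\<lambda>(a, \<alpha>). a # \<alpha>) ({..<K} \<times> exps K d) (exps K (Suc d))"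
    by (rule bij_betwI[where g = "\<lambda>\<alpha>. (hd \<alpha>, tl \<alpha>)"]) (auto simp: length_Suc_conv)
  have "(\<Sum>\<alpha>\<in>exps K (Suc d). c \<alpha> * (\<Prod>i<Suc d. \<zeta> i ^ (\<alpha> ! i)))
      = (\<Sum>(a, \<alpha>)\<in>{..<K} \<times> exps K d. c (a # \<alpha>) * (\<Prod>i<Suc d. \<zeta> i ^ ((a # \<alpha>) ! i)))"
    by (subst sum.reindex_bij_betw[OF bij, symmetric]) (simp add: case_prod_unfold)
  also have "\<dots> = (\<Sum>a<K. \<Sum>\<alpha>\<in>exps K d. c (a # \<alpha>) * (t ^ a * (\<Prod>i<d. \<xi> i ^ (\<alpha> ! i))))"
    by (simp only: sum.cartesian_product prod.lessThan_Suc_shift) (simp add: \<zeta>_def)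
  also have "\<dots> = (\<Sum>a<K. b a * t ^ a)"
    by (intro sum.cong refl) (simp add: b_def sum_distrib_left mult_ac)
  also have "\<dots> = poly p t" by (simp add: p_def poly_sum poly_monom)
  finally show ?case using t by (intro exI[of _ \<zeta>]) (simp only: not_False_eq_True)
qed

lemma reg_from_open_subspace:
  assumes "ringed X" "openin (zar X) U" "reg (subspace_on X U) S f"
  shows "reg X S f"
proof (rule ringed_local[OF assms(1)])
  have "openin (subtopology (zar X) U) S" using assms(3) by (simp add: reg_subspace)
  then show "openin (zar X) S" using assms(2) by (simp add: openin_open_subtopology)
  fix x assume "x \<in> S"
  then show "\<exists>V g. x \<in> V \<and> reg X V g \<and> (\<forall>y\<in>S \<inter> V. f y = g y)"
    using assms(3) unfolding reg_subspace by blast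
qed

text \<open>In a smooth chart at \<open>x0\<close> let \<open>q\<close> be a polynomial that vanishes off \<open>N\<close> but not identically.  It is
  related algebraically to the free coordinates; dividing the relation by the lowest power of
  \<open>q\<close> leaves a relation whose constant term \<open>R\<close> is a nonzero polynomial in the free coordinates
  alone.  The arc is chosen so that its free coordinates run from \<open>x0\<close> towards a point where \<open>R\<close> is not
  zero.  If \<open>q\<close> vanished on the arc, so would \<open>R\<close> near the centre, hence along the whole line.
  Therefore the zeros of \<open>q\<close> on the arc are isolated.\<close>

lemma smooth_arc:
  assumes X: "ringed X" "irreducible_fs X" and sm: "smooth_of_dim d X" and dim: "alg_dim_le d X"
    and x0: "x0 \<in> pts X" and N: "openin (zar X) N" "N \<noteq> {}"
  obtains \<beta> where "arc X \<beta>" "\<beta> 0 = x0" "eventually (\<lambda>s. \<beta> s \<in> N) (at 0)"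
proof -
  from sm[unfolded smooth_of_dim_def, rule_format, OF x0] obtain U n ps V Z e where
    U: "openin (zar X) U" "x0 \<in> U" and n: "length ps + d = n" and ps: "\<forall>p\<in>set ps. pvars p \<subseteq> {..<n}"
    and V: "openin (zar (affine_space n)) V" and Z: "Z = {z \<in> V. \<forall>p\<in>set ps. peval p z = 0}"
    and ind: "\<forall>z\<in>Z. \<forall>c. (\<forall>j<n. (\<Sum>i<length ps. c i * partial j (ps ! i) z) = 0) \<longrightarrow>
        (\<forall>i<length ps. c i = 0)"
    and iso: "isomorphism (subspace_on X U) (subspace_on (affine_space n) Z) e"
    by (elim exE conjE) (rule that)
  let ?XU = "subspace_on X U" and ?AZ = "subspace_on (affine_space n) Z"
  from iso obtain g where e: "morphism ?XU ?AZ e" and g: "morphism ?AZ ?XU g"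
    and ge: "\<And>x. x \<in> pts ?XU \<Longrightarrow> g (e x) = x" and eg: "\<And>z. z \<in> pts ?AZ \<Longrightarrow> e (g z) = z"
    by (rule isomorphismE) blast
  have U_pts: "U \<subseteq> pts X" by (rule openin_subset[OF U(1)])
  have V_len: "length z = n" if "z \<in> V" for z
    using openin_subset[OF V] that by auto
  have pts_U: "x \<in> pts ?XU \<longleftrightarrow> x \<in> U" for x using U_pts by auto
  have pts_Z: "z \<in> pts ?AZ \<longleftrightarrow> z \<in> Z" for z using V_len by (auto simp: Z)
  have eZ: "e x \<in> Z" if "x \<in> U" for x using morphism_pts[OF e] that pts_U pts_Z by blast
  have gU: "g z \<in> U" if "z \<in> Z" for z using morphism_pts[OF g] that pts_U pts_Z by blast
  have ge': "g (e x) = x" if "x \<in> U" for x by (rule ge) (use that pts_U in blast)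
  have eg': "e (g z) = z" if "z \<in> Z" for z by (rule eg) (use that pts_Z in blast)
  define z0 where "z0 = e x0"
  have z0: "z0 \<in> Z" "length z0 = n" "z0 \<in> V" using eZ[OF U(2)] V_len by (auto simp: z0_def Z)
  have indep: "\<forall>i<length ps. c i = 0"
    if "\<And>j. j < n \<Longrightarrow> (\<Sum>i<length ps. c i * partial j (ps ! i) z0) = 0" for c
    using ind z0(1) that by blast
  obtain I Q where
    I: "I \<subseteq> {..<n}" "card I = length ps" and Q0: "\<And>j l. j \<notin> I \<Longrightarrow> Q j l = 0"
    and Q: "\<And>i l. i < length ps \<Longrightarrow> l < length ps \<Longrightarrow>
       (\<Sum>j<n. partial j (ps ! i) z0 * Q j l) = (if i = l then 1 else 0)"
  proof (rule independent_rows_right_inverse[where n = n and m = "length ps" and J = "\<lambda>i j. partial j (ps ! i) z0"])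
    show "\<forall>i<length ps. c i = 0"
      if "\<And>j. j < n \<Longrightarrow> (\<Sum>i<length ps. c i * partial j (ps ! i) z0) = 0" for c
      by (rule indep[OF that])
  qed (rule that)
  let ?T = "{..<n} - I"
  have "card ?T = d" using I n by (simp add: card_Diff_subset finite_subset[OF I(1)])
  then obtain \<tau> where \<tau>: "bij_betw \<tau> {0..<d} ?T" using ex_bij_betw_nat_finite[of ?T] by auto
  have \<tau>T: "\<tau> i < n" "\<tau> i \<notin> I" if "i < d" for i using bij_betwE[OF \<tau>] that by auto
  \<comment> \<open>a regular function vanishing off \<open>N\<close>\<close>
  have "U \<inter> N \<noteq> {}" using X(2) U N unfolding irreducible_fs_def by blast
  then obtain x1 where x1: "x1 \<in> U" "x1 \<in> N" by blast
  have gX: "morphism ?AZ X g" by (rule morphism_from_subspace[OF X(1) g])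
  have "openin (zar ?AZ) {z \<in> pts ?AZ. g z \<in> N}" by (rule morphism_openin[OF gX N(1)])
  then obtain W where W: "openin (affine_zar n) W" "{z \<in> pts ?AZ. g z \<in> N} = W \<inter> Z"
    by (auto simp: openin_subtopology)
  have "e x1 \<in> {z \<in> pts ?AZ. g z \<in> N}" using x1(2) ge'[OF x1(1)] eZ[OF x1(1)] pts_Z by simp
  then have "e x1 \<in> W" using W(2) by blast
  with W(1) obtain q where q: "pvars q \<subseteq> {..<n}" "peval q (e x1) \<noteq> 0" "{y. length y = n \<and> peval q y \<noteq> 0} \<subseteq> W"
    unfolding openin_affine by blast
  have qN: "g z \<in> N" if "z \<in> Z" "peval q z \<noteq> 0" for z
  proof -
    have "z \<in> W \<inter> Z" using that q(3) V_len by (auto simp: Z)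
    then show ?thesis using W(2) by blast
  qed
  have ea: "morphism ?XU (affine_space n) e" by (rule morphism_from_subspace[OF ringed_affine e])
  have coord: "reg X U (\<lambda>x. e x ! j)" if "j < n" for j
  proof -
    have "pts ?XU = U" using pts_U by blast
    then show ?thesis
      using reg_from_open_subspace[OF X(1) U(1), of "pts ?XU"] morphism_affineD(2)[OF ea that] by simp
  qed
  have qreg: "reg X U (\<lambda>x. peval q (e x))"
    by (rule ringed_peval[OF X(1) U(1)]) (use q(1) coord in auto)
  \<comment> \<open>an algebraic relation between that function and the free coordinates\<close>
  from dim U coord \<tau>T(1) qreg obtain K c where
    c: "\<exists>a<K. \<exists>\<alpha>\<in>exps K d. c a \<alpha> \<noteq> 0"
    and rel: "\<And>z. z \<in> U \<Longrightarrow> (\<Sum>a<K. peval q (e z) ^ a *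
        (\<Sum>\<alpha>\<in>exps K d. c a \<alpha> * (\<Prod>i<d. (e z ! \<tau> i) ^ (\<alpha> ! i)))) = 0"
    unfolding alg_dim_le_def
    by (elim allE[of _ U] allE[of _ "\<lambda>x. peval q (e x)"] allE[of _ "\<lambda>i x. e x ! \<tau> i"]) blast
  define R where "R a \<xi> = (\<Sum>\<alpha>\<in>exps K d. c a \<alpha> * (\<Prod>i<d. \<xi> i ^ (\<alpha> ! i)))" for a and \<xi> :: "nat \<Rightarrow> complex"
  \<comment> \<open>the lowest power of the function with a nonzero coefficient; the relation divided by it is \<open>H = 0\<close>\<close>
  define a0 where "a0 = (LEAST a. a < K \<and> (\<exists>\<alpha>\<in>exps K d. c a \<alpha> \<noteq> 0))"
  have a0: "a0 < K" "\<exists>\<alpha>\<in>exps K d. c a0 \<alpha> \<noteq> 0"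
    using LeastI_ex[of "\<lambda>a. a < K \<and> (\<exists>\<alpha>\<in>exps K d. c a \<alpha> \<noteq> 0)"] c unfolding a0_def by blast+
  have low: "R a \<xi> = 0" if "a < a0" for a \<xi>
    unfolding R_def using not_less_Least[OF that[unfolded a0_def]] a0(1) that
    by (intro sum.neutral) auto
  define H where "H z = (\<Sum>a\<in>{a0..<K}. peval q (e z) ^ (a - a0) * R a (\<lambda>i. e z ! \<tau> i))" for z
  have H: "peval q (e z) ^ a0 * H z = 0" if "z \<in> U" for z
  proof -
    have "0 = (\<Sum>a<K. peval q (e z) ^ a * R a (\<lambda>i. e z ! \<tau> i))"
      using rel[OF that] by (simp add: R_def)
    also have "\<dots> = (\<Sum>a\<in>{a0..<K}. peval q (e z) ^ a * R a (\<lambda>i. e z ! \<tau> i))"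
      by (rule sum.mono_neutral_right) (auto simp: low)
    also have "\<dots> = peval q (e z) ^ a0 * H z"
      unfolding H_def sum_distrib_left by (intro sum.cong) (auto simp flip: power_add mult.assoc)
    finally show ?thesis by simp
  qed
  have Hreg: "reg X U H"
    unfolding H_def R_def
    by (intro ringed_sum ringed_mult ringed_power ringed_const ringed_prod X(1) U(1) qreg coord) (use \<tau>T in auto)
  have Hz: "H z = 0" if "z \<in> U" for z
  proof (rule irreducible_regular_zero[OF X _ _ Hreg _ that])
    show "openin (zar X) {x \<in> U. peval q (e x) \<noteq> 0}" by (rule ringed_nonzero[OF X(1) qreg])
    show "{x \<in> U. peval q (e x) \<noteq> 0} \<noteq> {}" using x1 q(2) by blast
    show "H x = 0" if "x \<in> U \<inter> {x \<in> U. peval q (e x) \<noteq> 0}" for x using H[of x] that by auto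
  qed
  from nonzero_polynomial_point[OF a0(2)] obtain \<xi> where \<xi>: "R a0 \<xi> \<noteq> 0" unfolding R_def by blast
  \<comment> \<open>the arc through \<open>z0\<close> whose free coordinates move on the line towards \<open>\<xi>\<close>\<close>
  define v where "v j = (if j \<in> ?T then \<xi> (inv_into {0..<d} \<tau> j) - z0 ! j else 0)" for j
  have v\<tau>: "v (\<tau> i) = \<xi> i - z0 ! \<tau> i" if "i < d" for i
  proof -
    have "inv_into {0..<d} \<tau> (\<tau> i) = i"
      using \<tau> that by (intro inv_into_f_f) (auto simp: bij_betw_def)
    then show ?thesis using \<tau>T[OF that] by (simp add: v_def)
  qed
  obtain r y where r: "r > 0" and y: "\<And>l. l < length ps \<Longrightarrow> y l holomorphic_on ball 0 r"
    and y0: "\<And>l. l < length ps \<Longrightarrow> y l 0 = 0"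
    and sol: "\<And>s p. s \<in> ball 0 r \<Longrightarrow> p \<in> set ps \<Longrightarrow>
       peval p (shift z0 (\<lambda>j. s * v j + (\<Sum>l<length ps. Q j l * y l s))) = 0"
  proof (rule implicit_arc[of ps z0 Q v])
    show "pvars p \<subseteq> {..<length z0}" if "p \<in> set ps" for p using ps that z0(2) by simp
    show "peval p z0 = 0" if "p \<in> set ps" for p using z0(1) that by (simp add: Z)
    show "(\<Sum>j<length z0. partial j (ps ! i) z0 * Q j l) = (if i = l then 1 else 0)"
      if "i < length ps" "l < length ps" for i l using Q[OF that] z0(2) by simp
  qed blast
  define \<zeta> where "\<zeta> s = shift z0 (\<lambda>j. s * v j + (\<Sum>l<length ps. Q j l * y l s))" for s
  have \<zeta>len: "length (\<zeta> s) = n" for s by (simp add: \<zeta>_def z0)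
  have \<zeta>0: "\<zeta> 0 = z0"
    by (rule nth_equalityI) (auto simp: \<zeta>_def y0)
  have \<zeta>an: "(\<lambda>s. \<zeta> s ! j) analytic_on {0}" if "j < n" for j
  proof -
    have "(\<lambda>s. \<zeta> s ! j) = (\<lambda>s. z0 ! j + (s * v j + (\<Sum>l<length ps. Q j l * y l s)))"
      using that z0(2) by (simp add: \<zeta>_def)
    moreover have "\<dots> holomorphic_on ball 0 r" by (intro holomorphic_intros y) auto
    ultimately show ?thesis using r by (auto simp: analytic_at_ball)
  qed
  have \<zeta>\<tau>: "\<zeta> s ! \<tau> i = z0 ! \<tau> i + s * (\<xi> i - z0 ! \<tau> i)" if "i < d" for s i
    using \<tau>T[OF that] z0(2) by (simp add: \<zeta>_def Q0 v\<tau>[OF that])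
  have arc\<zeta>: "arc (affine_space n) \<zeta>" by (rule arc_affine[OF \<zeta>len \<zeta>an])
  have "eventually (\<lambda>s. \<zeta> s \<in> V) (nhds 0)"
    by (rule arc_open[OF arc\<zeta> ringed_affine V]) (simp add: \<zeta>0 z0)
  moreover have "eventually (\<lambda>s. s \<in> ball 0 r) (nhds (0::complex))"
    using r by (intro eventually_nhds_in_open) auto
  ultimately have evZ: "eventually (\<lambda>s. \<zeta> s \<in> Z) (nhds 0)"
  proof eventually_elim
    case (elim s)
    then show ?case using sol[OF elim(2)] by (simp add: Z \<zeta>_def)
  qed
  have arcZ: "arc ?AZ \<zeta>" by (rule arc_subspace[OF arc\<zeta> ringed_affine evZ])
  define \<beta> where "\<beta> s = g (\<zeta> s)" for s
  have \<beta>: "arc X \<beta>" unfolding \<beta>_def by (rule arc_compose[OF arcZ gX])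
  have \<beta>0: "\<beta> 0 = x0" using ge'[OF U(2)] by (simp add: \<beta>_def \<zeta>0 z0_def)
  have qan: "(\<lambda>s. peval q (\<zeta> s)) analytic_on {0}"
    using q(1) \<zeta>an by (intro analytic_peval) auto
  have "\<exists>\<^sub>F s in at 0. peval q (\<zeta> s) \<noteq> 0"
  proof (rule ccontr)
    assume "\<not> (\<exists>\<^sub>F s in at 0. peval q (\<zeta> s) \<noteq> 0)"
    then have "\<forall>\<^sub>F s in at 0. peval q (\<zeta> s) = 0" by (simp add: frequently_def)
    moreover have "\<forall>\<^sub>F s in at 0. \<zeta> s \<in> Z" using evZ by (simp add: eventually_nhds_conv_at)
    ultimately have "\<forall>\<^sub>F s in at 0. R a0 (\<lambda>i. z0 ! \<tau> i + s * (\<xi> i - z0 ! \<tau> i)) = 0"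
    proof eventually_elim
      case (elim s)
      have "0 = H (g (\<zeta> s))" using Hz gU elim by simp
      also have "\<dots> = (\<Sum>a\<in>{a0..<K}. 0 ^ (a - a0) * R a (\<lambda>i. \<zeta> s ! \<tau> i))"
        using elim(1) eg'[OF elim(2)] by (simp add: H_def)
      also have "\<dots> = (\<Sum>a\<in>{a0}. 0 ^ (a - a0) * R a (\<lambda>i. \<zeta> s ! \<tau> i))"
        by (rule sum.mono_neutral_right) (use a0(1) in auto)
      also have "\<dots> = R a0 (\<lambda>i. z0 ! \<tau> i + s * (\<xi> i - z0 ! \<tau> i))"
        unfolding R_def by (simp add: \<zeta>\<tau>)
      finally show ?case by simp
    qed
    then obtain \<epsilon> where \<epsilon>: "\<epsilon> > 0"
      "\<And>s. s \<noteq> 0 \<Longrightarrow> dist s 0 < \<epsilon> \<Longrightarrow> R a0 (\<lambda>i. z0 ! \<tau> i + s * (\<xi> i - z0 ! \<tau> i)) = 0"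
      unfolding eventually_at by blast
    define \<rho> where "\<rho> s = R a0 (\<lambda>i. z0 ! \<tau> i + s * (\<xi> i - z0 ! \<tau> i))" for s
    have "\<rho> 1 = 0"
    proof (rule analytic_continuation[where f = \<rho> and S = UNIV and U = "ball 0 \<epsilon> - {0}" and \<xi> = 0])
      show "\<rho> holomorphic_on UNIV"
        unfolding \<rho>_def R_def by (intro holomorphic_intros)
      show "0 islimpt (ball 0 \<epsilon> - {0::complex})"
        using \<epsilon>(1) by (simp add: islimpt_punctured[symmetric] islimpt_ball)
      show "\<rho> z = 0" if "z \<in> ball 0 \<epsilon> - {0}" for z
        using \<epsilon>(2)[of z] that by (simp add: \<rho>_def dist_commute)
    qed auto
    then have "R a0 (\<lambda>i. \<xi> i) = 0" by (simp add: \<rho>_def)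
    with \<xi> show False by simp
  qed
  then have "\<forall>\<^sub>F s in at 0. peval q (\<zeta> s) \<noteq> 0"
    by (rule non_zero_neighbour[OF isolated_singularity_at_analytic[OF qan] not_essential_analytic[OF qan]])
  moreover have "\<forall>\<^sub>F s in at 0. \<zeta> s \<in> Z" using evZ by (simp add: eventually_nhds_conv_at)
  ultimately have "\<forall>\<^sub>F s in at 0. \<beta> s \<in> N"
    by eventually_elim (simp add: \<beta>_def qN)
  with \<beta> \<beta>0 show thesis by (rule that)
qed

section \<open>Density of fibre products\<close>

text \<open>A nonconstant holomorphic germ is open, so it takes all values close to the common one.\<close>

lemma arcs_meet:
  assumes A: "A analytic_on {0}" and B: "B analytic_on {0}" and AB: "A 0 = (B 0 :: complex)"
    and Bn: "\<forall>\<^sub>F s in at 0. B s \<noteq> B 0"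
    and P: "\<forall>\<^sub>F s' in nhds 0. P s'"
  shows "\<forall>\<^sub>F s in nhds 0. \<exists>s'. P s' \<and> B s' = A s"
proof -
  from B obtain r where r: "r > 0" "B holomorphic_on ball 0 r" unfolding analytic_at_ball by blast
  from P obtain \<delta> where \<delta>: "\<delta> > 0" "\<And>s. dist s 0 < \<delta> \<Longrightarrow> P s" unfolding eventually_nhds_metric by blast
  from Bn obtain \<epsilon> where \<epsilon>: "\<epsilon> > 0" "\<And>s. s \<noteq> 0 \<Longrightarrow> dist s 0 < \<epsilon> \<Longrightarrow> B s \<noteq> B 0"
    unfolding eventually_at by blast
  define \<rho> where "\<rho> = min r (min \<delta> \<epsilon>)"
  have \<rho>: "\<rho> > 0" "\<rho> \<le> r" "\<rho> \<le> \<delta>" "\<rho> \<le> \<epsilon>" using r \<delta> \<epsilon> by (auto simp: \<rho>_def)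
  have "\<not> B constant_on ball 0 \<rho>"
  proof
    assume "B constant_on ball 0 \<rho>"
    then obtain c where c: "\<And>s. s \<in> ball 0 \<rho> \<Longrightarrow> B s = c" unfolding constant_on_def by blast
    have "complex_of_real (\<rho> / 2) \<in> ball 0 \<rho>" "(0::complex) \<in> ball 0 \<rho>" using \<rho> by auto
    then have "B (complex_of_real (\<rho> / 2)) = B 0" using c by metis
    moreover have "complex_of_real (\<rho> / 2) \<noteq> 0" "dist (complex_of_real (\<rho> / 2)) 0 < \<epsilon>" using \<rho> by auto
    ultimately show False using \<epsilon>(2) by blast
  qed
  moreover have "B holomorphic_on ball 0 \<rho>"
    by (rule holomorphic_on_subset[OF r(2)]) (use \<rho> in auto)
  ultimately have "open (B ` ball 0 \<rho>)"
    by (intro open_mapping_thm[of B "ball 0 \<rho>"]) auto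
  moreover have "A 0 \<in> B ` ball 0 \<rho>" using AB \<rho>(1) by auto
  moreover have "(A \<longlongrightarrow> A 0) (nhds 0)"
    using analytic_at_imp_isCont[OF A] by (simp add: isCont_def tendsto_nhds_iff)
  ultimately have "\<forall>\<^sub>F s in nhds 0. A s \<in> B ` ball 0 \<rho>" by (metis topological_tendstoD)
  then show ?thesis
    by (rule eventually_mono) (use \<delta>(2) \<rho> in \<open>force simp: dist_commute\<close>)
qed

lemma tensor_slice_fst:
  assumes "ringed X" "tensor_fun X Y U V h" "openin (zar X) U"
  shows "reg X U (\<lambda>x. h (x, b))"
proof -
  from assms(2) obtain n :: nat and f g where f: "\<And>i. i < n \<Longrightarrow> reg X U (f i)" "\<And>i. i < n \<Longrightarrow> reg Y V (g i)"
    "\<And>x y. h (x, y) = (\<Sum>i<n. f i x * g i y)" by (rule tensor_funE) blast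
  show ?thesis unfolding f(3)
    by (intro ringed_sum ringed_mult ringed_const assms f) auto
qed

lemma tensor_slice_snd:
  assumes "ringed Y" "tensor_fun X Y U V h" "openin (zar Y) V"
  shows "reg Y V (\<lambda>y. h (a, y))"
proof -
  from assms(2) obtain n :: nat and f g where f: "\<And>i. i < n \<Longrightarrow> reg X U (f i)" "\<And>i. i < n \<Longrightarrow> reg Y V (g i)"
    "\<And>x y. h (x, y) = (\<Sum>i<n. f i x * g i y)" by (rule tensor_funE) blast
  show ?thesis unfolding f(3)
    by (intro ringed_sum ringed_mult ringed_const assms f) auto
qed

text \<open>Over the first factor one finds \<open>x\<close> whose fibre meets both open sets; the two traces on this
  fibre are open in the second factor.\<close>

lemma irreducible_fprod:
  assumes "ringed X" "ringed Y" "irreducible_fs X" "irreducible_fs Y"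
  shows "irreducible_fs (X \<times>\<^sub>v Y)"
  unfolding irreducible_fs_def
proof (intro conjI allI impI, goal_cases)
  case 1
  then show ?case using assms(3,4) by (auto simp: pts_fprod[OF assms(1,2)] irreducible_fs_def)
next
  case (2 N N')
  then obtain a b a' b' where z: "(a, b) \<in> N" "(a', b') \<in> N'" by (metis all_not_in_conv surj_pair)
  from 2 have N: "openin (zar (X \<times>\<^sub>v Y)) N" "openin (zar (X \<times>\<^sub>v Y)) N'" by blast+
  from openin_prodE[OF assms(1,2) N(1) z(1)] obtain U V h where
    h: "openin (zar X) U" "openin (zar Y) V" "tensor_fun X Y U V h" "(a, b) \<in> U \<times> V" "h (a, b) \<noteq> 0"
    "{z \<in> U \<times> V. h z \<noteq> 0} \<subseteq> N" by blast
  from openin_prodE[OF assms(1,2) N(2) z(2)] obtain U' V' h' where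
    h': "openin (zar X) U'" "openin (zar Y) V'" "tensor_fun X Y U' V' h'" "(a', b') \<in> U' \<times> V'" "h' (a', b') \<noteq> 0"
    "{z \<in> U' \<times> V'. h' z \<noteq> 0} \<subseteq> N'" by blast
  have "openin (zar X) {x \<in> U. h (x, b) \<noteq> 0}" "openin (zar X) {x \<in> U'. h' (x, b') \<noteq> 0}"
    using ringed_nonzero[OF assms(1) tensor_slice_fst[OF assms(1) h(3,1)]]
      ringed_nonzero[OF assms(1) tensor_slice_fst[OF assms(1) h'(3,1)]] by blast+
  moreover have "{x \<in> U. h (x, b) \<noteq> 0} \<noteq> {}" "{x \<in> U'. h' (x, b') \<noteq> 0} \<noteq> {}" using h h' by blast+
  ultimately have "{x \<in> U. h (x, b) \<noteq> 0} \<inter> {x \<in> U'. h' (x, b') \<noteq> 0} \<noteq> {}"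
    using assms(3) unfolding irreducible_fs_def by blast
  then obtain x where x: "x \<in> U" "h (x, b) \<noteq> 0" "x \<in> U'" "h' (x, b') \<noteq> 0" by blast
  have "openin (zar Y) {y \<in> V. h (x, y) \<noteq> 0}" "openin (zar Y) {y \<in> V'. h' (x, y) \<noteq> 0}"
    using ringed_nonzero[OF assms(2) tensor_slice_snd[OF assms(2) h(3,2)]]
      ringed_nonzero[OF assms(2) tensor_slice_snd[OF assms(2) h'(3,2)]] by blast+
  moreover have "{y \<in> V. h (x, y) \<noteq> 0} \<noteq> {}" "{y \<in> V'. h' (x, y) \<noteq> 0} \<noteq> {}" using h h' x by blast+
  ultimately have "{y \<in> V. h (x, y) \<noteq> 0} \<inter> {y \<in> V'. h' (x, y) \<noteq> 0} \<noteq> {}"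
    using assms(4) unfolding irreducible_fs_def by blast
  then obtain y where y: "y \<in> V" "h (x, y) \<noteq> 0" "y \<in> V'" "h' (x, y) \<noteq> 0" by blast
  have "(x, y) \<in> N" using h(6) x y by auto
  moreover have "(x, y) \<in> N'" using h'(6) x y by auto
  ultimately show "N \<inter> N' \<noteq> {}" by blast
qed

lemma dense_openI:
  assumes "openin (zar X) U" "\<And>T. openin (zar X) T \<Longrightarrow> T \<noteq> {} \<Longrightarrow> U \<inter> T \<noteq> {}"
  shows "dense_open X U"
proof -
  have "x \<in> zar X closure_of U" if "x \<in> pts X" for x
    unfolding in_closure_of using assms(2) that by blast
  then show ?thesis using assms(1) closure_of_subset_topspace[of "zar X" U] unfolding dense_open_def by blast
qed

lemma dense_openD:
  assumes "dense_open X U" "openin (zar X) T" "T \<noteq> {}"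
  shows "U \<inter> T \<noteq> {}"
proof -
  obtain x where x: "x \<in> T" using assms(3) by blast
  then have "x \<in> zar X closure_of U" using assms(1) openin_subset[OF assms(2)] unfolding dense_open_def by blast
  then show ?thesis using x assms(2) unfolding in_closure_of by blast
qed

lemma dense_open_openin: "dense_open X U \<Longrightarrow> openin (zar X) U"
  by (simp add: dense_open_def)

lemma irreducible_dense_open:
  "irreducible_fs X \<Longrightarrow> openin (zar X) U \<Longrightarrow> U \<noteq> {} \<Longrightarrow> dense_open X U"
  by (rule dense_openI) (auto simp: irreducible_fs_def)

lemma morphism_const:
  assumes "ringed X" "y \<in> pts Y"
  shows "morphism X Y (\<lambda>_. y)"
proof (rule morphismI)
  show o: "openin (zar X) {x \<in> pts X. y \<in> V}" for V by (cases "y \<in> V") auto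
  show "reg X {x \<in> pts X. y \<in> V} (\<lambda>_. g y)" for V g by (rule ringed_const[OF assms(1) o])
qed (rule assms(2))

text \<open>Near each point a single regular function separates points, as a coordinate does on an open part of
  the affine line.  Such a function transports equality of points of \<open>P\<close> to equality of complex numbers.\<close>

definition has_charts :: "'a fspace \<Rightarrow> bool" where
  "has_charts P \<longleftrightarrow> (\<forall>p\<in>pts P. \<exists>U T. reg P U T \<and> p \<in> U \<and> inj_on T U)"

lemma has_charts_point_closed:
  assumes "ringed P" "has_charts P"
  shows "openin (zar P) (pts P - {p})"
proof (subst openin_subopen, intro ballI)
  fix x assume x: "x \<in> pts P - {p}"
  then obtain U T where U: "reg P U T" "x \<in> U" "inj_on T U" using assms(2) unfolding has_charts_def by blast
  have o: "openin (zar P) U" by (rule ringed_openin[OF assms(1) U(1)])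
  show "\<exists>V. openin (zar P) V \<and> x \<in> V \<and> V \<subseteq> pts P - {p}"
  proof (cases "p \<in> U")
    case False
    then show ?thesis using U(2) o openin_subset[OF o] by blast
  next
    case True
    have "reg P U (\<lambda>y. T y + (- T p))"
      by (intro ringed_add ringed_const assms(1) U(1) o)
    from ringed_nonzero[OF assms(1) this] have "openin (zar P) {y \<in> U. T y + (- T p) \<noteq> 0}" .
    moreover have "x \<in> {y \<in> U. T y + (- T p) \<noteq> 0}" using U(2,3) True x by (auto dest: inj_onD)
    moreover have "{y \<in> U. T y + (- T p) \<noteq> 0} \<subseteq> pts P - {p}" using openin_subset[OF o] by auto
    ultimately show ?thesis by blast
  qed
qed

text \<open>Take arcs through the two components of a point of \<open>N\<close> that avoid, except at their centres, the
  fibre over the common image \<open>p\<close> and the complements of \<open>X1\<close> and \<open>Y1\<close>.  Composed with a chart at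
  \<open>p\<close>, they become holomorphic germs with the same value at \<open>0\<close>, and the second is not constant.
  So every value of the first near the centre is attained by the second, which yields pairs in the fibre
  product that tend to the given point.\<close>

lemma fibre_product_meets:
  assumes R: "ringed X" "ringed Y" "ringed P" "has_charts P"
    and X: "irreducible_fs X" "smooth_of_dim d X" "alg_dim_le d X"
    and Y: "irreducible_fs Y" "smooth_of_dim e Y" "alg_dim_le e Y"
    and f: "morphism X P f" and g: "morphism Y P g"
    and X1: "openin (zar X) X1" "\<And>p. {x \<in> X1. f x \<noteq> p} \<noteq> {}"
    and Y1: "openin (zar Y) Y1" "\<And>p. {y \<in> Y1. g y \<noteq> p} \<noteq> {}"
    and N: "openin (zar (fibre_product X f Y g)) N" "N \<noteq> {}"
  shows "\<exists>x y. (x, y) \<in> N \<and> x \<in> X1 \<and> y \<in> Y1"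
proof -
  from N(1) obtain N0 where N0: "openin (zar (X \<times>\<^sub>v Y)) N0" "N = N0 \<inter> {(x, y). f x = g y}"
    unfolding fibre_product_def zar_subspace openin_subtopology by blast
  from N(2) obtain a0 c0 where ac: "(a0, c0) \<in> N" by (metis all_not_in_conv surj_pair)
  define p where "p = f a0"
  have p: "f a0 = p" "g c0 = p" using ac N0(2) by (auto simp: p_def)
  have "(a0, c0) \<in> N0" using ac N0(2) by blast
  from openin_prodE[OF R(1,2) N0(1) this] obtain U V h where
    h: "openin (zar X) U" "openin (zar Y) V" "tensor_fun X Y U V h" "(a0, c0) \<in> U \<times> V" "h (a0, c0) \<noteq> 0"
    "{z \<in> U \<times> V. h z \<noteq> 0} \<subseteq> N0" by blast
  have pts: "a0 \<in> pts X" "c0 \<in> pts Y" using h(4) openin_subset[OF h(1)] openin_subset[OF h(2)] by auto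
  have pP: "p \<in> pts P" using morphism_pts[OF f pts(1)] p(1) by simp
  from R(4) pP obtain Op T where T: "reg P Op T" "p \<in> Op" "inj_on T Op" unfolding has_charts_def by blast
  have po: "openin (zar P) (pts P - {p})" by (rule has_charts_point_closed[OF R(3,4)])
  let ?NX = "{x \<in> X1. f x \<noteq> p}" and ?NY = "{y \<in> Y1. g y \<noteq> p}"
  have NXeq: "?NX = X1 \<inter> {x \<in> pts X. f x \<in> pts P - {p}}"
    using openin_subset[OF X1(1)] morphism_pts[OF f] by auto
  have NX: "openin (zar X) ?NX"
    unfolding NXeq by (rule openin_Int[OF X1(1) morphism_openin[OF f po]])
  have NYeq: "?NY = Y1 \<inter> {y \<in> pts Y. g y \<in> pts P - {p}}"
    using openin_subset[OF Y1(1)] morphism_pts[OF g] by auto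
  have NY: "openin (zar Y) ?NY"
    unfolding NYeq by (rule openin_Int[OF Y1(1) morphism_openin[OF g po]])
  obtain \<beta> where \<beta>: "arc X \<beta>" "\<beta> 0 = a0" "\<forall>\<^sub>F s in at 0. \<beta> s \<in> ?NX"
    by (rule smooth_arc[OF R(1) X(1,2,3) pts(1) NX X1(2)])
  obtain \<gamma> where \<gamma>: "arc Y \<gamma>" "\<gamma> 0 = c0" "\<forall>\<^sub>F s in at 0. \<gamma> s \<in> ?NY"
    by (rule smooth_arc[OF R(2) Y(1,2,3) pts(2) NY Y1(2)])
  define A where "A s = T (f (\<beta> s))" for s
  define B where "B s = T (g (\<gamma> s))" for s
  have arcs: "arc P (\<lambda>s. f (\<beta> s))" "arc P (\<lambda>s. g (\<gamma> s))"
    by (rule arc_compose[OF \<beta>(1) f], rule arc_compose[OF \<gamma>(1) g])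
  have in0: "f (\<beta> 0) \<in> Op" "g (\<gamma> 0) \<in> Op" using T(2) p \<beta>(2) \<gamma>(2) by simp_all
  have an: "A analytic_on {0}" "B analytic_on {0}"
    unfolding A_def B_def using arcD(3)[OF arcs(1) T(1)] arcD(3)[OF arcs(2) T(1)] in0 by blast+
  have evO: "\<forall>\<^sub>F s in nhds 0. f (\<beta> s) \<in> Op" "\<forall>\<^sub>F s in nhds 0. g (\<gamma> s) \<in> Op"
    using arcD(2)[OF arcs(1) T(1)] arcD(2)[OF arcs(2) T(1)] in0 by blast+
  have AB: "A 0 = B 0" using p \<beta>(2) \<gamma>(2) by (simp add: A_def B_def)
  have "\<forall>\<^sub>F s in at 0. g (\<gamma> s) \<in> Op" using evO(2) by (simp add: eventually_nhds_conv_at)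
  with \<gamma>(3) have Bn: "\<forall>\<^sub>F s in at 0. B s \<noteq> B 0"
  proof eventually_elim
    case (elim s)
    then show ?case using T(2,3) p(2) \<gamma>(2) by (auto simp: B_def dest: inj_onD)
  qed
  \<comment> \<open>the open set around \<open>(a0, c0)\<close> contains all pairs of nearby points of the two arcs\<close>
  from h(3) obtain n :: nat and u v where uv: "\<And>i. i < n \<Longrightarrow> reg X U (u i)" "\<And>i. i < n \<Longrightarrow> reg Y V (v i)"
    "\<And>x y. h (x, y) = (\<Sum>i<n. u i x * v i y)" by (rule tensor_funE) blast
  have lim: "(\<phi> \<longlongrightarrow> \<phi> 0) (nhds 0)" if "\<phi> analytic_on {0}" for \<phi> :: "complex \<Rightarrow> complex"
    using analytic_at_imp_isCont[OF that] by (simp add: isCont_def tendsto_nhds_iff)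
  have lu: "((\<lambda>s. u i (\<beta> s)) \<longlongrightarrow> u i a0) (nhds 0)" if "i < n" for i
    using lim[OF arcD(3)[OF \<beta>(1) uv(1)[OF that]]] h(4) \<beta>(2) by simp
  have lv: "((\<lambda>s. v i (\<gamma> s)) \<longlongrightarrow> v i c0) (nhds 0)" if "i < n" for i
    using lim[OF arcD(3)[OF \<gamma>(1) uv(2)[OF that]]] h(4) \<gamma>(2) by simp
  have "((\<lambda>z. \<Sum>i<n. u i (\<beta> (fst z)) * v i (\<gamma> (snd z))) \<longlongrightarrow> (\<Sum>i<n. u i a0 * v i c0)) (nhds 0 \<times>\<^sub>F nhds 0)"
  proof (intro tendsto_sum tendsto_mult)
    fix i assume "i \<in> {..<n}"
    then have i: "i < n" by simp
    show "((\<lambda>z. u i (\<beta> (fst z))) \<longlongrightarrow> u i a0) (nhds 0 \<times>\<^sub>F nhds 0)"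
      by (rule filterlim_compose[OF lu[OF i] filterlim_fst])
    show "((\<lambda>z. v i (\<gamma> (snd z))) \<longlongrightarrow> v i c0) (nhds 0 \<times>\<^sub>F nhds 0)"
      by (rule filterlim_compose[OF lv[OF i] filterlim_snd])
  qed
  then have "((\<lambda>z. h (\<beta> (fst z), \<gamma> (snd z))) \<longlongrightarrow> h (a0, c0)) (nhds 0 \<times>\<^sub>F nhds 0)" by (simp add: uv(3))
  then have "\<forall>\<^sub>F z in nhds 0 \<times>\<^sub>F nhds 0. h (\<beta> (fst z), \<gamma> (snd z)) \<noteq> 0"
    by (rule tendsto_imp_eventually_ne) (rule h(5))
  then obtain Pf Pg where Pf: "eventually Pf (nhds 0)" and Pg: "eventually Pg (nhds 0)"
    and PP: "\<And>s s'. Pf s \<Longrightarrow> Pg s' \<Longrightarrow> h (\<beta> s, \<gamma> s') \<noteq> 0"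
    unfolding eventually_prod_filter by auto
  have evU: "\<forall>\<^sub>F s in nhds 0. \<beta> s \<in> U" by (rule arc_open[OF \<beta>(1) R(1) h(1)]) (use h(4) \<beta>(2) in auto)
  have evV: "\<forall>\<^sub>F s in nhds 0. \<gamma> s \<in> V" by (rule arc_open[OF \<gamma>(1) R(2) h(2)]) (use h(4) \<gamma>(2) in auto)
  have evNY: "\<forall>\<^sub>F s in nhds 0. s \<noteq> 0 \<longrightarrow> \<gamma> s \<in> ?NY" using \<gamma>(3) by (simp add: eventually_at_filter)
  have "\<forall>\<^sub>F s' in nhds 0. Pg s' \<and> \<gamma> s' \<in> V \<and> g (\<gamma> s') \<in> Op \<and> (s' \<noteq> 0 \<longrightarrow> \<gamma> s' \<in> ?NY)"
    using Pg evV evO(2) evNY by eventually_elim blast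
  from arcs_meet[OF an AB Bn this] have "\<forall>\<^sub>F s in nhds 0. \<exists>s'. (Pg s' \<and> \<gamma> s' \<in> V \<and> g (\<gamma> s') \<in> Op \<and>
      (s' \<noteq> 0 \<longrightarrow> \<gamma> s' \<in> ?NY)) \<and> B s' = A s" .
  with Pf evU evO(1) have "\<forall>\<^sub>F s in nhds 0. Pf s \<and> \<beta> s \<in> U \<and> f (\<beta> s) \<in> Op \<and>
      (\<exists>s'. (Pg s' \<and> \<gamma> s' \<in> V \<and> g (\<gamma> s') \<in> Op \<and> (s' \<noteq> 0 \<longrightarrow> \<gamma> s' \<in> ?NY)) \<and> B s' = A s)"
    by eventually_elim blast
  then have "\<forall>\<^sub>F s in at 0. Pf s \<and> \<beta> s \<in> U \<and> f (\<beta> s) \<in> Op \<and>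
      (\<exists>s'. (Pg s' \<and> \<gamma> s' \<in> V \<and> g (\<gamma> s') \<in> Op \<and> (s' \<noteq> 0 \<longrightarrow> \<gamma> s' \<in> ?NY)) \<and> B s' = A s)"
    unfolding eventually_nhds_conv_at by blast
  with \<beta>(3) have "\<forall>\<^sub>F s in at 0. \<beta> s \<in> ?NX \<and> Pf s \<and> \<beta> s \<in> U \<and> f (\<beta> s) \<in> Op \<and>
      (\<exists>s'. (Pg s' \<and> \<gamma> s' \<in> V \<and> g (\<gamma> s') \<in> Op \<and> (s' \<noteq> 0 \<longrightarrow> \<gamma> s' \<in> ?NY)) \<and> B s' = A s)"
    by (rule eventually_conj)
  then have "\<exists>s. \<beta> s \<in> ?NX \<and> Pf s \<and> \<beta> s \<in> U \<and> f (\<beta> s) \<in> Op \<and>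
      (\<exists>s'. (Pg s' \<and> \<gamma> s' \<in> V \<and> g (\<gamma> s') \<in> Op \<and> (s' \<noteq> 0 \<longrightarrow> \<gamma> s' \<in> ?NY)) \<and> B s' = A s)"
    by (rule eventually_happens'[rotated]) simp
  then obtain s s' where s: "\<beta> s \<in> ?NX" "Pf s" "\<beta> s \<in> U" "f (\<beta> s) \<in> Op"
    and s': "Pg s'" "\<gamma> s' \<in> V" "g (\<gamma> s') \<in> Op" "s' \<noteq> 0 \<longrightarrow> \<gamma> s' \<in> ?NY" "B s' = A s" by blast
  have eq: "f (\<beta> s) = g (\<gamma> s')" using T(3) s(4) s'(3,5) unfolding A_def B_def by (metis inj_onD)
  have "s' \<noteq> 0" using s(1) eq p(2) \<gamma>(2) by auto
  then have "\<gamma> s' \<in> Y1" using s'(4) by blast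
  moreover have "(\<beta> s, \<gamma> s') \<in> N" using N0(2) h(6) s(3) s'(2) PP[OF s(2) s'(1)] eq by auto
  moreover have "\<beta> s \<in> X1" using s(1) by blast
  ultimately show ?thesis by blast
qed

section \<open>Charts of the projective line and of the double plane\<close>

lemma reg_wproj_quotient:
  assumes "whomog a d p" "whomog a d q"
  shows "reg (wproj_space a) (wopen a q) (\<lambda>b. peval p (orep a b) / peval q (orep a b))"
proof -
  have B: "(wopen a q, \<lambda>b. peval p (orep a b) / peval q (orep a b)) \<in> wproj_basis a"
    by (rule wproj_basisI[OF assms]) auto
  have "openin (zar (wproj_space a)) (wopen a q)"
    unfolding openin_wproj_basis fst_wproj_basis using assms(2) by blast
  with B show ?thesis unfolding reg_wproj by blast
qed

lemma has_charts_P1: "has_charts P1"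
  unfolding has_charts_def P1_wproj
proof
  fix p assume "p \<in> pts (wproj_space [1, 1])"
  then obtain v where v: "v \<in> nonzero_vecs (length [1::nat, 1])" "p = orbit [1, 1] v" unfolding pts_wproj by blast
  then obtain x y where xy: "v = [x, y]" "(x, y) \<noteq> (0, 0)"
    by (auto simp: nonzero_vecs_def length_2_iff length_Suc_conv)
  have chart: "\<exists>U T. reg (wproj_space [1, 1]) U T \<and> p \<in> U \<and> inj_on T U"
    if i: "i < 2" "j < 2" "v ! i \<noteq> 0" "\<And>u w. u \<in> nonzero_vecs 2 \<Longrightarrow> w \<in> nonzero_vecs 2 \<Longrightarrow> u ! i \<noteq> 0 \<Longrightarrow>
      w ! i \<noteq> 0 \<Longrightarrow> u ! j / u ! i = w ! j / w ! i \<Longrightarrow> orbit [1, 1] u = orbit [1, 1] w" for i j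
  proof -
    let ?a = "[1::nat, 1]"
    have a1: "?a ! k = 1" if "k < 2" for k using that by (cases k) (auto simp: less_Suc_eq)
    have w: "whomog ?a 1 (Var i)" "whomog ?a 1 (Var j)"
      by (rule whomog_Var; use i(1,2) a1 in simp)+
    let ?T = "\<lambda>b. peval (Var j) (orep ?a b) / peval (Var i) (orep ?a b)"
    have "reg (wproj_space ?a) (wopen ?a (Var i)) ?T" by (rule reg_wproj_quotient[OF w(2,1)])
    moreover have "p \<in> wopen ?a (Var i)" unfolding v(2) orbit_in_wopen[OF w(1) v(1)] using i(3) by simp
    moreover have "inj_on ?T (wopen ?a (Var i))"
    proof (rule inj_onI)
      fix b b' assume b: "b \<in> wopen ?a (Var i)" and b': "b' \<in> wopen ?a (Var i)" and eq: "?T b = ?T b'"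
      from b obtain u where u: "u \<in> nonzero_vecs (length ?a)" "b = orbit ?a u" "peval (Var i) u \<noteq> 0" unfolding wopen_def by blast
      from b' obtain u' where u': "u' \<in> nonzero_vecs (length ?a)" "b' = orbit ?a u'" "peval (Var i) u' \<noteq> 0" unfolding wopen_def by blast
      have "peval (Var j) u / peval (Var i) u = peval (Var j) u' / peval (Var i) u'"
        using eq unfolding u(2) u'(2) orep_ratio[OF w(2,1) u(1)] orep_ratio[OF w(2,1) u'(1)] .
      moreover have "u \<in> nonzero_vecs 2" "u' \<in> nonzero_vecs 2" using u(1) u'(1) by (simp_all add: numeral_2_eq_2)
      ultimately show "b = b'" unfolding u(2) u'(2) using u(3) u'(3) by (intro i(4)) simp_all
    qed
    ultimately show ?thesis by blast
  qed
  show "\<exists>U T. reg (wproj_space [1, 1]) U T \<and> p \<in> U \<and> inj_on T U"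
  proof (cases "x = 0")
    case False
    show ?thesis
    proof (rule chart[of 0 1])
      fix u w assume uw: "u \<in> nonzero_vecs 2" "w \<in> nonzero_vecs 2" "u ! 0 \<noteq> 0" "w ! 0 \<noteq> (0::complex)"
        and eq: "u ! 1 / u ! 0 = w ! 1 / w ! 0"
      then obtain a b c d where ab: "u = [a, b]" "w = [c, d]" by (auto simp: nonzero_vecs_def length_2_iff)
      then have nz: "a \<noteq> 0" "c \<noteq> 0" "b / a = d / c" using uw eq by simp_all
      show "orbit [1, 1] u = orbit [1, 1] w"
        unfolding ab pt2_eq_iff by (rule exI[of _ "a / c"]) (use nz in \<open>auto simp: field_simps\<close>)
    qed (use False xy in auto)
  next
    case True
    then have y: "y \<noteq> 0" using xy by simp
    show ?thesis
    proof (rule chart[of 1 0])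
      fix u w assume uw: "u \<in> nonzero_vecs 2" "w \<in> nonzero_vecs 2" "u ! 1 \<noteq> 0" "w ! 1 \<noteq> (0::complex)"
        and eq: "u ! 0 / u ! 1 = w ! 0 / w ! 1"
      then obtain a b c d where ab: "u = [a, b]" "w = [c, d]" by (auto simp: nonzero_vecs_def length_2_iff)
      then have nz: "b \<noteq> 0" "d \<noteq> 0" "a / b = c / d" using uw eq by simp_all
      show "orbit [1, 1] u = orbit [1, 1] w"
        unfolding ab pt2_eq_iff by (rule exI[of _ "b / d"]) (use nz in \<open>auto simp: field_simps\<close>)
    qed (use y xy in auto)
  qed
qed

abbreviation w4 :: "nat list" where "w4 \<equiv> [3, 1, 1, 1]"

text \<open>The coordinates \<open>w = S / (X\<^sub>0\<^sup>2 X\<^sub>1)\<close>, \<open>x\<^sub>1 = X\<^sub>1 / X\<^sub>0\<close> and \<open>t = X\<^sub>2 / X\<^sub>1\<close> where none of the last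
  three homogeneous coordinates vanishes.  As \<open>S\<close> comes first, the variables are
  \<open>S, X\<^sub>0, X\<^sub>1, X\<^sub>2\<close> in this order, with indices from \<open>0\<close> to \<open>3\<close>.\<close>

definition chart_dom :: "complex list set set" where
  "chart_dom = wopen w4 (Var 1 * Var 2 * Var 3)"

definition chart_w :: "complex list set \<Rightarrow> complex" where
  "chart_w b = peval (Var 0) (orep w4 b) / peval (Var 1 ^ 2 * Var 2) (orep w4 b)"

definition chart_x :: "complex list set \<Rightarrow> complex" where
  "chart_x b = peval (Var 2) (orep w4 b) / peval (Var 1) (orep w4 b)"

definition chart_t :: "complex list set \<Rightarrow> complex" where
  "chart_t b = peval (Var 3) (orep w4 b) / peval (Var 2) (orep w4 b)"

definition sigma :: "complex list set \<Rightarrow> complex list" where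
  "sigma b = [chart_w b, chart_x b, chart_t b]"

definition sigma_inv :: "complex list \<Rightarrow> complex list set" where
  "sigma_inv z = pt4 (z ! 0 * z ! 1) 1 (z ! 1) (z ! 2 * z ! 1)"

lemma w4_homog:
  "whomog w4 3 (Var 0)" "whomog w4 1 (Var 1)" "whomog w4 1 (Var 2)" "whomog w4 1 (Var 3)"
  "whomog w4 3 (Var 1 ^ 2 * Var 2)" "whomog w4 3 (Var 1 * Var 2 * Var 3)"
proof -
  show *: "whomog w4 3 (Var 0)" "whomog w4 1 (Var 1)" "whomog w4 1 (Var 2)" "whomog w4 1 (Var 3)"
    by (rule whomog_Var; simp add: eval_nat_numeral)+
  show "whomog w4 3 (Var 1 ^ 2 * Var 2)"
    using whomog_mult[OF whomog_mult[OF *(2) *(2)] *(3)] by (simp add: power2_eq_square eval_nat_numeral)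
  show "whomog w4 3 (Var 1 * Var 2 * Var 3)"
    using whomog_mult[OF whomog_mult[OF *(2) *(3)] *(4)] by (simp add: eval_nat_numeral)
qed

lemma nonzero_vecs_4: "[s, x0, x1, x2] \<in> nonzero_vecs (length w4) \<longleftrightarrow> (s, x0, x1, x2) \<noteq> (0, 0, 0, 0)"
  by (auto simp: nonzero_vecs_def)

lemma chart_dom_iff:
  assumes "(s, x0, x1, x2) \<noteq> (0, 0, 0, 0)"
  shows "pt4 s x0 x1 x2 \<in> chart_dom \<longleftrightarrow> x0 \<noteq> 0 \<and> x1 \<noteq> 0 \<and> x2 \<noteq> 0"
  unfolding chart_dom_def orbit_in_wopen[OF w4_homog(6) nonzero_vecs_4[THEN iffD2, OF assms]]
  by (simp add: peval_mult eval_nat_numeral)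

lemma sigma_pt4:
  assumes "(s, x0, x1, x2) \<noteq> (0, 0, 0, 0)"
  shows "sigma (pt4 s x0 x1 x2) = [s / (x0 ^ 2 * x1), x1 / x0, x2 / x1]"
proof -
  note v = nonzero_vecs_4[THEN iffD2, OF assms]
  show ?thesis
    unfolding sigma_def chart_w_def chart_x_def chart_t_def
      orep_ratio[OF w4_homog(1,5) v] orep_ratio[OF w4_homog(3,2) v] orep_ratio[OF w4_homog(4,3) v]
    by (simp add: peval_mult peval_power eval_nat_numeral)
qed

lemma chart_t_pt4: "(s, x0, x1, x2) \<noteq> (0, 0, 0, 0) \<Longrightarrow> chart_t (pt4 s x0 x1 x2) = x2 / x1"
  using sigma_pt4[of s x0 x1 x2] by (simp add: sigma_def)

lemma chart_dom_open: "openin (zar (wproj_space w4)) chart_dom"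
  unfolding chart_dom_def using ringed_openin[OF ringed_wproj reg_wproj_quotient[OF w4_homog(6,6)]] .

lemma wopen_chart_dom:
  "chart_dom \<subseteq> wopen w4 (Var 1 ^ 2 * Var 2)" "chart_dom \<subseteq> wopen w4 (Var 1)" "chart_dom \<subseteq> wopen w4 (Var 2)"
  unfolding chart_dom_def
  using wopen_iff[OF w4_homog(6)] wopen_iff[OF w4_homog(5)] wopen_iff[OF w4_homog(2)] wopen_iff[OF w4_homog(3)]
  by (auto simp: peval_mult peval_power)

lemma chart_regular:
  "reg (wproj_space w4) chart_dom chart_w" "reg (wproj_space w4) chart_dom chart_x"
  "reg (wproj_space w4) chart_dom chart_t"
  unfolding chart_w_def[abs_def] chart_x_def[abs_def] chart_t_def[abs_def]
  by (rule ringed_restrict[OF ringed_wproj reg_wproj_quotient[OF w4_homog(1,5)] chart_dom_open wopen_chart_dom(1)],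
      rule ringed_restrict[OF ringed_wproj reg_wproj_quotient[OF w4_homog(3,2)] chart_dom_open wopen_chart_dom(2)],
      rule ringed_restrict[OF ringed_wproj reg_wproj_quotient[OF w4_homog(4,3)] chart_dom_open wopen_chart_dom(3)])

text \<open>For fixed degree a monomial in two variables is determined by its second exponent, so no
  cancellation occurs when the first variable is set to \<open>1\<close>.\<close>

lemma binary_form_finite_zeros:
  assumes "binary_form d G" "G \<noteq> 0"
  shows "finite {t. dehom G t = 0}"
proof -
  define p where "p = (\<Sum>m\<in>Poly_Mapping.keys G. monom (Poly_Mapping.lookup G m) (Poly_Mapping.lookup m 2))"
  have "monev m [0, 1, t] = t ^ Poly_Mapping.lookup m 2" if "m \<in> Poly_Mapping.keys G" for m t
  proof -
    have "Poly_Mapping.keys m \<subseteq> {1, 2}" using that assms(1) by (auto simp: binary_form_def pvars_def)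
    then have "monev m [0, 1, t] = (\<Prod>i\<in>{1, 2}. ([0, 1, t] ! i) ^ Poly_Mapping.lookup m i)"
      by (intro monev_superset) auto
    then show ?thesis by (simp add: numeral_2_eq_2)
  qed
  then have "dehom G t = poly p t" for t
    by (simp add: dehom_def bval_def peval_alt p_def poly_sum poly_monom)
  moreover have "p \<noteq> 0"
  proof -
    have "Poly_Mapping.keys G \<noteq> {}" using assms(2) by (metis poly_mapping_eqI in_keys_iff lookup_zero empty_iff)
    then obtain m0 where m0: "m0 \<in> Poly_Mapping.keys G" by blast
    have inj: "m = m0" if "m \<in> Poly_Mapping.keys G" "Poly_Mapping.lookup m 2 = Poly_Mapping.lookup m0 2" for m
    proof (rule poly_mapping_eqI)
      fix i :: nat
      have k: "Poly_Mapping.keys m \<subseteq> {1, 2}" "Poly_Mapping.keys m0 \<subseteq> {1, 2}"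
        using that m0 assms(1) by (auto simp: binary_form_def pvars_def)
      have eq: "Poly_Mapping.lookup m 1 = Poly_Mapping.lookup m0 1"
        using that m0 assms(1) unfolding binary_form_def by (metis add_right_cancel)
      consider "i = 1" | "i = 2" | "i \<notin> {1, 2}" by blast
      then show "Poly_Mapping.lookup m i = Poly_Mapping.lookup m0 i"
      proof cases
        case 3
        then have "i \<notin> Poly_Mapping.keys m" "i \<notin> Poly_Mapping.keys m0" using k by blast+
        then show ?thesis by (simp add: in_keys_iff)
      qed (use that(2) eq in simp_all)
    qed
    have "coeff p (Poly_Mapping.lookup m0 2) = (\<Sum>m\<in>{m0}. Poly_Mapping.lookup G m)"
      unfolding p_def coeff_sum coeff_monom using inj m0
      by (intro sum.mono_neutral_cong_right) auto
    then have "coeff p (Poly_Mapping.lookup m0 2) \<noteq> 0" using m0 by (simp add: in_keys_iff)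
    then show ?thesis by auto
  qed
  ultimately show ?thesis using poly_roots_finite[of p] by simp
qed

definition dehom_at :: "nat \<Rightarrow> mpol \<Rightarrow> mpol" where
  "dehom_at j G = (\<Sum>m\<in>Poly_Mapping.keys G. Cst (Poly_Mapping.lookup G m) * Var j ^ Poly_Mapping.lookup m 2)"

lemma peval_dehom_at:
  assumes "pvars G \<subseteq> {1, 2}"
  shows "peval (dehom_at j G) xs = dehom G (xs ! j)"
proof -
  have "monev m [0, 1, t] = t ^ Poly_Mapping.lookup m 2" if "m \<in> Poly_Mapping.keys G" for m t
  proof -
    have "Poly_Mapping.keys m \<subseteq> {1, 2}" using that assms by (auto simp: pvars_def)
    then have "monev m [0, 1, t] = (\<Prod>i\<in>{1, 2}. ([0, 1, t] ! i) ^ Poly_Mapping.lookup m i)"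
      by (intro monev_superset) auto
    then show ?thesis by (simp add: numeral_2_eq_2)
  qed
  then show ?thesis
    by (simp add: dehom_at_def peval_sum peval_mult peval_power dehom_def bval_def peval_alt[of G])
qed

lemma pvars_sumI: "(\<And>i. i \<in> I \<Longrightarrow> pvars (f i) \<subseteq> A) \<Longrightarrow> pvars (\<Sum>i\<in>I. f i) \<subseteq> A"
  by (induction I rule: infinite_finite_induct) (simp_all add: pvars_addI)

lemma pvars_dehom_at: "pvars (dehom_at j G) \<subseteq> {j}"
  unfolding dehom_at_def by (intro pvars_sumI pvars_multI pvars_powerI) simp_all

context sextic_pair
begin

abbreviation SF where "SF \<equiv> S_surface (sextic F3 F6)"

lemma ringed_SF [simp]: "ringed SF"
  by (simp add: S_surface_def)

lemma peval_sextic: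
  assumes "x1 \<noteq> 0"
  shows "peval (sextic F3 F6) [x0, x1, x2] = x0 ^ 3 * (x1 ^ 3 * f3 (x2 / x1)) + x1 ^ 6 * f6 (x2 / x1)"
proof -
  have "peval G [x0, x1, x2] = bval G x1 x2" if "pvars G \<subseteq> {1, 2}" for G
    unfolding bval_def
  proof (rule peval_cong)
    fix i assume "i \<in> pvars G"
    then have "i = 1 \<or> i = 2" using that by auto
    then show "[x0, x1, x2] ! i = [0, x1, x2] ! i" by (auto simp: numeral_2_eq_2)
  qed
  moreover have "bval F3 x1 x2 = x1 ^ 3 * f3 (x2 / x1)" "bval F6 x1 x2 = x1 ^ 6 * f6 (x2 / x1)"
    using bval_dehom[OF F3, of x1 "x2 / x1"] bval_dehom[OF F6, of x1 "x2 / x1"] assms by simp_all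
  ultimately show ?thesis
    using binary_form_pvars[OF F3] binary_form_pvars[OF F6]
    by (simp add: sextic_def peval_add peval_mult peval_power)
qed

lemma pts_SF: "pts SF = {pt4 s x0 x1 x2 | s x0 x1 x2. (s, x0, x1, x2) \<noteq> (0, 0, 0, 0) \<and>
    s ^ 2 = peval (sextic F3 F6) [x0, x1, x2]}"
proof -
  have "pt4 s x0 x1 x2 \<in> pts (wproj_space w4)" if "(s, x0, x1, x2) \<noteq> (0, 0, 0, 0)" for s x0 x1 x2
    unfolding pts_wproj using nonzero_vecs_4[THEN iffD2, OF that] by (rule imageI)
  then show ?thesis unfolding S_surface_def zar_subspace topspace_subtopology by blast
qed

text \<open>The part of the double plane that \<open>sigma\<close> identifies with the points \<open>x\<^sub>1 \<noteq> 0\<close> of \<open>W\<^sup>\<circ>\<close>.\<close>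

definition S1 :: "complex list set set" where
  "S1 = {b \<in> pts SF. b \<in> chart_dom \<and> f3 (chart_t b) \<noteq> 0 \<and> f6 (chart_t b) \<noteq> 0}"

lemma S1_E:
  assumes "b \<in> S1"
  obtains s x0 x1 x2 where "b = pt4 s x0 x1 x2" "x0 \<noteq> 0" "x1 \<noteq> 0" "x2 \<noteq> 0"
    "f3 (x2 / x1) \<noteq> 0" "f6 (x2 / x1) \<noteq> 0" "s ^ 2 = x0 ^ 3 * (x1 ^ 3 * f3 (x2 / x1)) + x1 ^ 6 * f6 (x2 / x1)"
    "sigma b = [s / (x0 ^ 2 * x1), x1 / x0, x2 / x1]"
proof -
  from assms obtain s x0 x1 x2 where b: "b = pt4 s x0 x1 x2" "(s, x0, x1, x2) \<noteq> (0, 0, 0, 0)"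
    "s ^ 2 = peval (sextic F3 F6) [x0, x1, x2]" unfolding S1_def pts_SF by blast
  have d: "x0 \<noteq> 0 \<and> x1 \<noteq> 0 \<and> x2 \<noteq> 0" using assms chart_dom_iff[OF b(2)] unfolding S1_def b(1) by blast
  then have nz: "f3 (x2 / x1) \<noteq> 0" "f6 (x2 / x1) \<noteq> 0"
    using assms chart_t_pt4[OF b(2)] unfolding S1_def b(1) by simp_all
  show thesis
    by (rule that[OF b(1)]) (use d nz b(3) peval_sextic sigma_pt4[OF b(2)] b(1) in auto)
qed

lemma S1_subset: "S1 \<subseteq> pts SF"
  by (auto simp: S1_def)

lemma openin_SF:
  assumes "openin (zar (wproj_space w4)) V"
  shows "openin (zar SF) (V \<inter> pts SF)"
proof -
  have "V \<inter> pts SF = V \<inter> {pt4 s x0 x1 x2 | s x0 x1 x2. (s, x0, x1, x2) \<noteq> (0, 0, 0, 0) \<and>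
      s ^ 2 = peval (sextic F3 F6) [x0, x1, x2]}"
    using openin_subset[OF assms] unfolding pts_SF by blast
  then show ?thesis
    using assms unfolding S_surface_def zar_subspace openin_subtopology by blast
qed

lemma S1_open: "openin (zar SF) S1" "openin (zar SF) {b \<in> S1. chart_t b \<noteq> t0}"
proof -
  have r: "reg (wproj_space w4) chart_dom (\<lambda>b. f3 (chart_t b) * f6 (chart_t b))"
    by (intro ringed_mult ringed_dehom ringed_wproj chart_regular(3) binary_form_pvars[OF F3] binary_form_pvars[OF F6])
  have r': "reg (wproj_space w4) chart_dom (\<lambda>b. f3 (chart_t b) * f6 (chart_t b) * (chart_t b + (- t0)))"
    by (intro ringed_mult[OF ringed_wproj r] ringed_add ringed_const ringed_wproj chart_regular(3) chart_dom_open)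
  have "S1 = {b \<in> chart_dom. f3 (chart_t b) * f6 (chart_t b) \<noteq> 0} \<inter> pts SF"
    by (auto simp: S1_def)
  then show "openin (zar SF) S1" using openin_SF[OF ringed_nonzero[OF ringed_wproj r]] by simp
  have "{b \<in> S1. chart_t b \<noteq> t0} =
      {b \<in> chart_dom. f3 (chart_t b) * f6 (chart_t b) * (chart_t b + (- t0)) \<noteq> 0} \<inter> pts SF"
    by (auto simp: S1_def)
  then show "openin (zar SF) {b \<in> S1. chart_t b \<noteq> t0}"
    using openin_SF[OF ringed_nonzero[OF ringed_wproj r']] by simp
qed

lemma sigma_pts: "b \<in> S1 \<Longrightarrow> sigma b \<in> pts Wo" "b \<in> S1 \<Longrightarrow> sigma b ! 1 \<noteq> 0"
proof -
  assume "b \<in> S1"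
  then obtain s x0 x1 x2 where b: "b = pt4 s x0 x1 x2" "x0 \<noteq> 0" "x1 \<noteq> 0" "x2 \<noteq> 0"
    "f3 (x2 / x1) \<noteq> 0" "f6 (x2 / x1) \<noteq> 0" "s ^ 2 = x0 ^ 3 * (x1 ^ 3 * f3 (x2 / x1)) + x1 ^ 6 * f6 (x2 / x1)"
    "sigma b = [s / (x0 ^ 2 * x1), x1 / x0, x2 / x1]" by (rule S1_E)
  have "(s / (x0 ^ 2 * x1)) ^ 2 = (x0 ^ 3 * (x1 ^ 3 * f3 (x2 / x1)) + x1 ^ 6 * f6 (x2 / x1)) / (x0 ^ 4 * x1 ^ 2)"
    unfolding b(7)[symmetric] by (simp add: power_divide power_mult_distrib flip: power_mult)
  also have "\<dots> = x1 / x0 * f3 (x2 / x1) + (x1 / x0) ^ 4 * f6 (x2 / x1)"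
  proof -
    have "(a ^ 3 * (c ^ 3 * A) + c ^ 6 * B) / (a ^ 4 * c ^ 2) = c / a * A + (c / a) ^ 4 * B"
      if "a \<noteq> 0" "c \<noteq> 0" for a c A B :: complex
    proof -
      have "a ^ 3 * (c ^ 3 * A) + c ^ 6 * B = (c / a * A + (c / a) ^ 4 * B) * (a ^ 4 * c ^ 2)"
        using that by (simp add: algebra_simps power_divide) (simp add: field_simps eval_nat_numeral)
      then show ?thesis using that by simp
    qed
    from this[OF b(2,3)] show ?thesis .
  qed
  finally show "sigma b \<in> pts Wo" using b(2-6) unfolding pts_Wo b(8) by simp
  show "sigma b ! 1 \<noteq> 0" unfolding b(8) using b(2,3) by simp
qed

lemma sigma_inv_sigma:
  assumes "b \<in> S1"
  shows "sigma_inv (sigma b) = b"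
proof -
  from assms obtain s x0 x1 x2 where b: "b = pt4 s x0 x1 x2" "x0 \<noteq> 0" "x1 \<noteq> 0" "x2 \<noteq> 0"
    "f3 (x2 / x1) \<noteq> 0" "f6 (x2 / x1) \<noteq> 0" "s ^ 2 = x0 ^ 3 * (x1 ^ 3 * f3 (x2 / x1)) + x1 ^ 6 * f6 (x2 / x1)"
    "sigma b = [s / (x0 ^ 2 * x1), x1 / x0, x2 / x1]" by (rule S1_E)
  show ?thesis
    unfolding sigma_inv_def b(8) unfolding b(1)
    by (rule orbit_eqI[of "1 / x0"]) (use b(2,3) in \<open>auto simp: field_simps eval_nat_numeral\<close>)
qed

lemma sigma_inv_pts:
  assumes "z \<in> pts Wo" "z ! 1 \<noteq> 0"
  shows "sigma_inv z \<in> S1" "sigma (sigma_inv z) = z" "chart_t (sigma_inv z) = z ! 2"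
proof -
  from assms obtain w x t where z: "z = [w, x, t]" "t \<noteq> 0" "f3 t \<noteq> 0" "f6 t \<noteq> 0" "w ^ 2 = x * f3 t + x ^ 4 * f6 t"
    unfolding pts_Wo by blast
  have x: "x \<noteq> 0" using assms(2) z(1) by simp
  have si: "sigma_inv z = pt4 (w * x) 1 x (t * x)" by (simp add: sigma_inv_def z(1) numeral_2_eq_2)
  have nz: "(w * x, 1 :: complex, x, t * x) \<noteq> (0, 0, 0, 0)" by simp
  have "peval (sextic F3 F6) [1, x, t * x] = x ^ 3 * f3 t + x ^ 6 * f6 t"
    using peval_sextic[OF x, of 1 "t * x"] x by simp
  also have "\<dots> = (x * f3 t + x ^ 4 * f6 t) * x ^ 2" by (simp add: algebra_simps eval_nat_numeral)
  also have "\<dots> = (w * x) ^ 2" by (simp add: power_mult_distrib z(5))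
  finally have "(w * x) ^ 2 = peval (sextic F3 F6) [1, x, t * x]" by simp
  with nz have p: "pt4 (w * x) 1 x (t * x) \<in> pts SF" unfolding pts_SF by blast
  have ct: "chart_t (pt4 (w * x) 1 x (t * x)) = t" using chart_t_pt4[OF nz] x by simp
  have "pt4 (w * x) 1 x (t * x) \<in> chart_dom" unfolding chart_dom_iff[OF nz] using x z(2) by simp
  then show "sigma_inv z \<in> S1" unfolding si S1_def using p ct z(3,4) by simp
  show "sigma (sigma_inv z) = z" unfolding si sigma_pt4[OF nz] unfolding z(1) using x by simp
  show "chart_t (sigma_inv z) = z ! 2" unfolding si ct unfolding z(1) by simp
qed

lemma morphism_sigma: "morphism (subspace_on SF S1) Wo sigma"
proof -
  have r: "reg (subspace_on SF S1) (pts (subspace_on SF S1)) c" if c: "reg (wproj_space w4) chart_dom c" for c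
  proof -
    have "reg SF (chart_dom \<inter> {pt4 s x0 x1 x2 | s x0 x1 x2. (s, x0, x1, x2) \<noteq> (0, 0, 0, 0) \<and>
      s ^ 2 = peval (sextic F3 F6) [x0, x1, x2]}) c" (is "reg SF ?O c")
      unfolding S_surface_def by (rule reg_subspaceI[OF ringed_wproj c])
    from reg_subspaceI[OF ringed_SF this, of S1] have "reg (subspace_on SF S1) (?O \<inter> S1) c" .
    moreover have "?O \<inter> S1 = pts (subspace_on SF S1)"
      using S1_subset unfolding zar_subspace topspace_subtopology pts_SF[symmetric] by (auto simp: S1_def)
    ultimately show ?thesis by simp
  qed
  have s: "(\<lambda>b. sigma b ! 0) = chart_w" "(\<lambda>b. sigma b ! 1) = chart_x" "(\<lambda>b. sigma b ! 2) = chart_t"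
    by (simp_all add: sigma_def fun_eq_iff numeral_2_eq_2)
  have "morphism (subspace_on SF S1) (affine_space 3) sigma"
  proof (rule morphism_affineI)
    fix i :: nat assume "i < 3"
    then consider "i = 0" | "i = 1" | "i = 2" by linarith
    then show "reg (subspace_on SF S1) (pts (subspace_on SF S1)) (\<lambda>b. sigma b ! i)"
    proof cases
      case 1 show ?thesis unfolding 1 s by (rule r[OF chart_regular(1)])
    next
      case 2 show ?thesis unfolding 2 s by (rule r[OF chart_regular(2)])
    next
      case 3 show ?thesis unfolding 3 s by (rule r[OF chart_regular(3)])
    qed
  qed (auto simp: sigma_def)
  then show ?thesis unfolding W_circ_def
    by (rule morphism_into_subspace[rotated]) (use sigma_pts(1) pts_Wo P_circ in auto)
qed

abbreviation Wx :: "complex list set" where "Wx \<equiv> {z \<in> pts Wo. z ! 1 \<noteq> 0}"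

lemma Wx_open: "openin (zar Wo) Wx"
  using ringed_nonzero[OF ringed_circ(1) morphism_affineD(2)[OF morphism_circ_affine(1), of 1]] by simp

lemma morphism_sigma_inv: "morphism (subspace_on Wo Wx) SF sigma_inv"
proof -
  let ?X = "subspace_on Wo Wx"
  have m: "morphism ?X (affine_space 3) (\<lambda>z. z)"
    by (rule morphism_restrict[OF ringed_circ(1) morphism_circ_affine(1)])
  note c = morphism_affineD(2)[OF m]
  have rX: "ringed ?X" by simp
  have pX: "pts ?X = Wx" by auto
  have "morphism ?X (wproj_space w4) (\<lambda>z. orbit w4 [z ! 0 * z ! 1, 1, z ! 1, z ! 2 * z ! 1])"
  proof (rule morphism_wprojI[OF rX])
    fix i assume "i < length w4"
    then consider "i = 0" | "i = 1" | "i = 2" | "i = 3" by fastforce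
    then show "reg ?X (pts ?X) (\<lambda>z. [z ! 0 * z ! 1, 1, z ! 1, z ! 2 * z ! 1] ! i)"
    proof cases
      case 1
      have "reg ?X (pts ?X) (\<lambda>z. z ! 0 * z ! 1)" by (rule ringed_mult[OF rX c c]) simp_all
      then show ?thesis using 1 by simp
    next
      case 2 then show ?thesis using ringed_const_pts[OF rX, of 1] by simp
    next
      case 3
      have "reg ?X (pts ?X) (\<lambda>z. z ! 1)" by (rule c) simp
      then show ?thesis using 3 by (simp add: numeral_2_eq_2)
    next
      case 4
      have "reg ?X (pts ?X) (\<lambda>z. z ! 2 * z ! 1)" by (rule ringed_mult[OF rX c c]) simp_all
      then show ?thesis using 4 by (simp add: numeral_3_eq_3)
    qed
  next
    show "[z ! 0 * z ! 1, 1, z ! 1, z ! 2 * z ! 1] \<in> nonzero_vecs (length w4)" for z :: "complex list"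
      unfolding nonzero_vecs_4 by simp
  qed
  then have "morphism ?X (wproj_space w4) sigma_inv" unfolding sigma_inv_def[abs_def] .
  moreover have "sigma_inv z \<in> pts SF" if "z \<in> pts ?X" for z
    using sigma_inv_pts(1) S1_subset that unfolding pX by blast
  ultimately show ?thesis unfolding S_surface_def
    by (intro morphism_into_subspace[OF rX]) (auto simp: pts_SF[unfolded S_surface_def])
qed

text \<open>Everything divides zero, so a zero form would make the product have multiple roots.\<close>

lemma forms_nonzero: "F3 \<noteq> 0" "F6 \<noteq> 0"
proof -
  have "no_multiple_roots (F3 * F6)" using V by (simp add: V_circ_def)
  then have "\<not> (Cst 0 * Var 1 - Cst 1 * Var 2) ^ 2 dvd F3 * F6"
    unfolding no_multiple_roots_def by (metis old.prod.inject zero_neq_one)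
  then have "F3 * F6 \<noteq> 0" by (metis dvd_0_right)
  then show "F3 \<noteq> 0" "F6 \<noteq> 0" by auto
qed

lemma good_parameter:
  obtains t where "t \<noteq> 0" "f3 t \<noteq> 0" "f6 t \<noteq> 0" "t \<noteq> t0"
proof -
  have fin: "finite ({t. f3 t = 0} \<union> {t. f6 t = 0} \<union> {0, t0})"
    using binary_form_finite_zeros[OF F3 forms_nonzero(1)] binary_form_finite_zeros[OF F6 forms_nonzero(2)] by simp
  obtain t where "t \<notin> {t. f3 t = 0} \<union> {t. f6 t = 0} \<union> {0, t0}"
    using ex_new_if_finite[OF infinite_UNIV_char_0 fin] by (rule exE)
  then show thesis by (intro that) auto
qed

lemma S1_nonempty: "{b \<in> S1. chart_t b \<noteq> t0} \<noteq> {}"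
proof -
  obtain t where t: "t \<noteq> 0" "f3 t \<noteq> 0" "f6 t \<noteq> 0" "t \<noteq> t0" by (rule good_parameter)
  have "[csqrt (f3 t + f6 t), 1, t] \<in> pts Wo" using t unfolding pts_Wo by simp
  then have "sigma_inv [csqrt (f3 t + f6 t), 1, t] \<in> {b \<in> S1. chart_t b \<noteq> t0}"
    using sigma_inv_pts(1,3)[of "[csqrt (f3 t + f6 t), 1, t]"] t by simp
  then show ?thesis by blast
qed

lemma pts_Cp: "pts (C_plane F3 F6) = {[y, t] | y t. y ^ 6 = f3 t ^ 2 * f6 t}"
  by (auto simp: C_plane_def)

lemma Co_open: "openin (zar (C_plane F3 F6)) (pts Co)" "openin (zar (C_plane F3 F6)) {z \<in> pts Co. z ! 1 \<noteq> t0}"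
proof -
  let ?X = "C_plane F3 F6"
  have c: "reg ?X (pts ?X) (\<lambda>z. z ! 1)" using morphism_affineD(2)[OF morphism_circ_affine(4), of 1] by simp
  have r: "reg ?X (pts ?X) (\<lambda>z. z ! 1 * f3 (z ! 1) * f6 (z ! 1))"
    by (intro ringed_mult ringed_dehom c ringed_circ binary_form_pvars[OF F3] binary_form_pvars[OF F6])
  have r': "reg ?X (pts ?X) (\<lambda>z. z ! 1 * f3 (z ! 1) * f6 (z ! 1) * (z ! 1 + (- t0)))"
    by (intro ringed_mult[OF ringed_circ(4) r] ringed_add ringed_const c ringed_circ openin_topspace)
  have "pts Co = {z \<in> pts ?X. z ! 1 * f3 (z ! 1) * f6 (z ! 1) \<noteq> 0}"
    unfolding pts_Co pts_Cp by auto
  then show "openin (zar ?X) (pts Co)" using ringed_nonzero[OF ringed_circ(4) r] by simp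
  have "{z \<in> pts Co. z ! 1 \<noteq> t0} = {z \<in> pts ?X. z ! 1 * f3 (z ! 1) * f6 (z ! 1) * (z ! 1 + (- t0)) \<noteq> 0}"
    unfolding pts_Co pts_Cp by auto
  then show "openin (zar ?X) {z \<in> pts Co. z ! 1 \<noteq> t0}" using ringed_nonzero[OF ringed_circ(4) r'] by simp
qed

lemma Co_nonempty: "{z \<in> pts Co. z ! 1 \<noteq> t0} \<noteq> {}"
proof -
  obtain t where t: "t \<noteq> 0" "f3 t \<noteq> 0" "f6 t \<noteq> 0" "t \<noteq> t0" by (rule good_parameter)
  obtain y where "f3 t ^ 2 * f6 t = y ^ 6" by (rule exists_complex_root[of 6 "f3 t ^ 2 * f6 t"]) simp
  then have "[y, t] \<in> {z \<in> pts Co. z ! 1 \<noteq> t0}" using t unfolding pts_Co by simp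
  then show ?thesis by blast
qed

lemma integral_model_Wo: "integral_model 2 (pts Wo)"
  unfolding integral_model_def
proof (intro exI conjI ballI)
  show "pvars (Var 1 * dehom_at 2 F3 + Var 1 ^ 4 * dehom_at 2 F6) \<subseteq> {1..2}"
    by (intro pvars_addI pvars_multI pvars_powerI order_trans[OF pvars_dehom_at]) auto
  fix xs assume "xs \<in> pts Wo"
  then show "xs ! 0 ^ 2 = peval (Var 1 * dehom_at 2 F3 + Var 1 ^ 4 * dehom_at 2 F6) xs"
    unfolding pts_Wo peval_add peval_mult peval_power peval_Var
      peval_dehom_at[OF binary_form_pvars[OF F3]] peval_dehom_at[OF binary_form_pvars[OF F6]] by auto
qed simp

lemma integral_model_Co: "integral_model 1 (pts Co)"
  unfolding integral_model_def
proof (intro exI conjI ballI)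
  show "pvars (dehom_at 1 F3 ^ 2 * dehom_at 1 F6) \<subseteq> {1..1}"
    by (intro pvars_addI pvars_multI pvars_powerI order_trans[OF pvars_dehom_at]) auto
  fix xs assume "xs \<in> pts Co"
  then show "xs ! 0 ^ 6 = peval (dehom_at 1 F3 ^ 2 * dehom_at 1 F6) xs"
    unfolding pts_Co peval_mult peval_power
      peval_dehom_at[OF binary_form_pvars[OF F3]] peval_dehom_at[OF binary_form_pvars[OF F6]] by auto
qed simp

end

section \<open>The birational map on the smooth models\<close>

lemma morphism_subspaceI:
  assumes "ringed X" "morphism X Y f" "\<And>x. x \<in> A \<Longrightarrow> x \<in> pts X \<Longrightarrow> f x \<in> B"
  shows "morphism (subspace_on X A) (subspace_on Y B) f"
  by (intro morphism_into_subspace morphism_restrict assms ringed_subspace) (use assms(3) in auto)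

lemma morphism_subspace_mono:
  assumes "ringed X" "A \<subseteq> B"
  shows "morphism (subspace_on X A) (subspace_on X B) (\<lambda>x. x)"
  by (rule morphism_subspaceI[OF assms(1) morphism_id[OF assms(1)]]) (use assms(2) in blast)

text \<open>A continuous image that meets every nonempty open set is dense.\<close>

lemma irreducible_image:
  assumes "irreducible_fs X" "openin (zar X) U" "morphism (subspace_on X U) Y f" "pts Y \<noteq> {}"
    and meets: "\<And>N. openin (zar Y) N \<Longrightarrow> N \<noteq> {} \<Longrightarrow> {x \<in> U. f x \<in> N} \<noteq> {}"
  shows "irreducible_fs Y"
  unfolding irreducible_fs_def
proof (intro conjI allI impI assms(4), elim conjE)
  fix N N' assume N: "openin (zar Y) N" "openin (zar Y) N'" "N \<noteq> {}" "N' \<noteq> {}"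
  have "{x \<in> U. f x \<in> N} \<inter> {x \<in> U. f x \<in> N'} \<noteq> {}"
    using assms(1) morphism_open_subspace[OF assms(3,2) N(1)] morphism_open_subspace[OF assms(3,2) N(2)]
      meets[OF N(1,3)] meets[OF N(2,4)] unfolding irreducible_fs_def by blast
  then show "N \<inter> N' \<noteq> {}" by blast
qed

lemma P1_avoid: "\<exists>t0. \<forall>t. t \<noteq> t0 \<longrightarrow> pt2 1 t \<noteq> p"
proof (cases "\<exists>t0. pt2 1 t0 = p")
  case True
  then obtain t0 where "pt2 1 t0 = p" by blast
  then have "pt2 1 t \<noteq> p" if "t \<noteq> t0" for t using pt2_inject[of t t0] that by metis
  then show ?thesis by blast
qed blast

lemma isomorphism_of_open_subspaces:
  assumes "ringed X" "ringed Y" "openin (zar X) U" "openin (zar Y) V"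
    "isomorphism (subspace_on X U) (subspace_on Y V) f"
  obtains g where "morphism (subspace_on X U) (subspace_on Y V) f" "morphism (subspace_on Y V) (subspace_on X U) g"
    "\<And>x. x \<in> U \<Longrightarrow> f x \<in> V" "\<And>y. y \<in> V \<Longrightarrow> g y \<in> U"
    "\<And>x. x \<in> U \<Longrightarrow> g (f x) = x" "\<And>y. y \<in> V \<Longrightarrow> f (g y) = y"
proof -
  have p: "pts (subspace_on X U) = U" "pts (subspace_on Y V) = V"
    using openin_subset[OF assms(3)] openin_subset[OF assms(4)] by auto
  from assms(5) obtain g where g: "morphism (subspace_on X U) (subspace_on Y V) f"
    "morphism (subspace_on Y V) (subspace_on X U) g"
    "\<And>x. x \<in> pts (subspace_on X U) \<Longrightarrow> g (f x) = x" "\<And>y. y \<in> pts (subspace_on Y V) \<Longrightarrow> f (g y) = y"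
    by (rule isomorphismE) blast
  note m = morphism_pts[OF g(1)] morphism_pts[OF g(2)]
  show thesis
    by (rule that[OF g(1,2)]) (use g(3,4) m in \<open>simp_all only: p\<close>)
qed

lemma projective_variety_ringed: "projective_variety X \<Longrightarrow> ringed X"
  by (auto simp: projective_variety_def proj_space_def)

lemma projective_variety_irreducible: "projective_variety X \<Longrightarrow> irreducible_fs X"
  by (auto simp: projective_variety_def)

lemma ringed_P1: "ringed P1"
  unfolding P1_wproj by (rule ringed_wproj)

text \<open>The three models with their birational maps \<open>\<rho>\<close>, \<open>\<phi>\<close>, \<open>\<psi>\<close> to the double plane and to the two
  affine curves; primed letters denote the inverses on the open sets of isomorphism.\<close>

locale model_data = sextic_pair +
  fixes W :: "complex list set fspace" and \<rho> \<rho>' \<pi> UW VS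
    and C :: "complex list set fspace" and \<phi> \<phi>' \<tau> UC VC
    and D :: "complex list set fspace" and \<psi> \<psi>' UD VD
  assumes W: "projective_variety W" "smooth_of_dim 2 W"
    and C: "projective_variety C" "smooth_of_dim 1 C"
    and D: "projective_variety D"
    and UW: "openin (zar W) UW" and VS: "dense_open (S_surface (sextic F3 F6)) VS"
    and UC: "openin (zar C) UC" and VC: "dense_open (C_plane F3 F6) VC"
    and UD: "openin (zar D) UD" and VD: "dense_open D_circ VD"
    and rho: "morphism W (S_surface (sextic F3 F6)) \<rho>"
    and rho_inv: "morphism (subspace_on (S_surface (sextic F3 F6)) VS) (subspace_on W UW) \<rho>'"
    and rho_in: "\<And>x. x \<in> UW \<Longrightarrow> \<rho> x \<in> VS" "\<And>b. b \<in> VS \<Longrightarrow> \<rho>' b \<in> UW"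
    and rho_eq: "\<And>x. x \<in> UW \<Longrightarrow> \<rho>' (\<rho> x) = x" "\<And>b. b \<in> VS \<Longrightarrow> \<rho> (\<rho>' b) = b"
    and phi: "morphism (subspace_on C UC) (subspace_on (C_plane F3 F6) VC) \<phi>"
    and phi_inv: "morphism (subspace_on (C_plane F3 F6) VC) (subspace_on C UC) \<phi>'"
    and phi_in: "\<And>x. x \<in> UC \<Longrightarrow> \<phi> x \<in> VC" "\<And>b. b \<in> VC \<Longrightarrow> \<phi>' b \<in> UC"
    and phi_eq: "\<And>x. x \<in> UC \<Longrightarrow> \<phi>' (\<phi> x) = x" "\<And>b. b \<in> VC \<Longrightarrow> \<phi> (\<phi>' b) = b"
    and psi: "morphism (subspace_on D UD) (subspace_on D_circ VD) \<psi>"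
    and psi_inv: "morphism (subspace_on D_circ VD) (subspace_on D UD) \<psi>'"
    and psi_in: "\<And>x. x \<in> UD \<Longrightarrow> \<psi> x \<in> VD" "\<And>b. b \<in> VD \<Longrightarrow> \<psi>' b \<in> UD"
    and psi_eq: "\<And>x. x \<in> UD \<Longrightarrow> \<psi>' (\<psi> x) = x" "\<And>b. b \<in> VD \<Longrightarrow> \<psi> (\<psi>' b) = b"
    and pi: "induced_fibration W \<rho> \<pi>"
    and tau: "induced_cover C \<phi> UC \<tau>"
begin

lemma ringed_models [simp]: "ringed W" "ringed C" "ringed D"
  using W C D by (simp_all add: projective_variety_ringed)

lemma irreducible_models: "irreducible_fs W" "irreducible_fs C" "irreducible_fs D"
  using W C D by (simp_all add: projective_variety_irreducible)

text \<open>The open part of \<open>W\<close> with affine coordinates \<open>wcoords\<close>, its image \<open>W_img\<close> in \<open>W\<^sup>\<circ>\<close> and the inverse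
  \<open>wpoint\<close> of the coordinate map.\<close>

definition Wgood where "Wgood = {a \<in> UW. \<rho> a \<in> S1}"

definition wcoords where "wcoords a = sigma (\<rho> a)"

definition W_img where "W_img = {z \<in> Wx. sigma_inv z \<in> VS}"

definition wpoint where "wpoint z = \<rho>' (sigma_inv z)"

lemma VS_open: "openin (zar SF) VS" and VC_open: "openin (zar (C_plane F3 F6)) VC" and VD_open: "openin (zar D_circ) VD"
  using VS VC VD dense_open_openin by blast+

lemma Wgood_open: "openin (zar W) Wgood"
proof -
  have "Wgood = UW \<inter> {a \<in> pts W. \<rho> a \<in> S1}" using openin_subset[OF UW] by (auto simp: Wgood_def)
  then show ?thesis using openin_Int[OF UW morphism_openin[OF rho S1_open(1)]] by simp
qed

lemma morphism_wcoords: "morphism (subspace_on W Wgood) Wo wcoords"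
proof -
  have "morphism (subspace_on W Wgood) (subspace_on SF S1) \<rho>"
    by (rule morphism_subspaceI[OF ringed_models(1) rho]) (auto simp: Wgood_def)
  from morphism_compose[OF this morphism_sigma] show ?thesis unfolding wcoords_def[abs_def] .
qed

lemma W_img_open: "openin (zar Wo) W_img"
  unfolding W_img_def by (rule morphism_open_subspace[OF morphism_sigma_inv Wx_open VS_open])

lemma W_img_subset: "W_img \<subseteq> pts Wo"
  by (auto simp: W_img_def)

lemma morphism_wpoint: "morphism (subspace_on Wo W_img) W wpoint"
proof -
  have "morphism (subspace_on Wo W_img) (subspace_on Wo Wx) (\<lambda>z. z)"
    by (rule morphism_subspace_mono) (auto simp: W_img_def)
  from morphism_compose[OF this morphism_sigma_inv]
  have "morphism (subspace_on Wo W_img) (subspace_on SF VS) sigma_inv"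
    by (intro morphism_into_subspace) (auto simp: W_img_def)
  from morphism_compose[OF this rho_inv] have "morphism (subspace_on Wo W_img) (subspace_on W UW) wpoint"
    unfolding wpoint_def[abs_def] .
  then show ?thesis by (rule morphism_from_subspace[OF ringed_models(1)])
qed

lemma wcoords_in: "a \<in> Wgood \<Longrightarrow> wcoords a \<in> W_img"
  using sigma_pts sigma_inv_sigma rho_in(1) by (auto simp: Wgood_def W_img_def wcoords_def)

lemma wpoint_wcoords: "a \<in> Wgood \<Longrightarrow> wpoint (wcoords a) = a"
  using sigma_inv_sigma rho_eq(1) by (auto simp: Wgood_def wpoint_def wcoords_def)

lemma wpoint_in: "z \<in> W_img \<Longrightarrow> wpoint z \<in> Wgood"
  using sigma_inv_pts(1) rho_in(2) rho_eq(2) by (auto simp: Wgood_def W_img_def wpoint_def)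

lemma wcoords_wpoint: "z \<in> W_img \<Longrightarrow> wcoords (wpoint z) = z"
  using sigma_inv_pts(2) rho_eq(2) by (auto simp: W_img_def wpoint_def wcoords_def)

lemma pi_wcoords:
  assumes "a \<in> Wgood"
  shows "\<pi> a = t_proj (wcoords a)" "double_plane_coords (\<rho> a) (wcoords a)"
proof -
  have "\<rho> a \<in> S1" "a \<in> pts W" using assms openin_subset[OF Wgood_open] by (auto simp: Wgood_def)
  from this(1) obtain s x0 x1 x2 where b: "\<rho> a = pt4 s x0 x1 x2" "x0 \<noteq> 0" "x1 \<noteq> 0" "x2 \<noteq> 0"
    "f3 (x2 / x1) \<noteq> 0" "f6 (x2 / x1) \<noteq> 0" "s ^ 2 = x0 ^ 3 * (x1 ^ 3 * f3 (x2 / x1)) + x1 ^ 6 * f6 (x2 / x1)"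
    "sigma (\<rho> a) = [s / (x0 ^ 2 * x1), x1 / x0, x2 / x1]" by (rule S1_E)
  have "\<pi> a = pt2 x1 x2"
    using pi \<open>a \<in> pts W\<close> b(1,3) unfolding induced_fibration_def by blast
  also have "\<dots> = t_proj (wcoords a)" using pt2_normal[OF b(3), of x2] unfolding wcoords_def b(8) t_proj_def by simp
  finally show "\<pi> a = t_proj (wcoords a)" .
  show "double_plane_coords (\<rho> a) (wcoords a)"
    unfolding double_plane_coords_def wcoords_def using b by blast
qed

definition Cgood where "Cgood = {c \<in> UC. \<phi> c \<in> pts Co}"

definition C_img where "C_img = pts Co \<inter> VC"

lemma morphism_phi: "morphism (subspace_on C UC) (C_plane F3 F6) \<phi>"
  by (rule morphism_from_subspace[OF _ phi]) simp

lemma Cgood_open: "openin (zar C) Cgood"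
  unfolding Cgood_def by (rule morphism_open_subspace[OF morphism_phi UC Co_open(1)])

lemma morphism_phi_Co: "morphism (subspace_on C Cgood) Co \<phi>"
proof -
  have "morphism (subspace_on C Cgood) (subspace_on C UC) (\<lambda>c. c)"
    by (rule morphism_subspace_mono) (auto simp: Cgood_def)
  from morphism_compose[OF morphism_compose[OF this morphism_phi] morphism_circ_affine(4)]
  have "morphism (subspace_on C Cgood) (affine_space 2) \<phi>" .
  then have "morphism (subspace_on C Cgood) (subspace_on (affine_space 2)
     {[y, t] | y t. pt2 1 t \<in> P_circ F3 F6 \<and> y ^ 6 = f3 t ^ 2 * f6 t}) \<phi>"
    by (rule morphism_into_subspace[rotated]) (auto simp: Cgood_def C_circ_def)
  then show ?thesis unfolding C_circ_def .
qed

lemma tau_phi: "c \<in> Cgood \<Longrightarrow> \<tau> c = t_proj (\<phi> c)"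
  using tau by (auto simp: induced_cover_def Cgood_def)

lemma morphism_pi: "morphism W P1 \<pi>" and morphism_tau: "morphism C P1 \<tau>"
  using pi tau by (auto simp: induced_fibration_def induced_cover_def)

text \<open>The image of \<open>Wgood\<close> in the line is not a single point: the set where \<open>\<rho>\<close> is invertible is dense in
  the double plane and meets the nonempty open set where \<open>t\<close> differs from a given value.\<close>

lemma Wgood_avoid: "{a \<in> Wgood. \<pi> a \<noteq> p} \<noteq> {}"
proof -
  obtain t0 where t0: "\<And>t. t \<noteq> t0 \<Longrightarrow> pt2 1 t \<noteq> p" using P1_avoid by blast
  have "VS \<inter> {b \<in> S1. chart_t b \<noteq> t0} \<noteq> {}"
    by (rule dense_openD[OF VS S1_open(2) S1_nonempty])
  then obtain b where b: "b \<in> VS" "b \<in> S1" "chart_t b \<noteq> t0" by blast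
  then have a: "\<rho>' b \<in> Wgood" using rho_in(2) rho_eq(2) by (simp add: Wgood_def)
  have "\<pi> (\<rho>' b) = pt2 1 (chart_t b)"
    unfolding pi_wcoords(1)[OF a] by (simp add: t_proj_def wcoords_def rho_eq(2)[OF b(1)] sigma_def)
  with t0[OF b(3)] a show ?thesis by auto
qed

lemma Cgood_avoid: "{c \<in> Cgood. \<tau> c \<noteq> p} \<noteq> {}"
proof -
  obtain t0 where t0: "\<And>t. t \<noteq> t0 \<Longrightarrow> pt2 1 t \<noteq> p" using P1_avoid by blast
  have "VC \<inter> {z \<in> pts Co. z ! 1 \<noteq> t0} \<noteq> {}"
    by (rule dense_openD[OF VC Co_open(2) Co_nonempty])
  then obtain z where z: "z \<in> VC" "z \<in> pts Co" "z ! 1 \<noteq> t0" by blast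
  then have c: "\<phi>' z \<in> Cgood" using phi_in(2) phi_eq(2) by (simp add: Cgood_def)
  have "last z = z ! 1" using z(2) unfolding pts_Co by auto
  then have "\<tau> (\<phi>' z) = pt2 1 (z ! 1)"
    unfolding tau_phi[OF c] by (simp add: t_proj_def phi_eq(2)[OF z(1)])
  with t0[OF z(3)] c show ?thesis by auto
qed

lemma alg_dim_W: "alg_dim_le 2 W"
proof (rule alg_dim_le_model[OF ringed_models(1) irreducible_models(1) _ integral_model_Wo])
  have e': "morphism (subspace_on W Wgood) (affine_space 3) wcoords"
    using morphism_compose[OF morphism_wcoords morphism_circ_affine(1)] .
  have "morphism (subspace_on (affine_space 3) W_img) Wo (\<lambda>z. z)"
    unfolding W_circ_def
    by (rule morphism_subspace_mono[OF ringed_affine]) (use W_img_subset in \<open>auto simp: W_circ_def\<close>)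
  then have "morphism (subspace_on (affine_space 3) W_img) (subspace_on Wo W_img) (\<lambda>z. z)"
    by (rule morphism_into_subspace[rotated]) auto
  from morphism_compose[OF this morphism_wpoint]
  have "rational_chart W Wgood 3 wcoords"
    using Wgood_avoid by (intro rational_chartI[OF ringed_models(1) Wgood_open _ e' _ wcoords_in wpoint_wcoords]) auto
  then show "rational_chart W Wgood (Suc 2) wcoords" by (simp add: numeral_3_eq_3)
  show "wcoords a \<in> pts Wo" if "a \<in> Wgood" for a using wcoords_in[OF that] W_img_subset by blast
qed

lemma alg_dim_C: "alg_dim_le 1 C"
proof (rule alg_dim_le_model[OF ringed_models(2) irreducible_models(2) _ integral_model_Co])
  have e': "morphism (subspace_on C Cgood) (affine_space 2) \<phi>"
    using morphism_compose[OF morphism_phi_Co morphism_circ_affine(2)] .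
  have "morphism (subspace_on (affine_space 2) C_img) (C_plane F3 F6) (\<lambda>z. z)"
    unfolding C_plane_def
    by (rule morphism_subspace_mono[OF ringed_affine]) (use pts_Co in \<open>auto simp: C_img_def\<close>)
  then have "morphism (subspace_on (affine_space 2) C_img) (subspace_on (C_plane F3 F6) VC) (\<lambda>z. z)"
    by (rule morphism_into_subspace[rotated]) (auto simp: C_img_def)
  from morphism_from_subspace[OF ringed_models(2) morphism_compose[OF this phi_inv]]
  have m: "morphism (subspace_on (affine_space 2) C_img) C \<phi>'" .
  have "rational_chart C Cgood 2 \<phi>"
  proof (rule rational_chartI[OF ringed_models(2) Cgood_open _ e' m])
    show "Cgood \<noteq> {}" using Cgood_avoid by blast
    show "\<phi> c \<in> C_img" if "c \<in> Cgood" for c using that phi_in(1) by (simp add: Cgood_def C_img_def)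
    show "\<phi>' (\<phi> c) = c" if "c \<in> Cgood" for c using that phi_eq(1) by (simp add: Cgood_def)
  qed
  then show "rational_chart C Cgood (Suc 1) \<phi>" by (simp add: numeral_2_eq_2)
  show "\<phi> c \<in> pts Co" if "c \<in> Cgood" for c using that by (simp add: Cgood_def)
qed

abbreviation WC where "WC \<equiv> fibre_product W \<pi> C \<tau>"

text \<open>\<open>\<Omega>1\<close> consists of the points at which both factors have affine coordinates, which are collected in
  \<open>\<theta>\<close>; \<open>\<Theta>\<close> is the point of \<open>D\<^sup>\<circ>\<close> that \<open>kappa\<close> attaches to them, and on \<open>\<Omega>\<close> this point comes from \<open>D\<close>.\<close>

definition \<Omega>1 where "\<Omega>1 = {\<omega> \<in> pts WC. fst \<omega> \<in> Wgood \<and> snd \<omega> \<in> Cgood}"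

definition \<theta> where "\<theta> \<omega> = (wcoords (fst \<omega>), \<phi> (snd \<omega>))"

definition \<Theta> where "\<Theta> \<omega> = kappa1 (\<theta> \<omega>)"

lemma pts_WC: "pts WC = {(a, c). a \<in> pts W \<and> c \<in> pts C \<and> \<pi> a = \<tau> c}"
  by (rule pts_fibre_product) simp_all

lemma ringed_WC [simp]: "ringed WC"
  by simp

lemma WC_fst: "morphism WC W fst" and WC_snd: "morphism WC C snd"
  by (simp_all add: morphism_fibre_product_fst morphism_fibre_product_snd)

lemma \<Omega>1_open: "openin (zar WC) \<Omega>1"
proof -
  have "\<Omega>1 = {\<omega> \<in> pts WC. fst \<omega> \<in> Wgood} \<inter> {\<omega> \<in> pts WC. snd \<omega> \<in> Cgood}" by (auto simp: \<Omega>1_def)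
  then show ?thesis
    using openin_Int[OF morphism_openin[OF WC_fst Wgood_open] morphism_openin[OF WC_snd Cgood_open]] by simp
qed

lemma \<theta>_pts: "\<omega> \<in> \<Omega>1 \<Longrightarrow> \<theta> \<omega> \<in> pts WCo"
proof -
  assume \<omega>: "\<omega> \<in> \<Omega>1"
  then have *: "fst \<omega> \<in> Wgood" "snd \<omega> \<in> Cgood" "\<pi> (fst \<omega>) = \<tau> (snd \<omega>)"
    by (auto simp: \<Omega>1_def pts_WC)
  then have "t_proj (wcoords (fst \<omega>)) = t_proj (\<phi> (snd \<omega>))" using pi_wcoords(1) tau_phi by simp
  moreover have "wcoords (fst \<omega>) \<in> pts Wo" using wcoords_in[OF *(1)] W_img_subset by blast
  moreover have "\<phi> (snd \<omega>) \<in> pts Co" using *(2) by (simp add: Cgood_def)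
  ultimately show "\<theta> \<omega> \<in> pts WCo" by (simp add: \<theta>_def pts_fibre_product)
qed

lemma morphism_\<theta>: "morphism (subspace_on WC \<Omega>1) WCo \<theta>"
  unfolding \<theta>_def[abs_def]
proof (rule morphism_fibre_productI)
  have "morphism (subspace_on WC \<Omega>1) (subspace_on W Wgood) fst"
    by (rule morphism_subspaceI[OF ringed_WC WC_fst]) (auto simp: \<Omega>1_def)
  from morphism_compose[OF this morphism_wcoords] show "morphism (subspace_on WC \<Omega>1) Wo (\<lambda>\<omega>. wcoords (fst \<omega>))" .
  have "morphism (subspace_on WC \<Omega>1) (subspace_on C Cgood) snd"
    by (rule morphism_subspaceI[OF ringed_WC WC_snd]) (auto simp: \<Omega>1_def)
  from morphism_compose[OF this morphism_phi_Co] show "morphism (subspace_on WC \<Omega>1) Co (\<lambda>\<omega>. \<phi> (snd \<omega>))" .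
  fix \<omega> assume "\<omega> \<in> pts (subspace_on WC \<Omega>1)"
  then have "\<theta> \<omega> \<in> pts WCo" by (intro \<theta>_pts) simp
  then show "t_proj (wcoords (fst \<omega>)) = t_proj (\<phi> (snd \<omega>))" by (simp add: \<theta>_def pts_fibre_product)
qed simp_all

lemma morphism_\<Theta>: "morphism (subspace_on WC \<Omega>1) D_circ \<Theta>"
  using morphism_compose[OF morphism_\<theta> morphism_kappa1] unfolding \<Theta>_def[abs_def] .

definition \<Omega> where "\<Omega> = {\<omega> \<in> \<Omega>1. \<Theta> \<omega> \<in> VD}"

lemma \<Omega>_open: "openin (zar WC) \<Omega>"
  unfolding \<Omega>_def by (rule morphism_open_subspace[OF morphism_\<Theta> \<Omega>1_open VD_open])

abbreviation DC where "DC \<equiv> D_circ \<times>\<^sub>v C"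

text \<open>In the opposite direction: \<open>lift\<close> is the inverse of \<open>kappa\<close> in affine coordinates and \<open>\<Lambda>\<close> the
  resulting map to \<open>W \<times>\<^sub>P C\<close>, defined on the open set \<open>\<Omega>2\<close>.  Points of \<open>C\<close> rather than \<open>C\<^sup>\<circ>\<close> are used for
  the second component, since it is not changed.\<close>

definition lift where "lift z = lambda1 (fst z, \<phi> (snd z))"

definition \<Omega>2 where "\<Omega>2 = {z \<in> pts D_circ \<times> Cgood. lift z \<in> W_img}"

definition \<Lambda> where "\<Lambda> z = (wpoint (lift z), snd z)"

lemma ringed_DC [simp]: "ringed DC" "ringed (D \<times>\<^sub>v C)"
  by (simp_all add: ringed_fprod)

lemma morphism_lift:
  assumes "A \<subseteq> pts D_circ \<times> Cgood"
  shows "morphism (subspace_on DC A) Wo lift"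
proof -
  have "morphism (subspace_on DC A) (subspace_on C Cgood) snd"
    by (rule morphism_subspaceI[OF ringed_DC(1) morphism_snd]) (use assms in auto)
  note s = morphism_compose[OF this morphism_phi_Co]
  have f: "morphism (subspace_on DC A) D_circ fst"
    by (rule morphism_restrict[OF ringed_DC(1) morphism_fst]) simp_all
  have "morphism (subspace_on DC A) (D_circ \<times>\<^sub>v Co) (\<lambda>z. (fst z, \<phi> (snd z)))"
    by (rule morphism_pair[OF _ _ _ f s]) simp_all
  from morphism_compose[OF this morphism_lambda1] show ?thesis unfolding lift_def[abs_def] .
qed

lemma \<Omega>2_open: "openin (zar DC) \<Omega>2"
  unfolding \<Omega>2_def
  by (rule morphism_open_subspace[OF morphism_lift[OF order_refl] openin_times[OF _ _ openin_topspace Cgood_open] W_img_open])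
     simp_all

lemma \<Omega>2_pts: "z \<in> \<Omega>2 \<Longrightarrow> (fst z, \<phi> (snd z)) \<in> pts (D_circ \<times>\<^sub>v Co)"
  by (auto simp: \<Omega>2_def Cgood_def pts_fprod)

lemma \<Lambda>_in:
  assumes "z \<in> \<Omega>2"
  shows "\<Lambda> z \<in> \<Omega>1" "\<Theta> (\<Lambda> z) = fst z"
proof -
  have z: "lift z \<in> W_img" "snd z \<in> Cgood" using assms by (auto simp: \<Omega>2_def)
  have gW: "wpoint (lift z) \<in> Wgood" "wcoords (wpoint (lift z)) = lift z" using wpoint_in[OF z(1)] wcoords_wpoint[OF z(1)] by auto
  have "(lift z, \<phi> (snd z)) \<in> pts WCo"
    using lambda1_pts(2)[OF \<Omega>2_pts[OF assms]] by (simp add: lift_def)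
  then have "t_proj (lift z) = t_proj (\<phi> (snd z))" by (simp add: pts_fibre_product)
  then have "\<pi> (wpoint (lift z)) = \<tau> (snd z)" using pi_wcoords(1)[OF gW(1)] gW(2) tau_phi[OF z(2)] by simp
  moreover have "wpoint (lift z) \<in> pts W" "snd z \<in> pts C"
    using gW(1) z(2) openin_subset[OF Wgood_open] openin_subset[OF Cgood_open] by auto
  ultimately show "\<Lambda> z \<in> \<Omega>1" using gW z by (simp add: \<Omega>1_def \<Lambda>_def pts_WC)
  have "\<Theta> (\<Lambda> z) = kappa1 (lambda1 (fst z, \<phi> (snd z)), snd (fst z, \<phi> (snd z)))"
    by (simp add: \<Theta>_def \<theta>_def \<Lambda>_def gW(2)) (simp add: lift_def)
  also have "\<dots> = fst (fst z, \<phi> (snd z))" by (rule kappa_lambda[OF \<Omega>2_pts[OF assms]])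
  finally show "\<Theta> (\<Lambda> z) = fst z" by simp
qed

lemma \<Lambda>_\<Theta>:
  assumes "\<omega> \<in> \<Omega>1"
  shows "(\<Theta> \<omega>, snd \<omega>) \<in> \<Omega>2" "\<Lambda> (\<Theta> \<omega>, snd \<omega>) = \<omega>"
proof -
  have *: "fst \<omega> \<in> Wgood" "snd \<omega> \<in> Cgood" using assms by (auto simp: \<Omega>1_def)
  have "lift (\<Theta> \<omega>, snd \<omega>) = lambda1 (kappa1 (\<theta> \<omega>), snd (\<theta> \<omega>))" by (simp add: lift_def \<Theta>_def \<theta>_def)
  also have "\<dots> = wcoords (fst \<omega>)" using lambda_kappa[OF \<theta>_pts[OF assms]] by (simp add: \<theta>_def)
  finally have le: "lift (\<Theta> \<omega>, snd \<omega>) = wcoords (fst \<omega>)" .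
  have "\<Theta> \<omega> \<in> pts D_circ" unfolding \<Theta>_def by (rule kappa1_pts[OF \<theta>_pts[OF assms]])
  with * le wcoords_in show "(\<Theta> \<omega>, snd \<omega>) \<in> \<Omega>2" by (simp add: \<Omega>2_def del: zar_subspace)
  show "\<Lambda> (\<Theta> \<omega>, snd \<omega>) = \<omega>" using le wpoint_wcoords[OF *(1)] by (simp add: \<Lambda>_def)
qed

lemma morphism_\<Lambda>: "morphism (subspace_on DC \<Omega>2) WC \<Lambda>"
  unfolding \<Lambda>_def[abs_def]
proof (rule morphism_fibre_productI)
  have "morphism (subspace_on DC \<Omega>2) (subspace_on Wo W_img) lift"
    by (rule morphism_into_subspace[OF ringed_subspace[OF ringed_DC(1)] morphism_lift]) (auto simp: \<Omega>2_def)
  from morphism_compose[OF this morphism_wpoint] show "morphism (subspace_on DC \<Omega>2) W (\<lambda>z. wpoint (lift z))" .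
  show "morphism (subspace_on DC \<Omega>2) C snd"
    by (rule morphism_restrict[OF ringed_DC(1) morphism_snd]) simp_all
  show "\<pi> (wpoint (lift z)) = \<tau> (snd z)" if "z \<in> pts (subspace_on DC \<Omega>2)" for z
    using \<Lambda>_in(1)[of z] that by (simp add: \<Lambda>_def \<Omega>1_def pts_WC)
qed simp_all

text \<open>By \<open>fibre_product_meets\<close> every nonempty open set meets \<open>\<Omega>1\<close>, and by continuity of \<open>\<Lambda>\<close> it
  contains all points obtained from a nonempty open set of points of \<open>D\<^sup>\<circ>\<close>, one of which is in \<open>VD\<close>.\<close>

lemma \<Omega>_dense: "dense_open WC \<Omega>"
proof (rule dense_openI[OF \<Omega>_open])
  fix N assume N: "openin (zar WC) N" "N \<noteq> {}"
  have "\<exists>a c. (a, c) \<in> N \<and> a \<in> Wgood \<and> c \<in> Cgood"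
    by (rule fibre_product_meets[OF ringed_models(1,2) ringed_P1 has_charts_P1 irreducible_models(1) W(2) alg_dim_W
      irreducible_models(2) C(2) alg_dim_C morphism_pi morphism_tau Wgood_open Wgood_avoid Cgood_open Cgood_avoid N])
  then obtain a c where ac: "(a, c) \<in> N" "a \<in> Wgood" "c \<in> Cgood" by blast
  then have \<omega>: "(a, c) \<in> \<Omega>1" using openin_subset[OF N(1)] by (auto simp: \<Omega>1_def)
  \<comment> \<open>vary the point of \<open>D\<close> while keeping \<open>c\<close> fixed\<close>
  have cC: "c \<in> pts C" using ac(3) openin_subset[OF Cgood_open] by blast
  have slice: "morphism D_circ DC (\<lambda>p. (p, c))"
    by (intro morphism_pair morphism_id morphism_const cC) simp_all
  let ?S = "{p \<in> pts D_circ. (p, c) \<in> \<Omega>2}"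
  have S: "openin (zar D_circ) ?S" by (rule morphism_openin[OF slice \<Omega>2_open])
  have "morphism (subspace_on D_circ ?S) (subspace_on DC \<Omega>2) (\<lambda>p. (p, c))"
    by (rule morphism_subspaceI[OF _ slice]) simp_all
  from morphism_open_subspace[OF morphism_compose[OF this morphism_\<Lambda>] S N(1)]
  have o: "openin (zar D_circ) {p \<in> ?S. \<Lambda> (p, c) \<in> N}" .
  have "\<Theta> (a, c) \<in> {p \<in> ?S. \<Lambda> (p, c) \<in> N}"
    using \<Lambda>_\<Theta>[OF \<omega>] ac(1) by (auto simp: \<Omega>2_def)
  then have "VD \<inter> {p \<in> ?S. \<Lambda> (p, c) \<in> N} \<noteq> {}" by (intro dense_openD[OF VD o]) blast
  then obtain p where p: "p \<in> VD" "(p, c) \<in> \<Omega>2" "\<Lambda> (p, c) \<in> N" by blast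
  then have "\<Lambda> (p, c) \<in> \<Omega>" using \<Lambda>_in[OF p(2)] by (simp add: \<Omega>_def)
  with p(3) show "\<Omega> \<inter> N \<noteq> {}" by blast
qed

definition \<Omega>' where "\<Omega>' = {z \<in> UD \<times> pts C. (\<psi> (fst z), snd z) \<in> \<Omega>2}"

definition kappa_model where "kappa_model \<omega> = (\<psi>' (\<Theta> \<omega>), snd \<omega>)"

definition kappa_model_inv where "kappa_model_inv z = \<Lambda> (\<psi> (fst z), snd z)"

lemma morphism_psi_C:
  assumes "A \<subseteq> UD \<times> pts C"
  shows "morphism (subspace_on (D \<times>\<^sub>v C) A) DC (\<lambda>z. (\<psi> (fst z), snd z))"
proof (rule morphism_pair)
  have "morphism (subspace_on (D \<times>\<^sub>v C) A) (subspace_on D UD) fst"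
    by (rule morphism_subspaceI[OF ringed_DC(2) morphism_fst]) (use assms in auto)
  from morphism_from_subspace[OF _ morphism_compose[OF this psi]]
  show "morphism (subspace_on (D \<times>\<^sub>v C) A) D_circ (\<lambda>z. \<psi> (fst z))" by simp
  show "morphism (subspace_on (D \<times>\<^sub>v C) A) C snd"
    by (rule morphism_restrict[OF ringed_DC(2) morphism_snd]) simp_all
qed simp_all

lemma \<Omega>'_open: "openin (zar (D \<times>\<^sub>v C)) \<Omega>'"
  unfolding \<Omega>'_def
  by (rule morphism_open_subspace[OF morphism_psi_C[OF order_refl] openin_times[OF _ _ UD openin_topspace] \<Omega>2_open])
     simp_all

lemma kappa_model_in: "\<omega> \<in> \<Omega> \<Longrightarrow> kappa_model \<omega> \<in> \<Omega>'"
  using psi_in(2) psi_eq(2) \<Lambda>_\<Theta>(1) by (auto simp: kappa_model_def \<Omega>_def \<Omega>'_def \<Omega>1_def pts_WC)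

lemma kappa_model_inv_in: "z \<in> \<Omega>' \<Longrightarrow> kappa_model_inv z \<in> \<Omega>"
  using \<Lambda>_in[of "(\<psi> (fst z), snd z)"] psi_in(1) by (auto simp: kappa_model_inv_def \<Omega>_def \<Omega>'_def)

lemma kappa_model_inv_kappa_model: "\<omega> \<in> \<Omega> \<Longrightarrow> kappa_model_inv (kappa_model \<omega>) = \<omega>"
  using \<Lambda>_\<Theta>(2) psi_eq(2) by (auto simp: kappa_model_inv_def kappa_model_def \<Omega>_def)

lemma kappa_model_kappa_model_inv: "z \<in> \<Omega>' \<Longrightarrow> kappa_model (kappa_model_inv z) = z"
  using \<Lambda>_in(2)[of "(\<psi> (fst z), snd z)"] psi_eq(1) by (auto simp: kappa_model_inv_def kappa_model_def \<Omega>'_def \<Lambda>_def)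

lemma morphism_kappa_model: "morphism (subspace_on WC \<Omega>) (subspace_on (D \<times>\<^sub>v C) \<Omega>') kappa_model"
proof (rule morphism_into_subspace)
  have "morphism (subspace_on WC \<Omega>) (subspace_on WC \<Omega>1) (\<lambda>\<omega>. \<omega>)"
    by (rule morphism_subspace_mono) (auto simp: \<Omega>_def)
  from morphism_compose[OF this morphism_\<Theta>] have "morphism (subspace_on WC \<Omega>) (subspace_on D_circ VD) \<Theta>"
    by (intro morphism_into_subspace) (auto simp: \<Omega>_def)
  from morphism_from_subspace[OF ringed_models(3) morphism_compose[OF this psi_inv]]
  have "morphism (subspace_on WC \<Omega>) D (\<lambda>\<omega>. \<psi>' (\<Theta> \<omega>))" .
  moreover have "morphism (subspace_on WC \<Omega>) C snd"
    by (rule morphism_restrict[OF ringed_WC WC_snd])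
  ultimately show "morphism (subspace_on WC \<Omega>) (D \<times>\<^sub>v C) kappa_model"
    unfolding kappa_model_def[abs_def] by (intro morphism_pair) simp_all
  show "kappa_model \<omega> \<in> \<Omega>'" if "\<omega> \<in> pts (subspace_on WC \<Omega>)" for \<omega> using that kappa_model_in by simp
qed simp

lemma morphism_kappa_model_inv: "morphism (subspace_on (D \<times>\<^sub>v C) \<Omega>') (subspace_on WC \<Omega>) kappa_model_inv"
proof (rule morphism_into_subspace)
  have "morphism (subspace_on (D \<times>\<^sub>v C) \<Omega>') (subspace_on DC \<Omega>2) (\<lambda>z. (\<psi> (fst z), snd z))"
    by (intro morphism_into_subspace morphism_psi_C) (auto simp: \<Omega>'_def)
  from morphism_compose[OF this morphism_\<Lambda>]
  show "morphism (subspace_on (D \<times>\<^sub>v C) \<Omega>') WC kappa_model_inv" unfolding kappa_model_inv_def[abs_def] .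
  show "kappa_model_inv z \<in> \<Omega>" if "z \<in> pts (subspace_on (D \<times>\<^sub>v C) \<Omega>')" for z using that kappa_model_inv_in by simp
qed simp

lemma irreducible_D_circ: "irreducible_fs D_circ"
proof (rule irreducible_image[OF irreducible_models(3) UD morphism_from_subspace[OF _ psi]])
  have "[0, 0] \<in> pts D_circ" unfolding pts_Do by simp
  then show "pts D_circ \<noteq> {}" by blast
  fix N assume "openin (zar D_circ) N" "N \<noteq> {}"
  from dense_openD[OF VD this] obtain b where "b \<in> VD" "b \<in> N" by blast
  then have "\<psi>' b \<in> {x \<in> UD. \<psi> x \<in> N}" using psi_in(2) psi_eq(2) by simp
  then show "{x \<in> UD. \<psi> x \<in> N} \<noteq> {}" by blast
qed simp

lemma irreducible_Co: "irreducible_fs Co"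
proof (rule irreducible_image[OF irreducible_models(2) Cgood_open morphism_phi_Co])
  show "pts Co \<noteq> {}" using Co_nonempty by blast
  fix N assume N: "openin (zar Co) N" "N \<noteq> {}"
  have "morphism (subspace_on (C_plane F3 F6) (pts Co)) (subspace_on (affine_space 2)
     {[y, t] | y t. pt2 1 t \<in> P_circ F3 F6 \<and> y ^ 6 = f3 t ^ 2 * f6 t}) (\<lambda>z. z)"
    by (rule morphism_subspaceI[OF ringed_circ(4) morphism_circ_affine(4)]) (auto simp: C_circ_def)
  then have "morphism (subspace_on (C_plane F3 F6) (pts Co)) Co (\<lambda>z. z)" unfolding C_circ_def .
  from morphism_open_subspace[OF this Co_open(1) N(1)]
  have "openin (zar (C_plane F3 F6)) {z \<in> pts Co. z \<in> N}" .
  moreover have "{z \<in> pts Co. z \<in> N} = N" using openin_subset[OF N(1)] by blast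
  ultimately have "openin (zar (C_plane F3 F6)) N" by simp
  from dense_openD[OF VC this N(2)] obtain b where b: "b \<in> VC" "b \<in> N" by blast
  then have "b \<in> pts Co" using openin_subset[OF N(1)] by blast
  with b have "\<phi>' b \<in> {x \<in> Cgood. \<phi> x \<in> N}" using phi_in(2) phi_eq(2) by (simp add: Cgood_def)
  then show "{x \<in> Cgood. \<phi> x \<in> N} \<noteq> {}" by blast
qed

text \<open>A point of \<open>Wgood\<close> and one of \<open>Cgood\<close> over the same \<open>t\<close> are needed.  Through \<open>kappa\<close> the two conditions
  become open conditions on the irreducible space \<open>D\<^sup>\<circ> \<times> C\<^sup>\<circ>\<close>, and each can be satisfied
  separately: the first because \<open>C\<^sup>\<circ>\<close> has a point over each \<open>t\<close> in \<open>P\<^sup>\<circ>\<close>, the second trivially.\<close>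

lemma \<Omega>2_nonempty: "\<Omega>2 \<noteq> {}"
proof -
  let ?X = "D_circ \<times>\<^sub>v Co"
  have "morphism Co (subspace_on (affine_space 2) {[y, t] | y t. y ^ 6 = f3 t ^ 2 * f6 t}) (\<lambda>z. z)"
    by (rule morphism_into_subspace[OF ringed_circ(2) morphism_circ_affine(2)]) (use pts_Co in auto)
  then have "morphism Co (C_plane F3 F6) (\<lambda>z. z)" unfolding C_plane_def .
  from morphism_compose[OF morphism_snd[of D_circ Co] this] have s: "morphism ?X (C_plane F3 F6) snd" by simp
  let ?A = "{z \<in> pts ?X. lambda1 z \<in> W_img}" and ?B = "{z \<in> pts ?X. snd z \<in> VC}"
  have "openin (zar ?X) ?A" "openin (zar ?X) ?B"
    using morphism_openin[OF morphism_lambda1 W_img_open] morphism_openin[OF s VC_open] by blast+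
  moreover have "?A \<noteq> {}"
  proof -
    obtain a where a: "a \<in> Wgood" using Wgood_avoid by blast
    then have "wcoords a \<in> pts Wo" using wcoords_in W_img_subset by blast
    then obtain w x t where z: "wcoords a = [w, x, t]" "t \<noteq> 0" "f3 t \<noteq> 0" "f6 t \<noteq> 0" unfolding pts_Wo by blast
    obtain y where "f3 t ^ 2 * f6 t = y ^ 6" by (rule exists_complex_root[of 6 "f3 t ^ 2 * f6 t"]) simp
    then have y: "[y, t] \<in> pts Co" using z unfolding pts_Co by simp
    have p: "(wcoords a, [y, t]) \<in> pts WCo"
      using \<open>wcoords a \<in> pts Wo\<close> y unfolding pts_WCo z(1) by blast
    have "(kappa1 (wcoords a, [y, t]), [y, t]) \<in> pts ?X"
      using kappa1_pts[OF p] y unfolding pts_fprod[OF ringed_circ(3,2)] by blast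
    moreover have "lambda1 (kappa1 (wcoords a, [y, t]), [y, t]) \<in> W_img"
      using lambda_kappa[OF p] wcoords_in[OF a] by simp
    ultimately show ?thesis by blast
  qed
  moreover have "?B \<noteq> {}"
  proof -
    obtain c where c: "c \<in> Cgood" using Cgood_avoid by blast
    have "[0, 0] \<in> pts D_circ" unfolding pts_Do by simp
    moreover have "\<phi> c \<in> pts Co" "\<phi> c \<in> VC" using c phi_in(1) by (simp_all add: Cgood_def)
    ultimately have "([0, 0], \<phi> c) \<in> ?B" unfolding pts_fprod[OF ringed_circ(3,2)] by simp
    then show ?thesis by blast
  qed
  ultimately have "?A \<inter> ?B \<noteq> {}"
    using irreducible_fprod[OF ringed_circ(3,2) irreducible_D_circ irreducible_Co] unfolding irreducible_fs_def by blast
  then obtain p b where pb: "(p, b) \<in> pts ?X" "lambda1 (p, b) \<in> W_img" "b \<in> VC" by auto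
  then have "(p, \<phi>' b) \<in> \<Omega>2"
    using phi_in(2) phi_eq(2) unfolding pts_fprod[OF ringed_circ(3,2)] by (auto simp: \<Omega>2_def Cgood_def lift_def)
  then show ?thesis by blast
qed

lemma birational_kappa_model: "birational_on WC (D \<times>\<^sub>v C) kappa_model \<Omega> \<Omega>'"
  unfolding birational_on_def
proof (intro conjI \<Omega>_dense)
  have "\<Omega>1 \<noteq> {}" using \<Omega>2_nonempty \<Lambda>_in(1) by blast
  then have "pts WC \<noteq> {}" using openin_subset[OF \<Omega>1_open] by blast
  then have "\<Omega> \<noteq> {}" using dense_openD[OF \<Omega>_dense openin_topspace] by blast
  then have "\<Omega>' \<noteq> {}" using kappa_model_in by blast
  with irreducible_fprod[OF _ _ irreducible_models(3,2)] \<Omega>'_open show "dense_open (D \<times>\<^sub>v C) \<Omega>'"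
    by (intro irreducible_dense_open) simp_all
  show "isomorphism (subspace_on WC \<Omega>) (subspace_on (D \<times>\<^sub>v C) \<Omega>') kappa_model"
    by (rule isomorphismI[OF _ _ morphism_kappa_model morphism_kappa_model_inv]) (simp_all add: kappa_model_inv_kappa_model kappa_model_kappa_model_inv)
qed

lemma kappa_birational: "kappa_defines_birational_map F3 F6 W \<rho> \<pi> C \<phi> UC \<tau> D \<psi> UD"
  unfolding kappa_defines_birational_map_def
proof (intro exI conjI, rule birational_kappa_model, clarify)
  fix a c assume \<omega>: "(a, c) \<in> \<Omega>"
  then have \<omega>1: "(a, c) \<in> \<Omega>1" and v: "\<Theta> (a, c) \<in> VD" by (auto simp: \<Omega>_def)
  then have a: "a \<in> Wgood" and c: "c \<in> Cgood" by (auto simp: \<Omega>1_def)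
  have p: "(wcoords a, \<phi> c) \<in> pts WCo" using \<theta>_pts[OF \<omega>1] by (simp add: \<theta>_def)
  show "\<exists>z d c'. double_plane_coords (\<rho> a) z \<and> c \<in> UC \<and>
           (z, \<phi> c) \<in> pts (WC_circ F3 F6) \<and>
           kappa_model (a, c) = (d, c') \<and> d \<in> UD \<and> c' \<in> UC \<and> (\<psi> d, \<phi> c') = kappa F3 (z, \<phi> c)"
  proof (intro exI conjI)
    show "double_plane_coords (\<rho> a) (wcoords a)" by (rule pi_wcoords(2)[OF a])
    show "(wcoords a, \<phi> c) \<in> pts (WC_circ F3 F6)" by (rule p)
    show "kappa_model (a, c) = (\<psi>' (\<Theta> (a, c)), c)" by (simp add: kappa_model_def)
    show "\<psi>' (\<Theta> (a, c)) \<in> UD" by (rule psi_in(2)[OF v])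
    show "c \<in> UC" "c \<in> UC" using c by (auto simp: Cgood_def)
    show "(\<psi> (\<psi>' (\<Theta> (a, c))), \<phi> c) = kappa F3 (wcoords a, \<phi> c)"
      unfolding psi_eq(2)[OF v] kappa_eq[OF p] by (simp add: \<Theta>_def \<theta>_def)
  qed
qed

end

theorem proposition4p1:
  fixes F3 F6 :: mpol
  assumes "(F3, F6) \<in> V_circ"
  shows "isomorphism (WC_circ F3 F6) (D_circ \<times>\<^sub>v C_circ F3 F6) (kappa F3) \<and>
    (\<forall>W \<rho> \<pi> C \<phi> UC \<tau> D \<psi> UD.
       minimal_resolution (S_surface (sextic F3 F6)) W \<rho> \<longrightarrow>
       induced_fibration W \<rho> \<pi> \<longrightarrow>
       smooth_projective_model (C_plane F3 F6) C \<phi> UC \<longrightarrow>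
       induced_cover C \<phi> UC \<tau> \<longrightarrow>
       smooth_projective_model D_circ D \<psi> UD \<longrightarrow>
       kappa_defines_birational_map F3 F6 W \<rho> \<pi> C \<phi> UC \<tau> D \<psi> UD)"
proof (intro conjI allI impI)
  interpret sextic_pair F3 F6 by unfold_locales (rule assms)
  show "isomorphism (WC_circ F3 F6) (D_circ \<times>\<^sub>v C_circ F3 F6) (kappa F3)" by (rule kappa_isomorphism)
  fix W \<rho> \<pi> C \<phi> UC \<tau> D \<psi> UD
  assume res: "minimal_resolution (S_surface (sextic F3 F6)) W \<rho>" and pi: "induced_fibration W \<rho> \<pi>"
    and modC: "smooth_projective_model (C_plane F3 F6) C \<phi> UC" and tau: "induced_cover C \<phi> UC \<tau>"
    and modD: "smooth_projective_model D_circ D \<psi> UD"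
  from res obtain UW VS where W: "projective_variety W" "smooth_of_dim 2 W" "morphism W SF \<rho>"
    and bW: "birational_on W SF \<rho> UW VS"
    unfolding minimal_resolution_def surface_resolution_def by blast
  from modC obtain VC where C: "projective_variety C" "smooth_of_dim 1 C"
    and bC: "birational_on C (C_plane F3 F6) \<phi> UC VC" unfolding smooth_projective_model_def by blast
  from modD obtain VD where D: "projective_variety D"
    and bD: "birational_on D D_circ \<psi> UD VD" unfolding smooth_projective_model_def by blast
  note r = projective_variety_ringed[OF W(1)] projective_variety_ringed[OF C(1)] projective_variety_ringed[OF D]
  have oW: "openin (zar W) UW" "dense_open SF VS" "openin (zar SF) VS"
    and oC: "openin (zar C) UC" "dense_open (C_plane F3 F6) VC" "openin (zar (C_plane F3 F6)) VC"
    and oD: "openin (zar D) UD" "dense_open D_circ VD" "openin (zar D_circ) VD"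
    using bW bC bD by (auto simp: birational_on_def dense_open_openin)
  have isos: "isomorphism (subspace_on W UW) (subspace_on SF VS) \<rho>"
    "isomorphism (subspace_on C UC) (subspace_on (C_plane F3 F6) VC) \<phi>"
    "isomorphism (subspace_on D UD) (subspace_on D_circ VD) \<psi>"
    using bW bC bD by (auto simp: birational_on_def)
  obtain \<rho>' where \<rho>': "morphism (subspace_on W UW) (subspace_on SF VS) \<rho>"
    "morphism (subspace_on SF VS) (subspace_on W UW) \<rho>'"
    "\<And>x. x \<in> UW \<Longrightarrow> \<rho> x \<in> VS" "\<And>y. y \<in> VS \<Longrightarrow> \<rho>' y \<in> UW"
    "\<And>x. x \<in> UW \<Longrightarrow> \<rho>' (\<rho> x) = x" "\<And>y. y \<in> VS \<Longrightarrow> \<rho> (\<rho>' y) = y"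
    by (rule isomorphism_of_open_subspaces[OF r(1) ringed_SF oW(1,3) isos(1)]) (rule that)
  obtain \<phi>' where \<phi>': "morphism (subspace_on C UC) (subspace_on (C_plane F3 F6) VC) \<phi>"
    "morphism (subspace_on (C_plane F3 F6) VC) (subspace_on C UC) \<phi>'"
    "\<And>x. x \<in> UC \<Longrightarrow> \<phi> x \<in> VC" "\<And>y. y \<in> VC \<Longrightarrow> \<phi>' y \<in> UC"
    "\<And>x. x \<in> UC \<Longrightarrow> \<phi>' (\<phi> x) = x" "\<And>y. y \<in> VC \<Longrightarrow> \<phi> (\<phi>' y) = y"
    by (rule isomorphism_of_open_subspaces[OF r(2) ringed_circ(4) oC(1,3) isos(2)]) (rule that)
  obtain \<psi>' where \<psi>': "morphism (subspace_on D UD) (subspace_on D_circ VD) \<psi>"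
    "morphism (subspace_on D_circ VD) (subspace_on D UD) \<psi>'"
    "\<And>x. x \<in> UD \<Longrightarrow> \<psi> x \<in> VD" "\<And>y. y \<in> VD \<Longrightarrow> \<psi>' y \<in> UD"
    "\<And>x. x \<in> UD \<Longrightarrow> \<psi>' (\<psi> x) = x" "\<And>y. y \<in> VD \<Longrightarrow> \<psi> (\<psi>' y) = y"
    by (rule isomorphism_of_open_subspaces[OF r(3) ringed_circ(3) oD(1,3) isos(3)]) (rule that)
  interpret model_data F3 F6 W \<rho> \<rho>' \<pi> UW VS C \<phi> \<phi>' \<tau> UC VC D \<psi> \<psi>' UD VD
    by unfold_locales (rule W C D oW oC oD \<rho>' \<phi>' \<psi>' pi tau | assumption)+
  show "kappa_defines_birational_map F3 F6 W \<rho> \<pi> C \<phi> UC \<tau> D \<psi> UD" by (rule kappa_birational)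
qed

end
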